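(* Let $S$ be a punctured surface of negative Euler characteristic $\chi(S)$, let $\mathcal T$ be an ideal triangulation of $S$, and let $\rho$ be a (marked, finite area) convex projective structure on $S$. Let $t_1,\dots,t_{-2\chi(S)}\in(0,\infty)$ be the triple ratios of $\rho$ associated to the $-2\chi(S)$ triangles of $\mathcal T$. Then the Holmes--Thompson area of $\rho$ satisfies \[ \mathrm{vol}^{\mathrm{HT}}(\rho)\ \ge\ \frac38\big(-2\pi\chi(S)\big)+\frac{3}{8\pi}\sum_{i=1}^{-2\chi(S)}\ln^2(t_i). \]
   Context: **Hilbert metric and Holmes--Thompson area.** A properly convex domain $\Omega\subset\mathbb{RP}^2$ is an open set whose closure lies in an affine chart in which $\Omega$ is convex. View $\Omega\subset\mathbb R^2$ in such a chart. For $p\in\Omega$, $0\ne\xi\in\mathbb R^2$, let $v^\pm\in\partial\Omega$ be the forward/backward intersection points with $\partial\Omega$ of the line through $p$ directed by $\xi$ and write $\xi=\sigma^+(v^+-p)=\sigma^-(p-v^-)$, $\sigma^\pm>0$; the Hilbert Finsler norm is $\|\xi\|_{\Omega,p}=\frac12(\sigma^++\sigma^-)$. With $B_p$ its closed unit ball and $B_p^*=\{\eta:\langle\eta,\xi\rangle\le1\ \forall\xi\in B_p\}$, the Holmes--Thompson area is $\mathrm{vol}^{\mathrm{HT}}_\Omega(X)=\frac1\pi\int_X|B^*_p|\,dp$; it is $\mathsf{PGL}_3(\mathbb R)$-invariant. **Convex projective structures.** A marked convex projective structure $\rho$ on $S$ is given by a representation $\pi_1(S)\to\mathsf{PGL}_3(\mathbb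 R)$ acting freely and properly discontinuously on a properly convex domain $\Omega_\rho$, with an identification of the universal cover of $S$ with $\Omega_\rho$ inducing $S\cong\Omega_\rho/\pi_1(S)$. Its Holmes--Thompson area $\mathrm{vol}^{\mathrm{HT}}(\rho)$ is the area of the quotient (of a fundamental domain). When this area is finite, every point of $\partial\Omega_\rho$ has a unique tangent line. **Triple ratios.** The ideal triangulation $\mathcal T$ (vertices at the punctures) lifts to a triangulation of $\Omega_\rho$ by ideal triangles with vertices in $\partial\Omega_\rho$. For a lifted triangle with vertices $x_1,x_2,x_3$ in cyclic order along $\partial\Omega_\rho$ (with respect to the orientation of $\Omega_\rho$), let $E,F,G$ be the flags in $\mathbb R^3$ given by the point $x_i$ and the tangent line to $\partial\Omega_\rho$ at $x_i$; represent a flag $F$ by vectors $(f_1,f_2)$ with $f_1$ spanning the point and $f_1,f_2$ spanning the line. The triple ratio of the triangle, which depends only on its image in $S$, is \[T(E,F,G)=\frac{e_1\wedge e_2\wedge f_1}{f_1\wedge g_1\wedge g_2}\cdot\frac{e_1\wedge g_1\wedge g_2}{e_1\wedge f_1\wedge f_2}\cdot\frac{f_1\wedge f_2\wedge g_1}{e_1\wedge e_2\wedge g_1}>0,\] where $u\wedge v\wedge w$ is read as $\det(u,v,w)$. *)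

theory Defs
  imports "HOL-Analysis.Analysis" "HOL-Algebra.Coset" "HOL-Algebra.Bij" "HOL-Homology.Homology"
begin

section \<open>The projective plane and its projective group\<close>

quotient_type rp2 = "real^3" / partial: "\<lambda>v w. v \<noteq> 0 \<and> w \<noteq> 0 \<and> (\<exists>c. w = c *\<^sub>R v)"
  morphisms rep_rp2 proj_pt
proof (rule part_equivpI)
  show "\<exists>x::real^3. x \<noteq> 0 \<and> x \<noteq> 0 \<and> (\<exists>c. x = c *\<^sub>R x)"
    by (rule exI[of _ "axis 1 1"]) (auto simp: axis_eq_0_iff intro: exI[of _ 1])
  show "symp (\<lambda>v w::real^3. v \<noteq> 0 \<and> w \<noteq> 0 \<and> (\<exists>c. w = c *\<^sub>R v))"
  proof (rule sympI)
    fix v w :: "real^3"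
    assume a: "v \<noteq> 0 \<and> w \<noteq> 0 \<and> (\<exists>c. w = c *\<^sub>R v)"
    then obtain c where c: "w = c *\<^sub>R v" by blast
    with a have "c \<noteq> 0" by auto
    with c have "v = inverse c *\<^sub>R w" by simp
    with a show "w \<noteq> 0 \<and> v \<noteq> 0 \<and> (\<exists>c. v = c *\<^sub>R w)" by blast
  qed
  show "transp (\<lambda>v w::real^3. v \<noteq> 0 \<and> w \<noteq> 0 \<and> (\<exists>c. w = c *\<^sub>R v))"
    by (rule transpI) (metis scaleR_scaleR)
qed

instantiation rp2 :: topological_space
begin

definition open_rp2 :: "rp2 set \<Rightarrow> bool" where
  "open_rp2 W \<longleftrightarrow> open {v. v \<noteq> 0 \<and> proj_pt v \<in> W}"

instance
proof
  have "{v::real^3. v \<noteq> 0 \<and> proj_pt v \<in> UNIV} = - {0}" by auto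
  then show "open (UNIV :: rp2 set)"
    by (simp add: open_rp2_def open_Compl)
next
  fix S T :: "rp2 set"
  assume "open S" "open T"
  moreover have "{v::real^3. v \<noteq> 0 \<and> proj_pt v \<in> S \<inter> T} =
      {v. v \<noteq> 0 \<and> proj_pt v \<in> S} \<inter> {v. v \<noteq> 0 \<and> proj_pt v \<in> T}" by auto
  ultimately show "open (S \<inter> T)" unfolding open_rp2_def by (simp add: open_Int)
next
  fix K :: "rp2 set set"
  assume "\<forall>S\<in>K. open S"
  moreover have "{v::real^3. v \<noteq> 0 \<and> proj_pt v \<in> \<Union>K} =
      (\<Union>S\<in>K. {v. v \<noteq> 0 \<and> proj_pt v \<in> S})" by auto
  ultimately show "open (\<Union>K)" unfolding open_rp2_def by (simp add: open_UN)
qed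

end

definition GL3 :: "(real^3^3) monoid" where
  "GL3 = \<lparr>carrier = {M. invertible M}, mult = (**), one = mat 1\<rparr>"

definition PGL3 :: "(real^3^3) set monoid" where
  "PGL3 = GL3 Mod {mat c | c. c \<noteq> 0}"

text \<open>The value does not depend on the representatives chosen when \<open>g\<close> is in the carrier of
  \<open>PGL3\<close>.\<close>

definition pgl_act :: "(real^3^3) set \<Rightarrow> rp2 \<Rightarrow> rp2" where
  "pgl_act g x = proj_pt ((SOME M. M \<in> g) *v rep_rp2 x)"

section \<open>Properly convex domains\<close>

definition aff_chart :: "real^3^3 \<Rightarrow> real^2 \<Rightarrow> rp2" where
  "aff_chart A x = proj_pt (A *v vector [x $ 1, x $ 2, 1])"

text \<open>As \<open>A\<close> ranges over the invertible matrices, \<open>aff_chart A\<close> ranges over the (inverses of)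
  affine charts of the projective plane. A chart as below also orients \<open>\<Omega>\<close>, by the standard
  orientation of \<open>real^2\<close>, and both orientations of \<open>\<Omega>\<close> arise in this way.\<close>

definition convex_chart :: "real^3^3 \<Rightarrow> rp2 set \<Rightarrow> bool" where
  "convex_chart A \<Omega> \<longleftrightarrow>
     invertible A \<and> closure \<Omega> \<subseteq> range (aff_chart A) \<and> convex (aff_chart A -` \<Omega>)"

definition properly_convex :: "rp2 set \<Rightarrow> bool" where
  "properly_convex \<Omega> \<longleftrightarrow> open \<Omega> \<and> \<Omega> \<noteq> {} \<and> (\<exists>A. convex_chart A \<Omega>)"

section \<open>Hilbert metric and Holmes--Thompson area in a chart\<close>

definition sigma_plus :: "(real^2) set \<Rightarrow> real^2 \<Rightarrow> real^2 \<Rightarrow> real" where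
  "sigma_plus D p \<xi> = (THE s. s > 0 \<and> (\<exists>v \<in> frontier D. \<xi> = s *\<^sub>R (v - p)))"

definition sigma_minus :: "(real^2) set \<Rightarrow> real^2 \<Rightarrow> real^2 \<Rightarrow> real" where
  "sigma_minus D p \<xi> = (THE s. s > 0 \<and> (\<exists>v \<in> frontier D. \<xi> = s *\<^sub>R (p - v)))"

definition hilbert_norm :: "(real^2) set \<Rightarrow> real^2 \<Rightarrow> real^2 \<Rightarrow> real" where
  "hilbert_norm D p \<xi> = (if \<xi> = 0 then 0 else (sigma_plus D p \<xi> + sigma_minus D p \<xi>) / 2)"

definition hilbert_ball :: "(real^2) set \<Rightarrow> real^2 \<Rightarrow> (real^2) set" where
  "hilbert_ball D p = {\<xi>. hilbert_norm D p \<xi> \<le> 1}"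

definition hilbert_dual_ball :: "(real^2) set \<Rightarrow> real^2 \<Rightarrow> (real^2) set" where
  "hilbert_dual_ball D p = {\<eta>. \<forall>\<xi> \<in> hilbert_ball D p. \<eta> \<bullet> \<xi> \<le> 1}"

definition holmes_thompson :: "(real^2) set \<Rightarrow> (real^2) set \<Rightarrow> ennreal" where
  "holmes_thompson D Y =
     ennreal (1 / pi) * (\<integral>\<^sup>+ p\<in>Y. emeasure lebesgue (hilbert_dual_ball D p) \<partial>lebesgue)"

definition HT_area :: "real^3^3 \<Rightarrow> rp2 set \<Rightarrow> rp2 set \<Rightarrow> ennreal" where
  "HT_area A \<Omega> Y = holmes_thompson (aff_chart A -` \<Omega>) (aff_chart A -` Y)"

section \<open>Punctured surfaces and Euler characteristic\<close>

definition closed_surface :: "'s::t2_space set \<Rightarrow> bool" where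
  "closed_surface X \<longleftrightarrow> compact X \<and> connected X \<and>
     (\<forall>x\<in>X. \<exists>N. openin (top_of_set X) N \<and> x \<in> N \<and>
        (\<exists>V :: (real^2) set. open V \<and> N homeomorphic V))"

text \<open>\<open>S\<close> is the complement of the finite nonempty set \<open>P\<close> in the closed surface \<open>X\<close>.\<close>

definition punctured_surface :: "'s::t2_space set \<Rightarrow> 's set \<Rightarrow> 's set \<Rightarrow> bool" where
  "punctured_surface S X P \<longleftrightarrow>
     closed_surface X \<and> finite P \<and> P \<noteq> {} \<and> P \<subseteq> X \<and> S = X - P"

text \<open>The rank of an abelian group is the largest size of a finite subset that is linearly
  independent over the integers; it is meaningful only if these sizes are bounded.\<close>

definition int_independent :: "('a, 'b) monoid_scheme \<Rightarrow> 'a set \<Rightarrow> bool" where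
  "int_independent G B \<longleftrightarrow> finite B \<and> B \<subseteq> carrier G \<and>
     (\<forall>n :: 'a \<Rightarrow> int. finprod G (\<lambda>b. b [^]\<^bsub>G\<^esub> n b) B = \<one>\<^bsub>G\<^esub> \<longrightarrow> (\<forall>b\<in>B. n b = 0))"

definition group_rank :: "('a, 'b) monoid_scheme \<Rightarrow> nat" where
  "group_rank G = Sup (card ` {B. int_independent G B})"

definition euler_char :: "'a topology \<Rightarrow> int" where
  "euler_char X =
     (\<Sum>p | group_rank (homology_group p X) \<noteq> 0.
        (-1) ^ nat p * int (group_rank (homology_group p X)))"

section \<open>Marked convex projective structures\<close>

definition universal_cover :: "'u::topological_space set \<Rightarrow> ('u \<Rightarrow> 's::topological_space) \<Rightarrow> 's set \<Rightarrow> bool"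
  where "universal_cover U q S \<longleftrightarrow> covering_space U q S \<and> simply_connected U"

text \<open>The fundamental group of \<open>S\<close>, as the group of deck transformations of its universal cover.\<close>

definition deck_group :: "'u::topological_space set \<Rightarrow> ('u \<Rightarrow> 's) \<Rightarrow> ('u \<Rightarrow> 'u) monoid" where
  "deck_group U q = (BijGroup U)\<lparr>carrier :=
     {\<gamma> \<in> Bij U. (\<exists>\<delta>. homeomorphism U U \<gamma> \<delta>) \<and> (\<forall>u\<in>U. q (\<gamma> u) = q u)}\<rparr>"

text \<open>\<open>hol\<close> is the representation and \<open>dev\<close> the identification of the universal cover with \<open>\<Omega>\<close>.
  The last condition says that the fibres of \<open>q\<close> correspond to the orbits in \<open>\<Omega>\<close>; since \<open>q\<close> is an
  open map, \<open>dev\<close> then induces a homeomorphism from \<open>S\<close> to the quotient of \<open>\<Omega>\<close>.\<close>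

definition marked_convex_projective_structure ::
  "'u::topological_space set \<Rightarrow> ('u \<Rightarrow> 's) \<Rightarrow> rp2 set \<Rightarrow> (('u \<Rightarrow> 'u) \<Rightarrow> (real^3^3) set) \<Rightarrow> ('u \<Rightarrow> rp2) \<Rightarrow> bool"
  where
  "marked_convex_projective_structure U q \<Omega> hol dev \<longleftrightarrow>
     properly_convex \<Omega> \<and>
     hol \<in> hom (deck_group U q) PGL3 \<and>
     (\<forall>\<gamma> \<in> carrier (deck_group U q). pgl_act (hol \<gamma>) ` \<Omega> = \<Omega>) \<and>
     (\<forall>\<gamma> \<in> carrier (deck_group U q). \<gamma> \<noteq> \<one>\<^bsub>deck_group U q\<^esub> \<longrightarrow>
        (\<forall>x\<in>\<Omega>. pgl_act (hol \<gamma>) x \<noteq> x)) \<and>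
     (\<forall>K \<subseteq> \<Omega>. compact K \<longrightarrow>
        finite {\<gamma> \<in> carrier (deck_group U q). pgl_act (hol \<gamma>) ` K \<inter> K \<noteq> {}}) \<and>
     (\<exists>vde. homeomorphism U \<Omega> dev vde) \<and>
     (\<forall>\<gamma> \<in> carrier (deck_group U q). \<forall>u\<in>U. dev (\<gamma> u) = pgl_act (hol \<gamma>) (dev u)) \<and>
     (\<forall>u\<in>U. \<forall>v\<in>U. q u = q v \<longleftrightarrow>
        (\<exists>\<gamma> \<in> carrier (deck_group U q). pgl_act (hol \<gamma>) (dev u) = dev v))"

text \<open>Null sets are taken in a chart; being null is a projectively invariant notion.\<close>

definition fundamental_domain ::
  "'u::topological_space set \<Rightarrow> ('u \<Rightarrow> 's) \<Rightarrow> rp2 set \<Rightarrow> (('u \<Rightarrow> 'u) \<Rightarrow> (real^3^3) set) \<Rightarrow>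
   real^3^3 \<Rightarrow> rp2 set \<Rightarrow> bool"
  where
  "fundamental_domain U q \<Omega> hol A F \<longleftrightarrow>
     F \<subseteq> \<Omega> \<and> aff_chart A -` F \<in> sets lebesgue \<and>
     negligible (aff_chart A -` (\<Omega> - (\<Union>\<gamma> \<in> carrier (deck_group U q). pgl_act (hol \<gamma>) ` F))) \<and>
     (\<forall>\<gamma> \<in> carrier (deck_group U q). \<gamma> \<noteq> \<one>\<^bsub>deck_group U q\<^esub> \<longrightarrow>
        negligible (aff_chart A -` (F \<inter> pgl_act (hol \<gamma>) ` F)))"

section \<open>Ideal triangulations\<close>

definition model_triangle :: "(real^3) set" where
  "model_triangle = {z. (\<forall>k. z $ k \<ge> 0) \<and> (\<Sum>k\<in>UNIV. z $ k) = 1}"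

definition triangle_vertices :: "(real^3) set" where
  "triangle_vertices = range (\<lambda>k. axis k 1)"

definition triangle_edge :: "3 \<Rightarrow> (real^3) set" where
  "triangle_edge k = {z \<in> model_triangle. z $ k = 0 \<and> (\<forall>l. l \<noteq> k \<longrightarrow> z $ l > 0)}"

definition triangle_interior :: "(real^3) set" where
  "triangle_interior = {z \<in> model_triangle. \<forall>k. z $ k > 0}"

definition model_ideal_triangle :: "(real^3) set" where
  "model_ideal_triangle = model_triangle - triangle_vertices"

text \<open>The maps \<open>\<tau> i\<close>, \<open>i \<in> I\<close>, are the characteristic maps of the triangles of a triangulation of
  \<open>X\<close> (in the weak sense that sides of one triangle may be glued to each other, and that distinct
  triangles may share several vertices or sides) whose vertex set is \<open>P\<close>.\<close>

definition ideal_triangulation ::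
  "'s::t2_space set \<Rightarrow> 's set \<Rightarrow> nat set \<Rightarrow> (nat \<Rightarrow> real^3 \<Rightarrow> 's) \<Rightarrow> bool"
  where
  "ideal_triangulation X P I \<tau> \<longleftrightarrow>
     finite I \<and>
     (\<forall>i\<in>I. continuous_on model_triangle (\<tau> i) \<and> \<tau> i ` triangle_vertices \<subseteq> P \<and> \<tau> i ` model_ideal_triangle \<subseteq> X - P) \<and>
     (\<Union>i\<in>I. \<tau> i ` model_triangle) = X \<and>
     inj_on (\<lambda>(i, z). \<tau> i z) (I \<times> triangle_interior) \<and>
     (\<forall>i\<in>I. \<forall>k. inj_on (\<tau> i) (triangle_edge k)) \<and>
     (\<forall>i\<in>I. \<forall>j\<in>I. \<forall>k. \<tau> i ` triangle_interior \<inter> \<tau> j ` triangle_edge k = {}) \<and>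
     (\<forall>i\<in>I. \<forall>j\<in>I. \<forall>k l. \<tau> i ` triangle_edge k = \<tau> j ` triangle_edge l \<or>
        \<tau> i ` triangle_edge k \<inter> \<tau> j ` triangle_edge l = {})"

definition isotopic_to_id_rel :: "'s::t2_space set \<Rightarrow> 's set \<Rightarrow> ('s \<Rightarrow> 's) \<Rightarrow> bool" where
  "isotopic_to_id_rel X P h \<longleftrightarrow>
     (\<exists>H :: real \<times> 's \<Rightarrow> 's. continuous_on ({0..1} \<times> X) H \<and>
        (\<forall>t\<in>{0..1}. (\<exists>g. homeomorphism X X (\<lambda>x. H (t, x)) g) \<and> (\<forall>p\<in>P. H (t, p) = p)) \<and>
        (\<forall>x\<in>X. H (0, x) = x \<and> H (1, x) = h x))"

definition lift_of :: "'u::topological_space set \<Rightarrow> ('u \<Rightarrow> 's) \<Rightarrow> (real^3 \<Rightarrow> 's) \<Rightarrow> (real^3 \<Rightarrow> 'u) \<Rightarrow> bool"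
  where
  "lift_of U q f s \<longleftrightarrow> continuous_on model_ideal_triangle s \<and> s ` model_ideal_triangle \<subseteq> U \<and>
     (\<forall>z \<in> model_ideal_triangle. q (s z) = f z)"

text \<open>\<open>T\<close> is the straight triangle with (omitted) vertices \<open>x\<^sub>1\<close>, \<open>x\<^sub>2\<close>, \<open>x\<^sub>3\<close> on the boundary, in
  positive cyclic order with respect to the orientation given by the chart.\<close>

definition ideal_triangle ::
  "real^3^3 \<Rightarrow> rp2 set \<Rightarrow> rp2 set \<Rightarrow> real^2 \<Rightarrow> real^2 \<Rightarrow> real^2 \<Rightarrow> bool"
  where
  "ideal_triangle A \<Omega> T x1 x2 x3 \<longleftrightarrow>
     {x1, x2, x3} \<subseteq> frontier (aff_chart A -` \<Omega>) \<and>
     (x2 $ 1 - x1 $ 1) * (x3 $ 2 - x1 $ 2) - (x2 $ 2 - x1 $ 2) * (x3 $ 1 - x1 $ 1) > 0 \<and>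
     T = aff_chart A ` (convex hull {x1, x2, x3} - {x1, x2, x3}) \<and> T \<subseteq> \<Omega>"

text \<open>An ideal triangulation of \<open>S\<close> matters only up to isotopy. The homeomorphism \<open>h\<close> moves the
  triangulation \<open>\<tau>\<close> to a geodesic one, i.e. one that lifts to a triangulation of \<open>\<Omega>\<close> by ideal
  triangles.\<close>

definition straightening ::
  "'s::t2_space set \<Rightarrow> 's set \<Rightarrow> 'u::topological_space set \<Rightarrow> ('u \<Rightarrow> 's) \<Rightarrow> rp2 set \<Rightarrow> ('u \<Rightarrow> rp2) \<Rightarrow>
   real^3^3 \<Rightarrow> nat set \<Rightarrow> (nat \<Rightarrow> real^3 \<Rightarrow> 's) \<Rightarrow> ('s \<Rightarrow> 's) \<Rightarrow> bool"
  where
  "straightening X P U q \<Omega> dev A I \<tau> h \<longleftrightarrow>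
     isotopic_to_id_rel X P h \<and>
     (\<forall>i\<in>I. \<forall>s. lift_of U q (h \<circ> \<tau> i) s \<longrightarrow>
        (\<exists>x1 x2 x3. ideal_triangle A \<Omega> (dev ` s ` model_ideal_triangle) x1 x2 x3))"

section \<open>Triple ratios\<close>

definition det3 :: "real^3 \<Rightarrow> real^3 \<Rightarrow> real^3 \<Rightarrow> real" where
  "det3 u v w = det (vector [u, v, w] :: real^3^3)"

definition flag_triple_ratio ::
  "real^3 \<Rightarrow> real^3 \<Rightarrow> real^3 \<Rightarrow> real^3 \<Rightarrow> real^3 \<Rightarrow> real^3 \<Rightarrow> real"
  where
  "flag_triple_ratio e1 e2 f1 f2 g1 g2 =
     (det3 e1 e2 f1 / det3 f1 g1 g2) * (det3 e1 g1 g2 / det3 e1 f1 f2) *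
     (det3 f1 f2 g1 / det3 e1 e2 g1)"

text \<open>\<open>(e1, e2)\<close> represents the flag of a boundary point \<open>x\<close> and a line through \<open>x\<close> tangent to
  the boundary of \<open>\<Omega>\<close>. A tangent line at a boundary point of a convex domain is a line through
  that point that misses the domain; it is unique for structures of finite area.\<close>

definition tangent_flag :: "rp2 set \<Rightarrow> rp2 \<Rightarrow> real^3 \<Rightarrow> real^3 \<Rightarrow> bool" where
  "tangent_flag \<Omega> x e1 e2 \<longleftrightarrow>
     e1 \<noteq> 0 \<and> proj_pt e1 = x \<and> e2 \<notin> span {e1} \<and>
     (\<forall>v \<in> span {e1, e2}. v \<noteq> 0 \<longrightarrow> proj_pt v \<notin> \<Omega>)"

definition is_triple_ratio ::
  "real^3^3 \<Rightarrow> rp2 set \<Rightarrow> rp2 set \<Rightarrow> real \<Rightarrow> bool"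
  where
  "is_triple_ratio A \<Omega> T t \<longleftrightarrow>
     (\<exists>x1 x2 x3 e1 e2 f1 f2 g1 g2.
        ideal_triangle A \<Omega> T x1 x2 x3 \<and>
        tangent_flag \<Omega> (aff_chart A x1) e1 e2 \<and>
        tangent_flag \<Omega> (aff_chart A x2) f1 f2 \<and>
        tangent_flag \<Omega> (aff_chart A x3) g1 g2 \<and>
        t = flag_triple_ratio e1 e2 f1 f2 g1 g2)"

text \<open>The triple ratio of the \<open>i\<close>-th triangle, computed from some lift (all lifts give the same
  value when the holonomy preserves the orientation of \<open>\<Omega>\<close>, and values \<open>t\<close> or \<open>1 / t\<close>
  otherwise).\<close>

definition triangle_triple_ratio ::
  "'u::topological_space set \<Rightarrow> ('u \<Rightarrow> 's) \<Rightarrow> rp2 set \<Rightarrow> ('u \<Rightarrow> rp2) \<Rightarrow>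
   real^3^3 \<Rightarrow> (real^3 \<Rightarrow> 's) \<Rightarrow> real \<Rightarrow> bool"
  where
  "triangle_triple_ratio U q \<Omega> dev A f t \<longleftrightarrow>
     (\<exists>s. lift_of U q f s \<and> is_triple_ratio A \<Omega> (dev ` s ` model_ideal_triangle) t)"

end

theory Submission
  imports Defs "HOL-Real_Asymp.Real_Asymp"
begin

text \<open>Let \<open>l\<^sub>1\<close>, \<open>l\<^sub>2\<close>, \<open>l\<^sub>3\<close> be linear forms that cut out the tangent lines at the vertices
  of a lifted ideal triangle. None of them vanishes on \<open>\<Omega>\<close>, so the dual Hilbert ball at \<open>p\<close> contains
  the hexagon with vertices \<open>(\<alpha>\<^sub>i - \<alpha>\<^sub>j) / 2\<close>, where \<open>\<alpha>\<^sub>i\<close> is the logarithmic derivative of \<open>l\<^sub>i\<close> at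
  \<open>p\<close>. Its area is \<open>3 / 4\<close> times the Jacobian of the map \<open>\<Phi> = (ln \<bar>l\<^sub>1 / l\<^sub>3\<bar>, ln \<bar>l\<^sub>2 / l\<^sub>3\<bar>)\<close>. The image of
  the triangle under \<open>\<Phi>\<close> is, up to translation, the region
  \<open>e\<^sup>u + e\<^sup>v > 1\<close>, \<open>e\<^sup>u < 1 + s e\<^sup>v\<close>, \<open>e\<^sup>v < 1 + e\<^sup>u / s\<close> with \<open>s\<close> the inverse of the triple ratio, and a
  dilogarithm computation gives its area \<open>(\<pi>\<^sup>2 + ln\<^sup>2 s) / 2\<close>. Since the pull-back of the \<open>l\<^sub>i\<close> by the
  holonomy again consists of forms without zeros on \<open>\<Omega>\<close>, the same estimate applies, inside a
  fundamental domain, to the translates of the pieces into which its orbit cuts the triangles. That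
  the lifted interiors
  fill the straight triangles, with no area lost along the lifted edges, follows from invariance of
  domain: each straight side must be the lift of an edge.\<close>

subsection \<open>Integrals of dilogarithm type\<close>

text \<open>The factor 3 / 4 comes from polar bodies. \<open>sigma_plus\<close> is the gauge of the
  domain seen from p, so the Hilbert norm is the average of a gauge and its reflection, and its dual
  ball is half the difference body of the polar body at p. A line that misses the domain gives a
  point of that polar body, so three lines give a triangle in it. Half the difference body of a
  triangle is a hexagon of 3 / 2 times its area, and the area of the triangle is half the Jacobian.

  Two obstacles shape the rest. The area is an integral over an arbitrary measurable fundamental
  domain, which need not consist of triangles. And the triangulation is only topological: a lifted
  edge is an arc, arcs can have positive area, and nothing says beforehand that the edges of the
  model go to straight sides; two sides of one triangle may even be glued in the surface. Measure
  theory alone therefore cannot discard the edges.\<close>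

lemma neg_ln_one_minus_ennreal:
  fixes x :: real
  assumes "0 < x" "x < 1"
  shows "ennreal (- ln (1 - x)) = suminf (\<lambda>n. ennreal (x ^ Suc n / real (Suc n)))"
proof -
  have "(\<lambda>n. - (x ^ n / real n)) sums ln (1 - x)"
    using ln_series'[of "-x"] assms by simp
  then have "(\<lambda>n. x ^ n / real n) sums (- ln (1 - x))"
    using sums_minus by fastforce
  then have "(\<lambda>n. x ^ Suc n / real (Suc n)) sums (- ln (1 - x))"
    by (subst sums_Suc_iff) simp
  then show ?thesis
    using assms by (intro suminf_ennreal_eq[symmetric]) auto
qed

lemma nn_integral_exp_Ici:
  fixes a :: real assumes "a > 0"
  shows "(\<integral>\<^sup>+u. ennreal (exp (- (a * u))) * indicator {0..} u \<partial>lborel) = ennreal (1 / a)"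
proof -
  have "(\<integral>\<^sup>+u. ennreal (exp (- (a * u))) * indicator {0..} u \<partial>lborel) = 0 - (- exp (- (a * 0)) / a)"
  proof (rule nn_integral_FTC_atLeast)
    show "((\<lambda>u. - exp (- (a * u)) / a) has_real_derivative exp (- (a * u))) (at u)" for u
      using assms by (auto intro!: derivative_eq_intros)
    have "((\<lambda>u. exp (- (a * u))) \<longlongrightarrow> 0) at_top"
      using assms by real_asymp
    from tendsto_mult_right[OF this, of "-1/a"]
    show "((\<lambda>u. - exp (- (a * u)) / a) \<longlongrightarrow> 0) at_top" by simp
  qed auto
  then show ?thesis by simp
qed

text \<open>With x = exp (- u) this is Li_2 (1) = zeta (2). The power series of the logarithm has
  nonnegative terms, so it may be integrated term by term, and the terms integrate to the inverse
  squares.\<close>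

lemma nn_integral_neg_ln_one_minus_exp:
  "(\<integral>\<^sup>+u. ennreal (- ln (1 - exp (- u))) * indicator {0<..} u \<partial>lborel) = ennreal (pi\<^sup>2 / 6)"
proof -
  have "(\<integral>\<^sup>+u. ennreal (- ln (1 - exp (- u))) * indicator {0<..} u \<partial>lborel) =
    (\<integral>\<^sup>+u. (suminf (\<lambda>n. ennreal (exp (- u) ^ Suc n / real (Suc n)) * indicator {0..} u)) \<partial>lborel)"
  \<comment> \<open>The point 0 is discarded because the left side lives on the open ray and the
    terms of the series on the closed one.\<close>
  proof (rule nn_integral_cong_AE, use AE_lborel_singleton[of "0::real"] in eventually_elim)
    case (elim u)
    show ?case
    proof (cases "u > 0")
      case True
      then have ind: "indicator {0<..} u = (1::ennreal)" "indicator {0..} u = (1::ennreal)" by auto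
      show ?thesis
        unfolding ind mult_1_right by (rule neg_ln_one_minus_ennreal) (use True in auto)
    qed (use elim in auto)
  qed
  also have "\<dots> = suminf (\<lambda>n. \<integral>\<^sup>+u. ennreal (exp (- u) ^ Suc n / real (Suc n)) * indicator {0..} u \<partial>lborel)"
    by (intro nn_integral_suminf) measurable
  also have "\<dots> = suminf (\<lambda>n. ennreal (1 / (real n + 1)\<^sup>2))"
  proof (rule suminf_cong)
    fix n
    have "(\<integral>\<^sup>+u. ennreal (exp (- u) ^ Suc n / real (Suc n)) * indicator {0..} u \<partial>lborel)
      = (\<integral>\<^sup>+u. ennreal (1 / (real n + 1)) * (ennreal (exp (- ((real n + 1) * u))) * indicator {0..} u) \<partial>lborel)"
    proof (rule nn_integral_cong)
      fix u :: real
      have "exp (- u) ^ Suc n = exp (- ((real n + 1) * u))"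
        by (subst exp_of_nat_mult[symmetric]) (simp add: algebra_simps)
      then have "ennreal (exp (- u) ^ Suc n / real (Suc n)) =
          ennreal (1 / (real n + 1)) * ennreal (exp (- ((real n + 1) * u)))"
        by (subst ennreal_mult[symmetric]) (auto simp: add.commute simp del: power_Suc)
      then show "ennreal (exp (- u) ^ Suc n / real (Suc n)) * indicator {0..} u =
          ennreal (1 / (real n + 1)) * (ennreal (exp (- ((real n + 1) * u))) * indicator {0..} u)"
        by (simp add: mult.assoc)
    qed
    also have "\<dots> = ennreal (1 / (real n + 1)) * ennreal (1 / (real n + 1))"
      by (subst nn_integral_cmult) (auto simp: nn_integral_exp_Ici)
    also have "\<dots> = ennreal (1 / (real n + 1)\<^sup>2)"
      by (subst ennreal_mult[symmetric]) (auto simp: power2_eq_square)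
    finally show "(\<integral>\<^sup>+u. ennreal (exp (- u) ^ Suc n / real (Suc n)) * indicator {0..} u \<partial>lborel)
      = ennreal (1 / (real n + 1)\<^sup>2)" .
  qed
  also have "\<dots> = ennreal (pi\<^sup>2 / 6)"
    using inverse_squares_sums by (intro suminf_ennreal_eq) (auto simp: add.commute)
  finally show ?thesis .
qed

text \<open>This is - Li_2 (- s), by the substitution x = exp (- u).\<close>

definition ln_tail_integral :: "real \<Rightarrow> ennreal" where
  "ln_tail_integral s = (\<integral>\<^sup>+u. ennreal (ln (1 + s * exp (- u))) * indicator {0<..} u \<partial>lborel)"

text \<open>The identity 1 - x^2 = (1 - x) (1 + x) splits the integrand for zeta (2) at
  \<open>u\<close> into the same integrand at \<open>2 * u\<close>, which contributes half of pi^2 /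
  6, and the wanted one.\<close>

lemma ln_tail_integral_1: "ln_tail_integral 1 = ennreal (pi\<^sup>2 / 12)"
proof -
  let ?K = "\<lambda>u. ennreal (- ln (1 - exp (- u))) * indicator {0<..} (u::real)"
  have "(\<integral>\<^sup>+u. ?K u \<partial>lborel) = ennreal \<bar>2\<bar> * (\<integral>\<^sup>+u. ?K (0 + 2 * u) \<partial>lborel)"
    by (rule nn_integral_real_affine) auto
  then have "ennreal 2 * (\<integral>\<^sup>+u. ?K (2 * u) \<partial>lborel) = ennreal (pi\<^sup>2 / 6)"
    by (simp add: nn_integral_neg_ln_one_minus_exp)
  also have "\<dots> = ennreal 2 * ennreal (pi\<^sup>2 / 12)"
    by (subst ennreal_mult[symmetric]) auto
  finally have half: "(\<integral>\<^sup>+u. ?K (2 * u) \<partial>lborel) = ennreal (pi\<^sup>2 / 12)"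
    by (subst (asm) ennreal_mult_cancel_left) auto
  have "ennreal (pi\<^sup>2 / 6) = (\<integral>\<^sup>+u. ?K (2 * u) + ennreal (ln (1 + 1 * exp (- u))) * indicator {0<..} u \<partial>lborel)"
    unfolding nn_integral_neg_ln_one_minus_exp[symmetric]
  proof (rule nn_integral_cong)
    fix u :: real
    have "?K u = ennreal (- ln (1 - exp (- (2 * u))) + ln (1 + exp (- u)))" if "u > 0"
    proof -
      have "1 - exp (- (2 * u)) = (1 - exp (- u)) * (1 + exp (- u))"
        by (simp add: algebra_simps exp_add[symmetric])
      then have "- ln (1 - exp (- (2 * u))) + ln (1 + exp (- u)) = - ln (1 - exp (- u))"
        using that by (subst \<open>1 - exp (- (2 * u)) = _\<close>, subst ln_mult) (auto intro: add_pos_pos)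
      then show ?thesis using that by simp
    qed
    moreover have "- ln (1 - exp (- (2 * u))) \<ge> 0" if "u > 0" using that by simp
    ultimately show "?K u = ?K (2 * u) + ennreal (ln (1 + 1 * exp (- u))) * indicator {0<..} u"
      by (cases "u > 0") (auto simp: ennreal_plus[symmetric] simp del: ennreal_plus)
  qed
  also have "\<dots> = (\<integral>\<^sup>+u. ?K (2 * u) \<partial>lborel) + ln_tail_integral 1"
    unfolding ln_tail_integral_def by (rule nn_integral_add) auto
  finally have "ennreal (pi\<^sup>2 / 12) + ennreal (pi\<^sup>2 / 12) = ennreal (pi\<^sup>2 / 12) + ln_tail_integral 1"
    unfolding half by (subst ennreal_plus[symmetric]) auto
  then show ?thesis
    by (subst (asm) ennreal_add_left_cancel) auto
qed

text \<open>The functional equation of the dilogarithm: a translation of the variable by \<open>ln s\<close> and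
  \<open>ln (1 + exp w) = w + ln (1 + exp (- w))\<close>.\<close>

lemma ln_tail_integral_reciprocal_aux:
  assumes "s \<ge> 1"
  shows "ln_tail_integral s + ln_tail_integral (1 / s) = ennreal (pi\<^sup>2 / 6 + (ln s)\<^sup>2 / 2)"
proof -
  define a where "a = ln s"
  have a: "a \<ge> 0" "exp a = s" using assms by (auto simp: a_def)
  let ?l = "\<lambda>w::real. ennreal (ln (1 + exp (- w)))"
  have shift: "s * exp (- (a + w)) = exp (- w)" "1 / s * exp (- (- a + w)) = exp (- w)" for w
  proof -
    have "s * exp (- (a + w)) = exp (a + - (a + w))" by (simp only: a(2)[symmetric] exp_add)
    then show "s * exp (- (a + w)) = exp (- w)" by simp
    have "1 / s * exp (- (- a + w)) = exp (- a) * exp (- (- a + w))"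
      by (simp only: a(2)[symmetric] exp_minus inverse_eq_divide)
    then show "1 / s * exp (- (- a + w)) = exp (- w)" by (simp only: exp_add[symmetric]) simp
  qed
  have "ln_tail_integral s = ennreal \<bar>1\<bar> * (\<integral>\<^sup>+u. ennreal (ln (1 + s * exp (- (a + 1 * u)))) * indicator {0<..} (a + 1 * u) \<partial>lborel)"
    unfolding ln_tail_integral_def by (rule nn_integral_real_affine) auto
  also have "\<dots> = (\<integral>\<^sup>+w. ?l w * indicator {0<..} w + ?l w * indicator {-a<..0} w \<partial>lborel)"
    unfolding mult_1 shift using a by (auto intro!: nn_integral_cong simp: indicator_def)
  also have "\<dots> = ln_tail_integral 1 + (\<integral>\<^sup>+w. ?l w * indicator {-a<..0} w \<partial>lborel)"
    unfolding ln_tail_integral_def by (subst nn_integral_add) auto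
  also have "(\<integral>\<^sup>+w. ?l w * indicator {-a<..0} w \<partial>lborel) =
     ennreal \<bar>-1\<bar> * (\<integral>\<^sup>+w. ?l (0 + (-1) * w) * indicator {-a<..0} (0 + (-1) * w) \<partial>lborel)"
    by (rule nn_integral_real_affine) auto
  also have "\<dots> = (\<integral>\<^sup>+w. ennreal w * indicator {0..a} w + ?l w * indicator {0<..a} w \<partial>lborel)"
    unfolding abs_minus_cancel abs_1 mult_1 ennreal_1
  proof (rule nn_integral_cong_AE, use AE_lborel_singleton[of "0::real"] AE_lborel_singleton[of a] in eventually_elim)
    case (elim w)
    have "ln (1 + exp w) = w + ln (1 + exp (- w))"
    proof -
      have "1 + exp w = exp w * (1 + exp (- w))" by (simp add: algebra_simps exp_minus)
      moreover have "1 + exp (- w) \<noteq> 0" by (metis add_pos_pos exp_gt_zero less_irrefl zero_less_one)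
      ultimately show ?thesis by (simp add: ln_mult)
    qed
    then show ?case using elim
      by (auto simp: indicator_def ennreal_plus)
  qed
  also have "\<dots> = (\<integral>\<^sup>+w. ennreal w * indicator {0..a} w \<partial>lborel) + (\<integral>\<^sup>+w. ?l w * indicator {0<..a} w \<partial>lborel)"
    by (rule nn_integral_add) auto
  also have "(\<integral>\<^sup>+w. ennreal w * indicator {0..a} w \<partial>lborel) = ennreal (a\<^sup>2 / 2 - 0\<^sup>2 / 2)"
    by (rule nn_integral_FTC_Icc) (use a in \<open>auto intro!: derivative_eq_intros\<close>)
  finally have 1: "ln_tail_integral s = ln_tail_integral 1 + (ennreal (a\<^sup>2 / 2) + (\<integral>\<^sup>+w. ?l w * indicator {0<..a} w \<partial>lborel))"
    by simp
  have "ln_tail_integral (1 / s) = ennreal \<bar>1\<bar> * (\<integral>\<^sup>+u. ennreal (ln (1 + 1 / s * exp (- (- a + 1 * u)))) * indicator {0<..} (- a + 1 * u) \<partial>lborel)"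
    unfolding ln_tail_integral_def by (rule nn_integral_real_affine) auto
  also have "\<dots> = (\<integral>\<^sup>+w. ?l w * indicator {a<..} w \<partial>lborel)"
    unfolding mult_1 shift using a by (auto intro!: nn_integral_cong simp: indicator_def)
  finally have 2: "ln_tail_integral (1 / s) = (\<integral>\<^sup>+w. ?l w * indicator {a<..} w \<partial>lborel)" .
  \<comment> \<open>The integral over \<open>{0<..a}\<close> that \<open>s\<close> has in excess is
    what \<open>1 / s\<close> lacks, so the two pieces reassemble to the integral for 1 and only a^2
    / 2 remains.\<close>
  have "ln_tail_integral 1 = (\<integral>\<^sup>+w. ?l w * indicator {0<..a} w + ?l w * indicator {a<..} w \<partial>lborel)"
    unfolding ln_tail_integral_def using a by (auto intro!: nn_integral_cong simp: indicator_def)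
  also have "\<dots> = (\<integral>\<^sup>+w. ?l w * indicator {0<..a} w \<partial>lborel) + ln_tail_integral (1 / s)"
    unfolding 2 by (rule nn_integral_add) auto
  finally have 3: "(\<integral>\<^sup>+w. ?l w * indicator {0<..a} w \<partial>lborel) + ln_tail_integral (1 / s) = ln_tail_integral 1" ..
  have "ln_tail_integral s + ln_tail_integral (1 / s) = ln_tail_integral 1 + (ennreal (a\<^sup>2 / 2) + ln_tail_integral 1)"
    unfolding 1 3[symmetric] by (simp add: ac_simps)
  also have "\<dots> = ennreal (pi\<^sup>2 / 6 + a\<^sup>2 / 2)"
    unfolding ln_tail_integral_1 by (subst ennreal_plus[symmetric], auto)+
  finally show ?thesis by (simp add: a_def)
qed

lemma ln_tail_integral_reciprocal:
  assumes "s > 0"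
  shows "ln_tail_integral s + ln_tail_integral (1 / s) = ennreal (pi\<^sup>2 / 6 + (ln s)\<^sup>2 / 2)"
proof (cases "s \<ge> 1")
  case False
  then have "ln_tail_integral (1 / s) + ln_tail_integral (1 / (1 / s)) = ennreal (pi\<^sup>2 / 6 + (ln (1 / s))\<^sup>2 / 2)"
    using assms by (intro ln_tail_integral_reciprocal_aux) auto
  then show ?thesis using assms by (simp add: ln_div add.commute)
qed (rule ln_tail_integral_reciprocal_aux)

text \<open>Carries Fubini from pairs to \<open>real^2\<close>: Lebesgue measure is determined by
  its values on boxes, and boxes correspond to boxes.\<close>

lemma distr_lborel_vector_2:
  "distr lborel lborel (\<lambda>z::real \<times> real. vector [fst z, snd z] :: real^2) = lborel"
proof (rule lborel_eqI[symmetric])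
  have eq: "(\<lambda>z::real \<times> real. vector [fst z, snd z] :: real^2) = (\<lambda>z. fst z *\<^sub>R axis 1 1 + snd z *\<^sub>R axis 2 1)"
    by (auto simp: fun_eq_iff vec_eq_iff forall_2 axis_def)
  have meas[measurable]: "(\<lambda>z::real \<times> real. vector [fst z, snd z] :: real^2) \<in> borel_measurable borel"
    unfolding eq by (intro borel_measurable_continuous_onI continuous_intros)
  fix l u :: "real^2"
  assume le: "\<And>b. b \<in> Basis \<Longrightarrow> l \<bullet> b \<le> u \<bullet> b"
  have lu: "l $ k \<le> u $ k" for k
    using le[of "axis k 1"] by (auto simp: inner_axis Basis_vec_def)
  have "emeasure (distr lborel lborel (\<lambda>z::real \<times> real. vector [fst z, snd z] :: real^2)) (box l u) =
      emeasure lborel ((\<lambda>z. vector [fst z, snd z] :: real^2) -` box l u)"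
    by (subst emeasure_distr) auto
  also have "(\<lambda>z::real \<times> real. vector [fst z, snd z] :: real^2) -` box l u = box (l $ 1, l $ 2) (u $ 1, u $ 2)"
    by (auto simp: mem_box_cart forall_2 mem_box Basis_prod_def)
  also have "emeasure lborel \<dots> = (\<Prod>b\<in>Basis. (u - l) \<bullet> b)"
    using lu by (subst emeasure_lborel_box)
      (auto simp: Basis_prod_def Basis_vec_def inner_axis prod.union_disjoint prod.reindex inj_on_def axis_eq_axis UNIV_2 ennreal_mult)
  finally show "emeasure (distr lborel lborel (\<lambda>z::real \<times> real. vector [fst z, snd z] :: real^2)) (box l u)
     = (\<Prod>b\<in>Basis. (u - l) \<bullet> b)" .
qed simp

lemma emeasure_lborel_real_2:
  assumes "S \<in> sets borel"
  shows "emeasure lborel (S :: (real^2) set) =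
    (\<integral>\<^sup>+u. emeasure lborel {v. vector [u, v] \<in> S} \<partial>lborel)"
proof -
  have eq: "(\<lambda>z::real \<times> real. vector [fst z, snd z] :: real^2) = (\<lambda>z. fst z *\<^sub>R axis 1 1 + snd z *\<^sub>R axis 2 1)"
    by (auto simp: fun_eq_iff vec_eq_iff forall_2 axis_def)
  have meas[measurable]: "(\<lambda>z::real \<times> real. vector [fst z, snd z] :: real^2) \<in> borel_measurable borel"
    unfolding eq by (intro borel_measurable_continuous_onI continuous_intros)
  let ?V = "(\<lambda>z::real \<times> real. vector [fst z, snd z] :: real^2) -` S"
  have V: "?V \<in> sets (lborel \<Otimes>\<^sub>M lborel)"
    unfolding lborel_prod sets_lborel by (rule measurable_sets_borel[OF meas assms])
  have "emeasure lborel S = emeasure (lborel :: (real \<times> real) measure) ?V"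
    by (subst distr_lborel_vector_2[symmetric], subst emeasure_distr) (use assms in auto)
  also have "\<dots> = emeasure (lborel \<Otimes>\<^sub>M lborel) ?V"
    by (simp add: lborel_prod)
  also have "\<dots> = (\<integral>\<^sup>+u. emeasure lborel (Pair u -` ?V) \<partial>lborel)"
    by (rule lborel.emeasure_pair_measure_alt[OF V])
  also have "\<dots> = (\<integral>\<^sup>+u. emeasure lborel {v. vector [u, v] \<in> S} \<partial>lborel)"
    by (simp add: vimage_def)
  finally show ?thesis .
qed

subsection \<open>The logarithmic image of an inscribed triangle\<close>

text \<open>For \<open>s = 1\<close> these are the strict triangle inequalities for the lengths 1,
  exp u, exp v. Each of the three inequalities belongs to one side of the inscribed
  triangle.\<close>

definition log_region :: "real \<Rightarrow> (real^2) set" where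
  "log_region s = {x. exp (x $ 1) + exp (x $ 2) > 1 \<and> exp (x $ 1) < 1 + s * exp (x $ 2) \<and>
     exp (x $ 2) < 1 + exp (x $ 1) / s}"

lemma open_log_region: "s > 0 \<Longrightarrow> open (log_region s)"
  unfolding log_region_def by (intro open_Collect_conj open_Collect_less continuous_intros) auto

lemma less_exp_iff: "y > 0 \<Longrightarrow> y < exp v \<longleftrightarrow> ln y < (v::real)"
  by (metis exp_less_cancel_iff exp_ln)

lemma exp_less_iff: "y > 0 \<Longrightarrow> exp v < y \<longleftrightarrow> v < ln (y::real)"
  by (metis exp_less_cancel_iff exp_ln)

text \<open>The case \<open>s = 1\<close> is the area of the amoeba of a line.\<close>

lemma emeasure_log_region:
  assumes s: "s > 0"
  shows "emeasure lborel (log_region s) = ennreal ((pi\<^sup>2 + (ln s)\<^sup>2) / 2)"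
proof -
  let ?f = "\<lambda>r w. (ennreal (ln (1 + r * exp (- w))) * indicator {0<..} w
      + ennreal (- ln (1 - exp (- w))) * indicator {0<..} w :: ennreal)"
  have int: "(\<integral>\<^sup>+w. ?f r w \<partial>lborel) = ln_tail_integral r + ennreal (pi\<^sup>2 / 6)" for r
    unfolding ln_tail_integral_def
    by (subst nn_integral_add) (auto simp: nn_integral_neg_ln_one_minus_exp)
  have "emeasure lborel (log_region s) = (\<integral>\<^sup>+u. emeasure lborel {v. vector [u, v] \<in> log_region s} \<partial>lborel)"
    by (rule emeasure_lborel_real_2) (simp add: open_log_region s)
  \<comment> \<open>For u < 0 only \<open>?f (1 / s) (- u)\<close> contributes, for u > 0 only
    \<open>?f s u\<close>; each is upper end minus lower end of the slice at u.\<close>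
  also have "\<dots> = (\<integral>\<^sup>+u. ?f (1 / s) (- u) + ?f s u \<partial>lborel)"
  proof (rule nn_integral_cong_AE, use AE_lborel_singleton[of "0::real"] in eventually_elim)
    case (elim u)
    have pos: "1 + exp u / s > 0" using s by (simp add: add_pos_pos)
    show ?case
    proof (cases "u < 0")
      case True
      then have "exp u < 1" by simp
      have "v \<in> {ln (1 - exp u)<..<ln (1 + exp u / s)} \<longleftrightarrow> (vector [u, v] :: real^2) \<in> log_region s" for v
      proof -
        \<comment> \<open>One inequality is automatic for u < 0, so the slice is an interval bounded
          by the other two. For u > 0 it is \<open>exp u + exp v > 1\<close> that is
          automatic.\<close>
        have "exp u < 1 + s * exp v" using \<open>exp u < 1\<close> mult_pos_pos[OF s exp_gt_zero[of v]] by linarith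
        moreover have "exp u + exp v > 1 \<longleftrightarrow> ln (1 - exp u) < v"
          using less_exp_iff[of "1 - exp u" v] \<open>exp u < 1\<close> by auto
        ultimately show ?thesis
          using exp_less_iff[OF pos, of v] by (simp add: log_region_def)
      qed
      then have slice: "{v. vector [u, v] \<in> log_region s} = {ln (1 - exp u)<..<ln (1 + exp u / s)}"
        by (intro Set.set_eqI) (simp only: mem_Collect_eq)
      have nn: "ln (1 - exp u) \<le> 0" "ln (1 + exp u / s) \<ge> 0"
        using \<open>exp u < 1\<close> s by auto
      have "emeasure lborel {ln (1 - exp u)<..<ln (1 + exp u / s)} =
          ennreal (ln (1 + exp u / s) + - ln (1 - exp u))"
        by (subst emeasure_lborel_Ioo) (use nn in auto)
      also have "\<dots> = ennreal (ln (1 + exp u / s)) + ennreal (- ln (1 - exp u))"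
        by (rule ennreal_plus) (use nn in auto)
      finally show ?thesis using True unfolding slice by simp
    next
      case False
      with elim have u: "u > 0" "exp u > 1" by auto
      have q: "(exp u - 1) / s > 0" using u s by simp
      have "v \<in> {ln ((exp u - 1) / s)<..<ln (1 + exp u / s)} \<longleftrightarrow> (vector [u, v] :: real^2) \<in> log_region s" for v
      proof -
        have "exp u + exp v > 1" using u exp_gt_zero[of v] by linarith
        moreover have "exp u < 1 + s * exp v \<longleftrightarrow> ln ((exp u - 1) / s) < v"
          using less_exp_iff[OF q, of v] s by (auto simp: field_simps)
        ultimately show ?thesis
          using exp_less_iff[OF pos, of v] by (simp add: log_region_def)
      qed
      then have slice: "{v. vector [u, v] \<in> log_region s} = {ln ((exp u - 1) / s)<..<ln (1 + exp u / s)}"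
        by (intro Set.set_eqI) (simp only: mem_Collect_eq)
      \<comment> \<open>Taking exp u / s out of both ends leaves the common summand
        \<open>u - ln s\<close>, which cancels in the length.\<close>
      have l: "ln ((exp u - 1) / s) = u - ln s + ln (1 - exp (- u))"
      proof -
        have "(exp u - 1) / s = exp u * (1 - exp (- u)) / s" by (simp add: algebra_simps exp_minus)
        then show ?thesis using u s by (simp add: ln_div ln_mult)
      qed
      have r: "ln (1 + exp u / s) = u - ln s + ln (1 + s * exp (- u))"
      proof -
        have "1 + exp u / s = exp u * (1 + s * exp (- u)) / s" using s by (simp add: field_simps exp_minus)
        moreover have "1 + s * exp (- u) > 0" using s by (simp add: add_pos_pos)
        ultimately show ?thesis using s by (simp add: ln_div ln_mult)
      qed
      have nn: "ln (1 - exp (- u)) \<le> 0" "ln (1 + s * exp (- u)) \<ge> 0"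
        using u s by auto
      have "emeasure lborel {ln ((exp u - 1) / s)<..<ln (1 + exp u / s)} =
          ennreal (ln (1 + s * exp (- u)) + - ln (1 - exp (- u)))"
        unfolding l r by (subst emeasure_lborel_Ioo) (use nn in auto)
      also have "\<dots> = ennreal (ln (1 + s * exp (- u))) + ennreal (- ln (1 - exp (- u)))"
        by (rule ennreal_plus) (use nn in auto)
      finally show ?thesis using u unfolding slice by simp
    qed
  qed
  also have "\<dots> = (\<integral>\<^sup>+u. ?f (1 / s) (- u) \<partial>lborel) + (\<integral>\<^sup>+u. ?f s u \<partial>lborel)"
    by (rule nn_integral_add) auto
  also have "(\<integral>\<^sup>+u. ?f (1 / s) (- u) \<partial>lborel) = (\<integral>\<^sup>+u. ?f (1 / s) u \<partial>lborel)"
    by (subst (2) nn_integral_real_affine[of _ "-1" 0]) auto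
  also have "\<dots> + (\<integral>\<^sup>+u. ?f s u \<partial>lborel) =
      (ln_tail_integral s + ln_tail_integral (1 / s)) + (ennreal (pi\<^sup>2 / 6) + ennreal (pi\<^sup>2 / 6))"
    unfolding int by (simp add: ac_simps)
  \<comment> \<open>Two of the three copies of pi^2 / 6 come from the lower ends of the slices, the
    third from the functional equation.\<close>
  also have "\<dots> = ennreal (pi\<^sup>2 / 6 + (ln s)\<^sup>2 / 2 + (pi\<^sup>2 / 6 + pi\<^sup>2 / 6))"
    unfolding ln_tail_integral_reciprocal[OF s] by (subst ennreal_plus[symmetric], auto)+
  finally show ?thesis by (simp add: field_simps)
qed

subsection \<open>Hilbert dual balls contain hexagons\<close>

text \<open>Half the difference body of the triangle with vertices 0, (1, 0) and (0, 1).\<close>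

definition unit_hexagon :: "(real^2) set" where
  "unit_hexagon = {c. \<bar>c $ 1\<bar> \<le> 1 / 2 \<and> \<bar>c $ 2\<bar> \<le> 1 / 2 \<and> \<bar>c $ 1 + c $ 2\<bar> \<le> 1 / 2}"

lemma compact_unit_hexagon: "compact unit_hexagon"
proof (rule compact_Int_closed[of "cbox (vec (-1/2)) (vec (1/2))" unit_hexagon, THEN ssubst[of _ _ compact, rotated]])
  show "closed unit_hexagon"
    unfolding unit_hexagon_def by (intro closed_Collect_conj closed_Collect_le continuous_intros)
  show "unit_hexagon = cbox (vec (-1/2)) (vec (1/2)) \<inter> unit_hexagon"
    by (auto simp: unit_hexagon_def mem_box_cart forall_2 abs_le_iff)
qed auto

text \<open>The unit square loses two corner triangles of area 1 / 8 each. For a lower bound it is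
  enough to cover the square and use subadditivity.\<close>

lemma measure_unit_hexagon: "measure lebesgue unit_hexagon \<ge> 3 / 4"
proof -
  \<comment> \<open>\<open>T (1/2)\<close> and \<open>T (-1/2)\<close> are the corners at (1/2, 1/2)
    and (-1/2, -1/2); the witnesses given to \<open>inT\<close> are barycentric coordinates in
    them.\<close>
  define T where "T e = convex hull {vector [e, e], vector [e, 0], vector [0, e] :: real^2}" for e :: real
  have T: "compact (T e)" for e
    unfolding T_def by (intro compact_convex_hull) auto
  have inT: "c \<in> T e" if "u \<ge> 0" "v \<ge> 0" "w \<ge> 0" "u + v + w = 1" "c $ 1 = (u + v) * e" "c $ 2 = (u + w) * e" for c u v w e
    unfolding T_def convex_hull_3 using that
    by (intro CollectI, rule_tac x = u in exI, rule_tac x = v in exI, rule_tac x = w in exI)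
      (auto simp: vec_eq_iff forall_2 algebra_simps)
  have mT: "measure lebesgue (T e) = e\<^sup>2 / 2" for e
  proof -
    have "measure lebesgue (T e) = measure lborel (T e)"
      by (rule measure_completion) (use compact_imp_closed[OF T] in auto)
    also have "\<dots> = e\<^sup>2 / 2"
      unfolding T_def content_triangle by (simp add: power2_eq_square)
    finally show ?thesis .
  qed
  have sub: "cbox (vec (-1/2)) (vec (1/2)) \<subseteq> unit_hexagon \<union> (T (1/2) \<union> T (-1/2) :: (real^2) set)"
  proof
    fix c :: "real^2" assume "c \<in> cbox (vec (-1/2)) (vec (1/2))"
    then have c: "- 1/2 \<le> c $ 1" "c $ 1 \<le> 1/2" "-1/2 \<le> c $ 2" "c $ 2 \<le> 1/2"
      by (auto simp: mem_box_cart)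
    consider "\<bar>c $ 1 + c $ 2\<bar> \<le> 1/2" | "c $ 1 + c $ 2 > 1/2" | "c $ 1 + c $ 2 < -1/2" by linarith
    then show "c \<in> unit_hexagon \<union> (T (1/2) \<union> T (-1/2))"
    proof cases
      case 1
      then show ?thesis using c by (auto simp: unit_hexagon_def abs_le_iff)
    next
      case 2
      then have "c \<in> T (1/2)" using c
        by (intro inT[of "2 * c$1 + 2 * c$2 - 1" "1 - 2 * c$2" "1 - 2 * c$1"]) auto
      then show ?thesis by simp
    next
      case 3
      then have "c \<in> T (-1/2)" using c
        by (intro inT[of "- 2 * c$1 - 2 * c$2 - 1" "1 + 2 * c$2" "1 + 2 * c$1"]) auto
      then show ?thesis by simp
    qed
  qed
  have lm: "unit_hexagon \<in> lmeasurable" "T e \<in> lmeasurable" for e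
    using compact_unit_hexagon T by (auto intro: lmeasurable_compact)
  have "Henstock_Kurzweil_Integration.content (cbox (vec (-1/2)) (vec (1/2)) :: (real^2) set) = 1"
    by (subst content_cbox_cart) (auto simp: interval_ne_empty_cart UNIV_2)
  then have "(1::real) = measure lebesgue (cbox (vec (-1/2)) (vec (1/2)) :: (real^2) set)"
    by simp
  also have "\<dots> \<le> measure lebesgue (unit_hexagon \<union> (T (1/2) \<union> T (-1/2)))"
    by (rule measure_mono_fmeasurable[OF sub]) (auto intro!: fmeasurable.Un lm)
  also have "\<dots> \<le> measure lebesgue unit_hexagon + measure lebesgue (T (1/2) \<union> T (-1/2))"
    by (rule measure_Un_le) (auto intro!: fmeasurableD lm)
  also have "measure lebesgue (T (1/2) \<union> T (-1/2)) \<le> measure lebesgue (T (1/2)) + measure lebesgue (T (-1/2))"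
    by (rule measure_Un_le) (auto intro!: fmeasurableD lm)
  also have "measure lebesgue (T (1/2)) + measure lebesgue (T (-1/2)) = 1 / 4"
    by (simp add: mT power2_eq_square)
  finally show ?thesis by simp
qed

lemma emeasure_hexagon_image:
  fixes a b :: "real^2"
  defines "L \<equiv> (\<lambda>c::real^2. c $ 1 *\<^sub>R a + c $ 2 *\<^sub>R b)"
  shows "emeasure lebesgue (L ` unit_hexagon) \<ge> ennreal (3 / 4 * \<bar>a $ 1 * b $ 2 - a $ 2 * b $ 1\<bar>)"
proof -
  have lin: "linear L"
    unfolding L_def by (intro linearI) (auto simp: algebra_simps)
  have "det (matrix L) = a $ 1 * b $ 2 - a $ 2 * b $ 1"
    by (simp add: det_2 matrix_def L_def axis_def)
  moreover have lm: "unit_hexagon \<in> lmeasurable"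
    using compact_unit_hexagon by (rule lmeasurable_compact)
  ultimately have "measure lebesgue (L ` unit_hexagon) = \<bar>a $ 1 * b $ 2 - a $ 2 * b $ 1\<bar> * measure lebesgue unit_hexagon"
    using measure_linear_image[OF lin lm] by simp
  also have "\<dots> \<ge> \<bar>a $ 1 * b $ 2 - a $ 2 * b $ 1\<bar> * (3 / 4)"
    by (intro mult_left_mono measure_unit_hexagon) auto
  finally have "measure lebesgue (L ` unit_hexagon) \<ge> 3 / 4 * \<bar>a $ 1 * b $ 2 - a $ 2 * b $ 1\<bar>" by simp
  moreover have "emeasure lebesgue (L ` unit_hexagon) = measure lebesgue (L ` unit_hexagon)"
    using measurable_linear_image[OF lin lm] by (intro emeasure_eq_measure2) auto
  ultimately show ?thesis by (simp add: ennreal_leI)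
qed

text \<open>The definition by \<open>THE\<close> needs exactly one frontier point on the ray.
  Boundedness gives one; a second is impossible because every point strictly between
  \<open>p\<close> and a point of the closure is interior.\<close>

lemma sigma_plus_props:
  assumes "open D" "convex D" "bounded D" "p \<in> D" "\<xi> \<noteq> 0"
  shows "sigma_plus D p \<xi> > 0" "p + (1 / sigma_plus D p \<xi>) *\<^sub>R \<xi> \<in> frontier D"
proof -
  let ?P = "\<lambda>s. s > 0 \<and> (\<exists>v \<in> frontier D. \<xi> = s *\<^sub>R (v - p))"
  have int: "interior D = D" using assms(1) by (rule interior_open)
  obtain d where d: "0 < d" "p + d *\<^sub>R \<xi> \<in> frontier D"
    by (rule ray_to_frontier[of D p \<xi>]) (use assms int in auto)
  have 1: "?P (1 / d)" using d by (auto intro!: bexI[of _ "p + d *\<^sub>R \<xi>"])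
  have le: "\<not> s < s'" if "?P s" "?P s'" for s s'
  proof
    assume "s < s'"
    from that obtain v v' where v: "v \<in> frontier D" "\<xi> = s *\<^sub>R (v - p)" "v' \<in> frontier D" "\<xi> = s' *\<^sub>R (v' - p)"
      by blast
    define e where "e = 1 - s / s'"
    have e: "0 < e" "e \<le> 1" using that \<open>s < s'\<close> by (auto simp: e_def)
    have "s' *\<^sub>R (v' - p) = s *\<^sub>R (v - p)" using v by simp
    then have "(1 / s') *\<^sub>R (s' *\<^sub>R (v' - p)) = (1 / s') *\<^sub>R (s *\<^sub>R (v - p))" by simp
    then have "v' - p = (s / s') *\<^sub>R (v - p)" using that by simp
    then have "v' = v - e *\<^sub>R (v - p)" by (simp add: e_def algebra_simps)
    then have "v' \<in> D"
      using mem_interior_closure_convex_shrink[of D p v e] assms int e v by (auto simp: frontier_def)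
    then show False using v int by (auto simp: frontier_def)
  qed
  have "?P (sigma_plus D p \<xi>)"
    unfolding sigma_plus_def
  proof (rule theI[of ?P])
    show "?P (1 / d)" by (rule 1)
    show "s = 1 / d" if "?P s" for s
      using le[OF that 1] le[OF 1 that] by linarith
  qed
  then obtain v where v: "sigma_plus D p \<xi> > 0" "v \<in> frontier D" "\<xi> = sigma_plus D p \<xi> *\<^sub>R (v - p)"
    by blast
  then have "(1 / sigma_plus D p \<xi>) *\<^sub>R \<xi> = (1 / sigma_plus D p \<xi>) *\<^sub>R sigma_plus D p \<xi> *\<^sub>R (v - p)"
    by metis
  then have "p + (1 / sigma_plus D p \<xi>) *\<^sub>R \<xi> = v" using v(1) by simp
  then show "sigma_plus D p \<xi> > 0" "p + (1 / sigma_plus D p \<xi>) *\<^sub>R \<xi> \<in> frontier D"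
    using v by simp_all
qed

lemma sigma_minus_eq: "sigma_minus D p \<xi> = sigma_plus D p (- \<xi>)"
proof -
  have "\<xi> = s *\<^sub>R (p - v) \<longleftrightarrow> - \<xi> = s *\<^sub>R (v - p)" for s v
    by (metis minus_diff_eq minus_equation_iff scaleR_minus_right)
  then show ?thesis by (simp add: sigma_minus_def sigma_plus_def)
qed

text \<open>An affine function without zeros on a connected set keeps its sign, and the weak
  inequality survives on the closure. Dividing by the value at \<open>p\<close> treats both signs at
  once.\<close>

lemma affine_ratio_nonneg:
  fixes a :: "real^2"
  assumes D: "convex D" "p \<in> D" and nz: "\<And>x. x \<in> D \<Longrightarrow> b + a \<bullet> x \<noteq> 0" and v: "v \<in> closure D"
  shows "(b + a \<bullet> v) / (b + a \<bullet> p) \<ge> 0"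
proof -
  let ?f = "\<lambda>x. (b + a \<bullet> x) / (b + a \<bullet> p)"
  have cont: "continuous_on X ?f" for X
    by (intro continuous_intros) (use nz D in auto)
  have pos: "?f x > 0" if "x \<in> D" for x
  proof (rule ccontr)
    assume "\<not> ?f x > 0"
    have "convex (?f ` D)"
      using connected_continuous_image[OF cont convex_connected[OF D(1)]] by (simp add: connected_convex_1)
    then have "is_interval (?f ` D)" by (simp add: is_interval_convex_1)
    moreover have "?f x \<in> ?f ` D" "1 \<in> ?f ` D" using that D nz by (auto intro!: image_eqI[of _ _ p])
    ultimately have "0 \<in> ?f ` D"
      using \<open>\<not> ?f x > 0\<close> by (auto simp: is_interval_1)
    then show False using nz D by auto
  qed
  show ?thesis
    by (rule continuous_ge_on_closure[OF cont v]) (use pos less_imp_le in blast)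
qed

text \<open>The normalised affine function is still nonnegative where the ray from \<open>p\<close>
  leaves \<open>D\<close>. In dual terms, minus the logarithmic derivative lies in the polar body of
  \<open>D\<close> at \<open>p\<close>.\<close>

lemma affine_slope_ge:
  assumes D: "open D" "convex D" "bounded D" "p \<in> D" "\<xi> \<noteq> 0"
    and nz: "\<And>x. x \<in> D \<Longrightarrow> b + a \<bullet> x \<noteq> 0"
  shows "- sigma_plus D p \<xi> \<le> (a \<bullet> \<xi>) / (b + a \<bullet> p)"
proof -
  let ?s = "sigma_plus D p \<xi>" and ?f = "\<lambda>x. (b + a \<bullet> x) / (b + a \<bullet> p)"
  have "?f (p + (1 / ?s) *\<^sub>R \<xi>) \<ge> 0"
    using sigma_plus_props(2)[OF D] affine_ratio_nonneg[OF D(2,4) nz] by (auto simp: frontier_def)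
  also have "?f (p + (1 / ?s) *\<^sub>R \<xi>) = 1 + (1 / ?s) * ((a \<bullet> \<xi>) / (b + a \<bullet> p))"
    using nz[OF D(4)] by (simp add: inner_add_right add.assoc[symmetric] add_divide_distrib[of "b + a \<bullet> p"])
  finally have "0 \<le> ?s * (1 + (1 / ?s) * ((a \<bullet> \<xi>) / (b + a \<bullet> p)))"
    using sigma_plus_props(1)[OF D] by simp
  also have "\<dots> = ?s + (a \<bullet> \<xi>) / (b + a \<bullet> p)"
    using sigma_plus_props(1)[OF D] by (simp add: distrib_left del: times_divide_eq_left)
  finally show ?thesis by simp
qed

text \<open>One function is tested against \<xi> and the other against - \<xi>; the two gauges add
  up to twice the Hilbert norm.\<close>

lemma affine_slope_diff_le:
  assumes D: "open D" "convex D" "bounded D" "p \<in> D"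
    and nz: "\<And>x. x \<in> D \<Longrightarrow> b + a \<bullet> x \<noteq> 0" "\<And>x. x \<in> D \<Longrightarrow> b' + a' \<bullet> x \<noteq> 0"
    and ball: "\<xi> \<in> hilbert_ball D p"
  shows "(a \<bullet> \<xi>) / (b + a \<bullet> p) - (a' \<bullet> \<xi>) / (b' + a' \<bullet> p) \<le> 2"
proof (cases "\<xi> = 0")
  case False
  have "- sigma_plus D p \<xi> \<le> (a' \<bullet> \<xi>) / (b' + a' \<bullet> p)"
    by (rule affine_slope_ge[OF D False nz(2)])
  moreover have "- sigma_plus D p (- \<xi>) \<le> (a \<bullet> (- \<xi>)) / (b + a \<bullet> p)"
    by (rule affine_slope_ge[OF D _ nz(1)]) (use False in auto)
  moreover have "sigma_plus D p \<xi> + sigma_plus D p (- \<xi>) \<le> 2"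
    using ball False by (simp add: hilbert_ball_def hilbert_norm_def sigma_minus_eq)
  ultimately show ?thesis by simp
qed auto

text \<open>The pairing can be written with any two of the three differences, with coefficients
  taken up to sign from \<open>c\<close>, \<open>d\<close>, \<open>c + d\<close>. The largest of
  these in absolute value equals the sum of the other two absolute values; the form that avoids it
  is bounded by twice 1 / 2.\<close>

lemma hexagon_pairing_le:
  fixes x y z c d :: real
  assumes "\<bar>c\<bar> \<le> 1 / 2" "\<bar>d\<bar> \<le> 1 / 2" "\<bar>c + d\<bar> \<le> 1 / 2"
    and "x - y \<le> 2" "y - x \<le> 2" "y - z \<le> 2" "z - y \<le> 2" "x - z \<le> 2" "z - x \<le> 2"
  shows "c * (x - z) + d * (y - z) \<le> 1"
proof -
  have bnd: "u * v \<le> 2 * \<bar>u\<bar>" if "\<bar>v\<bar> \<le> 2" for u v :: real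
  proof -
    have "u * v \<le> \<bar>u\<bar> * \<bar>v\<bar>" by (metis abs_ge_self abs_mult)
    also have "\<dots> \<le> \<bar>u\<bar> * 2" using that by (intro mult_left_mono) auto
    finally show ?thesis by simp
  qed
  have "c * (x - z) \<le> 2 * \<bar>c\<bar>" "d * (y - z) \<le> 2 * \<bar>d\<bar>" "(c + d) * (x - z) \<le> 2 * \<bar>c + d\<bar>"
    "(- d) * (x - y) \<le> 2 * \<bar>- d\<bar>" "(c + d) * (y - z) \<le> 2 * \<bar>c + d\<bar>" "c * (x - y) \<le> 2 * \<bar>c\<bar>"
    by (rule bnd, use assms in linarith)+
  moreover have "c * (x - z) + d * (y - z) = (c + d) * (x - z) + (- d) * (x - y)"
    "c * (x - z) + d * (y - z) = (c + d) * (y - z) + c * (x - y)"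
    by (auto simp: algebra_simps)
  moreover have "T \<le> 1" if "A \<le> 2 * \<bar>c\<bar>" "B \<le> 2 * \<bar>d\<bar>" "E \<le> 2 * \<bar>c + d\<bar>" "F \<le> 2 * \<bar>- d\<bar>"
    "G \<le> 2 * \<bar>c + d\<bar>" "H \<le> 2 * \<bar>c\<bar>" "T = A + B" "T = E + F" "T = G + H" for A B E F G H T
    using that assms(1-3) by (auto simp: abs_if split: if_splits)
  ultimately show ?thesis by blast
qed

lemma closed_hilbert_dual_ball: "closed (hilbert_dual_ball D p)"
proof -
  have "hilbert_dual_ball D p = (\<Inter>\<xi>\<in>hilbert_ball D p. {\<eta>. \<eta> \<bullet> \<xi> \<le> 1})"
    by (auto simp: hilbert_dual_ball_def)
  then show ?thesis
    by (auto intro!: closed_INT closed_Collect_le continuous_intros)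
qed

text \<open>The vectors \<open>\<alpha>\<^sub>i / 2 - \<alpha>\<^sub>j / 2\<close>, where \<open>\<alpha>\<^sub>i\<close> is the logarithmic derivative at \<open>p\<close> of the
  \<open>i\<close>-th affine function, lie in the dual ball; they are the vertices of the hexagon below.\<close>

lemma emeasure_hilbert_dual_ball_ge:
  fixes a1 a2 a3 :: "real^2"
  assumes D: "open D" "convex D" "bounded D" "p \<in> D"
    and nz: "\<And>x. x \<in> D \<Longrightarrow> b1 + a1 \<bullet> x \<noteq> 0" "\<And>x. x \<in> D \<Longrightarrow> b2 + a2 \<bullet> x \<noteq> 0"
      "\<And>x. x \<in> D \<Longrightarrow> b3 + a3 \<bullet> x \<noteq> 0"
  defines "u \<equiv> (1 / (b1 + a1 \<bullet> p)) *\<^sub>R a1 - (1 / (b3 + a3 \<bullet> p)) *\<^sub>R a3"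
    and "v \<equiv> (1 / (b2 + a2 \<bullet> p)) *\<^sub>R a2 - (1 / (b3 + a3 \<bullet> p)) *\<^sub>R a3"
  shows "ennreal (3 / 4 * \<bar>u $ 1 * v $ 2 - u $ 2 * v $ 1\<bar>) \<le> emeasure lebesgue (hilbert_dual_ball D p)"
proof -
  have "(c $ 1 *\<^sub>R u + c $ 2 *\<^sub>R v) \<in> hilbert_dual_ball D p" if c: "c \<in> unit_hexagon" for c
    unfolding hilbert_dual_ball_def
  proof (intro CollectI ballI)
    fix \<xi> assume \<xi>: "\<xi> \<in> hilbert_ball D p"
    note le = affine_slope_diff_le[OF D _ _ \<xi>]
    have "(c $ 1 *\<^sub>R u + c $ 2 *\<^sub>R v) \<bullet> \<xi> =
        c $ 1 * ((a1 \<bullet> \<xi>) / (b1 + a1 \<bullet> p) - (a3 \<bullet> \<xi>) / (b3 + a3 \<bullet> p)) +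
        c $ 2 * ((a2 \<bullet> \<xi>) / (b2 + a2 \<bullet> p) - (a3 \<bullet> \<xi>) / (b3 + a3 \<bullet> p))"
      by (simp add: u_def v_def inner_add_left inner_diff_left)
    also have "\<dots> \<le> 1"
      using c by (intro hexagon_pairing_le le nz) (auto simp: unit_hexagon_def)
    finally show "(c $ 1 *\<^sub>R u + c $ 2 *\<^sub>R v) \<bullet> \<xi> \<le> 1" .
  qed
  then have "(\<lambda>c. c $ 1 *\<^sub>R u + c $ 2 *\<^sub>R v) ` unit_hexagon \<subseteq> hilbert_dual_ball D p" by auto
  then have "emeasure lebesgue ((\<lambda>c. c $ 1 *\<^sub>R u + c $ 2 *\<^sub>R v) ` unit_hexagon) \<le> emeasure lebesgue (hilbert_dual_ball D p)"
    by (rule emeasure_mono) (use closed_hilbert_dual_ball in auto)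
  then show ?thesis
    using emeasure_hexagon_image[of u v] by (rule order_trans[rotated])
qed

subsection \<open>Logarithmic coordinates of three lines\<close>

lemma vector_2_eq: "(vector [a, b] :: real^2) = a *\<^sub>R axis 1 1 + b *\<^sub>R axis 2 1"
  by (simp add: vec_eq_iff forall_2 axis_def)

definition homogeneous :: "real^2 \<Rightarrow> real^3" where
  "homogeneous x = vector [x $ 1, x $ 2, 1]"

definition planar :: "real^3 \<Rightarrow> real^2" where
  "planar m = vector [m $ 1, m $ 2]"

lemma inner_homogeneous: "m \<bullet> homogeneous x = m $ 3 + planar m \<bullet> x"
  by (simp add: homogeneous_def planar_def inner_vec_def sum_2 sum_3)

text \<open>\<open>(ln (y\<^sup>2) - ln (z\<^sup>2)) / 2\<close> is \<open>ln \<bar>y / z\<bar>\<close>, in a form that is differentiable for both signs.\<close>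

definition log_ratio :: "real^3 \<Rightarrow> real^3 \<Rightarrow> real^3 \<Rightarrow> real^3 \<Rightarrow> real^2" where
  "log_ratio l1 l2 l3 v = vector [(ln ((l1 \<bullet> v)\<^sup>2) - ln ((l3 \<bullet> v)\<^sup>2)) / 2,
     (ln ((l2 \<bullet> v)\<^sup>2) - ln ((l3 \<bullet> v)\<^sup>2)) / 2]"

lemma log_ratio_scaleR:
  assumes "c \<noteq> 0" "l1 \<bullet> v \<noteq> 0" "l2 \<bullet> v \<noteq> 0" "l3 \<bullet> v \<noteq> 0"
  shows "log_ratio l1 l2 l3 (c *\<^sub>R v) = log_ratio l1 l2 l3 v"
  using assms by (simp add: log_ratio_def power_mult_distrib ln_mult)

text \<open>The gradient at \<open>x\<close> of ln |l / m|, both covectors being read as affine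
  functions in the chart.\<close>

definition log_slope :: "real^3 \<Rightarrow> real^3 \<Rightarrow> real^2 \<Rightarrow> real^2" where
  "log_slope l m x = (1 / (l $ 3 + planar l \<bullet> x)) *\<^sub>R planar l - (1 / (m $ 3 + planar m \<bullet> x)) *\<^sub>R planar m"

lemma has_derivative_log_quotient:
  fixes a a' :: "real^2"
  assumes "b + a \<bullet> p \<noteq> 0" "b' + a' \<bullet> p \<noteq> 0"
  shows "((\<lambda>x. (ln ((b + a \<bullet> x)\<^sup>2) - ln ((b' + a' \<bullet> x)\<^sup>2)) / 2) has_derivative
      (\<lambda>\<xi>. ((1 / (b + a \<bullet> p)) *\<^sub>R a - (1 / (b' + a' \<bullet> p)) *\<^sub>R a') \<bullet> \<xi>)) (at p within X)"
proof -
  have ln: "((\<lambda>y::real. ln (y\<^sup>2) / 2) has_real_derivative 1 / y) (at y)" if "y \<noteq> 0" for y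
    using that by (auto intro!: derivative_eq_intros simp: power2_eq_square zero_less_mult_iff)
  have d: "((\<lambda>x. ln ((b + a \<bullet> x)\<^sup>2) / 2) has_derivative (\<lambda>\<xi>. (a \<bullet> \<xi>) * (1 / (b + a \<bullet> p)))) (at p within X)"
    if "b + a \<bullet> p \<noteq> 0" for a :: "real^2" and b
    by (rule DERIV_compose_FDERIV[where g = "\<lambda>x. b + a \<bullet> x" and x = p, OF ln[OF that]]) (auto intro!: derivative_eq_intros)
  show ?thesis
    using has_derivative_diff[OF d[OF assms(1)] d[OF assms(2)]]
    by (simp add: inner_diff_left diff_divide_distrib)
qed

definition log_jacobian :: "real^3 \<Rightarrow> real^3 \<Rightarrow> real^3 \<Rightarrow> real^2 \<Rightarrow> real" where
  "log_jacobian l1 l2 l3 x = \<bar>log_slope l1 l3 x $ 1 * log_slope l2 l3 x $ 2 -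
     log_slope l1 l3 x $ 2 * log_slope l2 l3 x $ 1\<bar>"

lemma has_derivative_log_ratio:
  assumes "l1 \<bullet> homogeneous p \<noteq> 0" "l2 \<bullet> homogeneous p \<noteq> 0" "l3 \<bullet> homogeneous p \<noteq> 0"
  shows "((\<lambda>x. log_ratio l1 l2 l3 (homogeneous x)) has_derivative
     (\<lambda>\<xi>. vector [log_slope l1 l3 p \<bullet> \<xi>, log_slope l2 l3 p \<bullet> \<xi>])) (at p within X)"
  using assms unfolding log_ratio_def log_slope_def vector_2_eq inner_homogeneous
  by (intro has_derivative_add has_derivative_scaleR_left has_derivative_log_quotient)

lemma det_log_ratio_derivative:
  "\<bar>det (matrix (\<lambda>\<xi>. vector [log_slope l1 l3 p \<bullet> \<xi>, log_slope l2 l3 p \<bullet> \<xi>] :: real^2))\<bar> = log_jacobian l1 l2 l3 p"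
  by (simp add: det_2 matrix_def log_jacobian_def inner_axis mult.commute)

lemma borel_measurable_log_jacobian [measurable]: "log_jacobian l1 l2 l3 \<in> borel_measurable borel"
  unfolding log_jacobian_def log_slope_def vector_minus_component vector_scaleR_component inner_vec_def
  by measurable

lemma log_jacobian_le_dual_ball:
  assumes D: "open D" "convex D" "bounded D" "p \<in> D"
    and nz: "\<And>x. x \<in> D \<Longrightarrow> l1 \<bullet> homogeneous x \<noteq> 0" "\<And>x. x \<in> D \<Longrightarrow> l2 \<bullet> homogeneous x \<noteq> 0"
      "\<And>x. x \<in> D \<Longrightarrow> l3 \<bullet> homogeneous x \<noteq> 0"
  shows "ennreal (3 / 4 * log_jacobian l1 l2 l3 p) \<le> emeasure lebesgue (hilbert_dual_ball D p)"
  unfolding log_jacobian_def log_slope_def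
  by (rule emeasure_hilbert_dual_ball_ge[OF D]) (use nz in \<open>simp_all add: inner_homogeneous\<close>)

text \<open>The area formula as an inequality, because the map may fail to be injective on
  \<open>Y\<close>. Finiteness of the integral makes the Jacobian absolutely integrable, as the
  change of variables requires.\<close>

lemma emeasure_log_ratio_image_le:
  assumes Y: "Y \<in> sets lebesgue"
    and nz: "\<And>x. x \<in> Y \<Longrightarrow> l1 \<bullet> homogeneous x \<noteq> 0" "\<And>x. x \<in> Y \<Longrightarrow> l2 \<bullet> homogeneous x \<noteq> 0"
      "\<And>x. x \<in> Y \<Longrightarrow> l3 \<bullet> homogeneous x \<noteq> 0"
    and fin: "(\<integral>\<^sup>+p\<in>Y. ennreal (log_jacobian l1 l2 l3 p) \<partial>lebesgue) < \<infinity>"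
  defines "\<Phi> \<equiv> (\<lambda>x. log_ratio l1 l2 l3 (homogeneous x))"
  shows "\<Phi> ` Y \<in> lmeasurable"
    and "emeasure lebesgue (\<Phi> ` Y) \<le> (\<integral>\<^sup>+p\<in>Y. ennreal (log_jacobian l1 l2 l3 p) \<partial>lebesgue)"
proof -
  let ?J = "log_jacobian l1 l2 l3"
  have J: "?J \<in> borel_measurable lebesgue" "?J x \<ge> 0" for x
    using borel_measurable_log_jacobian by (auto simp: log_jacobian_def intro: measurable_completion)
  have ind: "ennreal (?J p) * indicator Y p = ennreal (indicator Y p *\<^sub>R ?J p)" for p
    by (auto simp: indicator_def)
  have "integrable lebesgue (\<lambda>p. indicator Y p *\<^sub>R ?J p)"
    using fin J Y unfolding ind by (intro integrableI_nonneg) auto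
  then have I: "set_integrable lebesgue Y ?J" by (simp add: set_integrable_def)
  note eq = set_lebesgue_integral_eq_integral[OF I]
  have der: "(\<Phi> has_derivative (\<lambda>\<xi>. vector [log_slope l1 l3 x \<bullet> \<xi>, log_slope l2 l3 x \<bullet> \<xi>])) (at x within Y)"
    if "x \<in> Y" for x
    unfolding \<Phi>_def using nz that by (intro has_derivative_log_ratio) auto
  show lm: "\<Phi> ` Y \<in> lmeasurable"
    by (rule measurable_differentiable_image[OF Y der]) (use eq det_log_ratio_derivative in simp_all)
  have "measure lebesgue (\<Phi> ` Y) \<le> integral Y (\<lambda>x. \<bar>det (matrix (\<lambda>\<xi>. vector [log_slope l1 l3 x \<bullet> \<xi>, log_slope l2 l3 x \<bullet> \<xi>] :: real^2))\<bar>)"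
    by (rule measure_differentiable_image[OF Y der]) (use eq det_log_ratio_derivative in simp_all)
  also have "\<dots> = (\<integral>p. indicator Y p *\<^sub>R ?J p \<partial>lebesgue)"
    using eq by (simp add: det_log_ratio_derivative set_lebesgue_integral_def)
  finally have "ennreal (measure lebesgue (\<Phi> ` Y)) \<le> ennreal (\<integral>p. indicator Y p *\<^sub>R ?J p \<partial>lebesgue)"
    by (rule ennreal_leI)
  also have "\<dots> = (\<integral>\<^sup>+p\<in>Y. ennreal (?J p) \<partial>lebesgue)"
    unfolding ind by (rule nn_integral_eq_integral[symmetric]) (use I J in \<open>auto simp: set_integrable_def\<close>)
  finally show "emeasure lebesgue (\<Phi> ` Y) \<le> (\<integral>\<^sup>+p\<in>Y. ennreal (?J p) \<partial>lebesgue)"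
    using lm by (simp add: emeasure_eq_measure2)
qed

subsection \<open>Charts of the projective plane\<close>

lemma rep_rp2_nonzero: "rep_rp2 x \<noteq> 0"
  using Quotient_rep_reflp[OF Quotient_rp2] by blast

lemma proj_pt_rep_rp2: "proj_pt (rep_rp2 x) = x"
  by (rule Quotient_abs_rep[OF Quotient_rp2])

lemma proj_pt_eq_iff:
  assumes "v \<noteq> 0" "w \<noteq> 0"
  shows "proj_pt v = proj_pt w \<longleftrightarrow> (\<exists>c. w = c *\<^sub>R v)"
  using Quotient_rel[OF Quotient_rp2, of v w] assms
  by (metis scaleR_one)

lemma proj_pt_scaleR: "c \<noteq> 0 \<Longrightarrow> v \<noteq> 0 \<Longrightarrow> proj_pt (c *\<^sub>R v) = proj_pt v"
  by (metis proj_pt_eq_iff scaleR_eq_0_iff)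

lemma continuous_on_proj_pt: "continuous_on (- {0}) proj_pt"
proof (subst continuous_on_open_vimage)
  show "\<forall>B. open B \<longrightarrow> open (proj_pt -` B \<inter> - {0})"
  proof (intro allI impI)
    fix B :: "rp2 set" assume "open B"
    moreover have "proj_pt -` B \<inter> - {0} = {v. v \<noteq> 0 \<and> proj_pt v \<in> B}" by auto
    ultimately show "open (proj_pt -` B \<inter> - {0})" by (simp add: open_rp2_def)
  qed
qed (auto simp: open_Compl)

lemma homogeneous_nonzero: "homogeneous x \<noteq> 0"
  by (metis homogeneous_def vector_3(3) zero_index zero_neq_one)

lemma invertible_mult_nonzero: "invertible (A::real^3^3) \<Longrightarrow> v \<noteq> 0 \<Longrightarrow> A *v v \<noteq> 0"
  using invertible_left_inverse matrix_left_invertible_ker by blast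

lemma continuous_on_homogeneous: "continuous_on X homogeneous"
proof -
  have eq: "homogeneous = (\<lambda>x. x $ 1 *\<^sub>R axis 1 1 + x $ 2 *\<^sub>R axis 2 1 + axis 3 1)"
    by (auto simp: fun_eq_iff vec_eq_iff forall_3 axis_def homogeneous_def)
  show ?thesis unfolding eq by (intro continuous_intros)
qed

lemma aff_chart_eq: "aff_chart A x = proj_pt (A *v homogeneous x)"
  by (simp add: aff_chart_def homogeneous_def)

lemma continuous_on_proj_pt_homogeneous:
  assumes "invertible M"
  shows "continuous_on X (\<lambda>x. proj_pt (M *v homogeneous x))"
proof (rule continuous_on_compose2[OF continuous_on_proj_pt
        linear_continuous_on_compose[OF continuous_on_homogeneous matrix_vector_mul_linear]])
  show "(\<lambda>x. M *v homogeneous x) ` X \<subseteq> - {0}"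
    by (rule image_subsetI) (use invertible_mult_nonzero[OF assms homogeneous_nonzero] in simp)
qed

lemma continuous_on_aff_chart: "invertible A \<Longrightarrow> continuous_on X (aff_chart A)"
  unfolding aff_chart_eq[abs_def] by (rule continuous_on_proj_pt_homogeneous)

lemma homogeneous_eq_scaleR: "homogeneous y = c *\<^sub>R homogeneous x \<Longrightarrow> y = x"
  by (auto simp: homogeneous_def vec_eq_iff forall_3 forall_2)

lemma inj_aff_chart:
  assumes "invertible A" shows "inj (aff_chart A)"
proof (rule injI)
  fix x y assume "aff_chart A x = aff_chart A y"
  then obtain c where "A *v homogeneous y = c *\<^sub>R (A *v homogeneous x)"
    unfolding aff_chart_eq
    by (subst (asm) proj_pt_eq_iff) (auto simp: invertible_mult_nonzero[OF assms homogeneous_nonzero])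
  then have "A *v (homogeneous y - c *\<^sub>R homogeneous x) = 0"
    by (simp add: matrix_vector_mult_diff_distrib matrix_vector_mult_scaleR)
  then have "homogeneous y - c *\<^sub>R homogeneous x = 0"
    using invertible_mult_nonzero[OF assms] by blast
  then have "homogeneous y = c *\<^sub>R homogeneous x" by simp
  then show "x = y" by (metis homogeneous_eq_scaleR)
qed

text \<open>The inverse chart on representing vectors. It is meaningful where
  \<open>chart_height\<close> is nonzero, that is, off the line at infinity of the chart.\<close>

definition chart_coords :: "real^3^3 \<Rightarrow> real^3 \<Rightarrow> real^2" where
  "chart_coords A v = (let w = matrix_inv A *v v in vector [w $ 1 / w $ 3, w $ 2 / w $ 3])"

definition chart_height :: "real^3^3 \<Rightarrow> real^3 \<Rightarrow> real" where
  "chart_height A v = (matrix_inv A *v v) $ 3"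

lemma matrix_inv_cancel:
  assumes "invertible (A :: real^3^3)"
  shows "A *v (matrix_inv A *v v) = v" "matrix_inv A *v (A *v v) = v"
proof -
  have "A ** matrix_inv A = mat 1 \<and> matrix_inv A ** A = mat 1"
    unfolding matrix_inv_def by (rule someI_ex) (use assms in \<open>simp add: invertible_def\<close>)
  then show "A *v (matrix_inv A *v v) = v" "matrix_inv A *v (A *v v) = v"
    by (simp_all add: matrix_vector_mul_assoc)
qed

lemma chart_coords_height:
  assumes "invertible A" "chart_height A v \<noteq> 0"
  shows "v = chart_height A v *\<^sub>R (A *v homogeneous (chart_coords A v))"
proof -
  let ?w = "matrix_inv A *v v"
  have "A *v ?w = v"
    by (rule matrix_inv_cancel(1)[OF assms(1)])
  moreover have "?w = chart_height A v *\<^sub>R homogeneous (chart_coords A v)"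
    using assms(2) by (auto simp: chart_coords_def chart_height_def homogeneous_def vec_eq_iff forall_3 Let_def)
  ultimately show ?thesis by (metis matrix_vector_mult_scaleR)
qed

lemma chart_coords_scaleR:
  assumes "invertible A" "c \<noteq> 0"
  shows "chart_height A (c *\<^sub>R (A *v homogeneous x)) = c" "chart_coords A (c *\<^sub>R (A *v homogeneous x)) = x"
proof -
  have "matrix_inv A *v (c *\<^sub>R (A *v homogeneous x)) = c *\<^sub>R homogeneous x"
    by (simp add: matrix_vector_mult_scaleR matrix_inv_cancel(2)[OF assms(1)])
  then show "chart_height A (c *\<^sub>R (A *v homogeneous x)) = c" "chart_coords A (c *\<^sub>R (A *v homogeneous x)) = x"
    using assms(2) by (simp_all add: chart_height_def chart_coords_def homogeneous_def vec_eq_iff forall_2)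
qed

lemma proj_pt_eq_aff_chart_iff:
  assumes A: "invertible A" and v: "v \<noteq> 0"
  shows "proj_pt v = aff_chart A x \<longleftrightarrow> chart_height A v \<noteq> 0 \<and> chart_coords A v = x"
proof
  assume "proj_pt v = aff_chart A x"
  then obtain c where c: "v = c *\<^sub>R (A *v homogeneous x)"
    unfolding aff_chart_eq using proj_pt_eq_iff[of "A *v homogeneous x" v] v
      invertible_mult_nonzero[OF A homogeneous_nonzero] by metis
  then have "c \<noteq> 0" using v by auto
  then show "chart_height A v \<noteq> 0 \<and> chart_coords A v = x"
    using chart_coords_scaleR[OF A] c by auto
next
  assume h: "chart_height A v \<noteq> 0 \<and> chart_coords A v = x"
  then have "v = chart_height A v *\<^sub>R (A *v homogeneous x)" using chart_coords_height[OF A] by blast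
  then show "proj_pt v = aff_chart A x"
    unfolding aff_chart_eq by (metis h proj_pt_scaleR invertible_mult_nonzero[OF A homogeneous_nonzero])
qed

lemma continuous_on_chart_height: "continuous_on X (chart_height A)"
  unfolding chart_height_def by (intro continuous_intros)

lemma continuous_on_chart_coords:
  "(\<And>v. v \<in> X \<Longrightarrow> chart_height A v \<noteq> 0) \<Longrightarrow> continuous_on X (chart_coords A)"
  unfolding chart_coords_def Let_def vector_2_eq chart_height_def
  by (intro continuous_intros) auto

lemma open_aff_chart_image:
  assumes A: "invertible A" and W: "open W"
  shows "open (aff_chart A ` W)"
proof -
  let ?H = "{v. chart_height A v \<noteq> 0}"
  have 0: "chart_height A 0 = 0" by (simp add: chart_height_def)
  have "{v. v \<noteq> 0 \<and> proj_pt v \<in> aff_chart A ` W} = ?H \<inter> chart_coords A -` W"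
  proof (rule Set.set_eqI, rule iffI)
    fix v assume "v \<in> {v. v \<noteq> 0 \<and> proj_pt v \<in> aff_chart A ` W}"
    then show "v \<in> ?H \<inter> chart_coords A -` W"
      using proj_pt_eq_aff_chart_iff[OF A, of v] by blast
  next
    fix v assume v: "v \<in> ?H \<inter> chart_coords A -` W"
    then have "v \<noteq> 0" using 0 by auto
    then have "proj_pt v = aff_chart A (chart_coords A v)"
      using proj_pt_eq_aff_chart_iff[OF A, of v] v by blast
    then show "v \<in> {v. v \<noteq> 0 \<and> proj_pt v \<in> aff_chart A ` W}"
      using v \<open>v \<noteq> 0\<close> by blast
  qed
  moreover have "open ?H"
    by (intro open_Collect_neq continuous_on_chart_height continuous_intros)
  then have "open (?H \<inter> chart_coords A -` W)"
    by (intro continuous_open_preimage continuous_on_chart_coords W) auto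
  ultimately show ?thesis by (simp add: open_rp2_def)
qed

text \<open>Boundedness rests on the condition on the closure: the unit vectors over
  \<open>closure \<Omega>\<close> form a compact set on which \<open>chart_height\<close> has no
  zero, and their chart coordinates form a compact set containing \<open>D\<close>.\<close>

lemma convex_chart_domain:
  assumes "convex_chart A \<Omega>" "open \<Omega>"
  defines "D \<equiv> aff_chart A -` \<Omega>"
  shows "invertible A" "open D" "convex D" "bounded D" "aff_chart A ` D = \<Omega>"
proof -
  show A: "invertible A" and "convex D"
    using assms by (auto simp: convex_chart_def)
  show "open D"
    unfolding D_def using continuous_open_preimage[OF continuous_on_aff_chart[OF A] open_UNIV assms(2)] by simp
  have cl: "closure \<Omega> \<subseteq> range (aff_chart A)"
    using assms by (auto simp: convex_chart_def)
  moreover have "aff_chart A ` D = \<Omega> \<inter> range (aff_chart A)"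
    unfolding D_def by (rule image_vimage_eq)
  ultimately show "aff_chart A ` D = \<Omega>"
    using closure_subset[of \<Omega>] by blast
  let ?K = "sphere 0 1 \<inter> proj_pt -` closure \<Omega>"
  have "closedin (top_of_set (sphere 0 1)) ?K"
    by (rule continuous_closedin_preimage)
      (auto intro: continuous_on_subset[OF continuous_on_proj_pt])
  then have "compact ?K"
    by (rule closedin_compact[rotated]) auto
  moreover have h: "chart_height A v \<noteq> 0" if v: "v \<in> ?K" for v
  proof -
    from v cl obtain x where "proj_pt v = aff_chart A x" by auto
    moreover have "v \<noteq> 0" using v by auto
    ultimately show ?thesis using proj_pt_eq_aff_chart_iff[OF A] by blast
  qed
  ultimately have "compact (chart_coords A ` ?K)"
    by (intro compact_continuous_image continuous_on_chart_coords)
  moreover have "D \<subseteq> chart_coords A ` ?K"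
  proof
    fix x assume x: "x \<in> D"
    let ?u = "A *v homogeneous x"
    have u: "?u \<noteq> 0" by (rule invertible_mult_nonzero[OF A homogeneous_nonzero])
    have "(1 / norm ?u) *\<^sub>R ?u \<in> ?K"
      using u x proj_pt_scaleR[of "1 / norm ?u" ?u] closure_subset[of \<Omega>]
      by (auto simp: D_def aff_chart_eq)
    moreover have "chart_coords A ((1 / norm ?u) *\<^sub>R ?u) = x"
      by (rule chart_coords_scaleR[OF A]) (use u in auto)
    ultimately show "x \<in> chart_coords A ` ?K" by (rule image_eqI[rotated, OF _ sym])
  qed
  ultimately show "bounded D" using compact_imp_bounded bounded_subset by blast
qed

lemma continuous_on_inv_aff_chart:
  assumes A: "invertible A" and X: "X \<subseteq> range (aff_chart A)"
  shows "continuous_on X (inv_into UNIV (aff_chart A))"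
proof (rule continuous_on_subset[OF _ X])
  show "continuous_on (range (aff_chart A)) (inv_into UNIV (aff_chart A))"
  proof (subst continuous_on_open_vimage)
    show "open (range (aff_chart A))" by (rule open_aff_chart_image[OF A open_UNIV])
    show "\<forall>B. open B \<longrightarrow> open (inv_into UNIV (aff_chart A) -` B \<inter> range (aff_chart A))"
    proof (intro allI impI)
      fix B :: "(real^2) set" assume "open B"
      moreover have "inv_into UNIV (aff_chart A) -` B \<inter> range (aff_chart A) = aff_chart A ` B"
        using inj_aff_chart[OF A] by auto
      ultimately show "open (inv_into UNIV (aff_chart A) -` B \<inter> range (aff_chart A))"
        using open_aff_chart_image[OF A] by simp
    qed
  qed
qed

text \<open>The choices inside \<open>pgl_act\<close> only cost nonzero scalars: the coset consists
  of scalar multiples of one matrix, and \<open>rep_rp2\<close> picks a multiple of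
  \<open>v\<close>.\<close>

lemma pgl_act_matrix:
  assumes "g \<in> carrier PGL3"
  obtains M where "invertible M" "\<And>v. v \<noteq> 0 \<Longrightarrow> pgl_act g (proj_pt v) = proj_pt (M *v v)"
proof -
  define M where "M = (SOME M. M \<in> g)"
  obtain a where a: "invertible a" and g: "g = (\<Union>c\<in>{c. c \<noteq> 0}. {mat c ** a})"
    using assms by (auto simp: PGL3_def FactGroup_def RCOSETS_def r_coset_def GL3_def)
  have "mat 1 ** a \<in> g" using g by auto
  then have "M \<in> g" unfolding M_def by (rule someI)
  then obtain c where c: "c \<noteq> 0" "M = mat c ** a" using g by auto
  have "mat c ** (mat (1 / c)) = (mat 1 :: real^3^3)" "mat (1 / c) ** mat c = (mat 1 :: real^3^3)"
    using c by (auto simp: matrix_matrix_mult_def mat_def vec_eq_iff sum_3 forall_3)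
  then have "invertible (mat c :: real^3^3)" unfolding invertible_def by blast
  then have "invertible M" unfolding c by (intro invertible_mult a)
  moreover have "pgl_act g (proj_pt v) = proj_pt (M *v v)" if v: "v \<noteq> 0" for v
  proof -
    obtain c where c: "rep_rp2 (proj_pt v) = c *\<^sub>R v"
      using proj_pt_eq_iff[OF v rep_rp2_nonzero] proj_pt_rep_rp2 by metis
    then have "c \<noteq> 0" using rep_rp2_nonzero by auto
    then show ?thesis
      unfolding pgl_act_def M_def[symmetric] c matrix_vector_mult_scaleR
      by (rule proj_pt_scaleR) (rule invertible_mult_nonzero[OF \<open>invertible M\<close> v])
  qed
  ultimately show thesis by (rule that)
qed

subsection \<open>Inscribed triangles\<close>

lemma homogeneous_affine:
  assumes "w1 + w2 + w3 = 1"
  shows "homogeneous (w1 *\<^sub>R x1 + w2 *\<^sub>R x2 + w3 *\<^sub>R x3) =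
    w1 *\<^sub>R homogeneous x1 + w2 *\<^sub>R homogeneous x2 + w3 *\<^sub>R homogeneous x3"
  using assms by (simp add: homogeneous_def vec_eq_iff forall_3)

definition open_triangle :: "real^2 \<Rightarrow> real^2 \<Rightarrow> real^2 \<Rightarrow> (real^2) set" where
  "open_triangle x1 x2 x3 = {w1 *\<^sub>R x1 + w2 *\<^sub>R x2 + w3 *\<^sub>R x3 | w1 w2 w3.
     w1 > 0 \<and> w2 > 0 \<and> w3 > 0 \<and> w1 + w2 + w3 = 1}"

text \<open>With \<open>l\<^sub>i\<close> vanishing at \<open>x\<^sub>i\<close>, barycentric coordinates of the point with prescribed
  ratios of the \<open>l\<^sub>i\<close> are found by solving a linear system; the inequalities that define
  \<open>log_region\<close> say that they are positive.\<close>

lemma log_region_subset_image: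
  fixes l1 l2 l3 :: "real^3" and A :: "real^3^3" and x1 x2 x3 :: "real^2"
  defines "m \<equiv> \<lambda>l x. l \<bullet> (A *v homogeneous x)"
  assumes zero: "m l1 x1 = 0" "m l2 x2 = 0" "m l3 x3 = 0"
    and pos: "m l1 x2 > 0" "m l1 x3 > 0" "m l2 x1 > 0" "m l2 x3 > 0" "m l3 x1 > 0" "m l3 x2 > 0"
  defines "s \<equiv> (m l3 x2 * m l1 x3 * m l2 x1) / (m l1 x2 * m l2 x3 * m l3 x1)"
    and "\<kappa> \<equiv> vector [ln (m l1 x2 / m l3 x2), ln (m l2 x1 / m l3 x1)]"
  shows "(+) \<kappa> ` log_region s \<subseteq> (\<lambda>x. log_ratio l1 l2 l3 (A *v homogeneous x)) ` open_triangle x1 x2 x3"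
proof
  fix z assume "z \<in> (+) \<kappa> ` log_region s"
  then obtain y where y: "y \<in> log_region s" and z: "z = \<kappa> + y" by auto
  define P where "P = m l1 x2 * m l2 x3 * m l3 x1"
  define Q where "Q = m l3 x2 * m l1 x3 * m l2 x1"
  have PQ: "P > 0" "Q > 0" using pos by (auto simp: P_def Q_def)
  have s: "s = Q / P" by (simp add: s_def P_def Q_def)
  define X where "X = exp (y $ 1)"
  define Y where "Y = exp (y $ 2)"
  have XY: "X > 0" "Y > 0" "X + Y > 1" "X < 1 + s * Y" "Y < 1 + X / s"
    using y by (auto simp: X_def Y_def log_region_def)
  \<comment> \<open>Cramer's rule. The matrix of the values of the three forms at the three vertices
    has zero diagonal and determinant \<open>P + Q\<close>. Its adjugate, applied to the prescribed
    values \<open>X * (m l1 x2 / m l3 x2)\<close>, \<open>Y * (m l2 x1 / m l3 x1)\<close> and 1,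
    gives \<open>r1\<close>, \<open>r2\<close>, \<open>r3\<close>.\<close>
  define r1 where "r1 = m l1 x2 * m l2 x3 * (1 + s * Y - X)"
  define r2 where "r2 = m l1 x3 * m l2 x1 * (1 + X / s - Y)"
  define r3 where "r3 = m l2 x1 * m l1 x2 * (X + Y - 1)"
  have r: "r1 > 0" "r2 > 0" "r3 > 0"
    unfolding r1_def r2_def r3_def using pos XY by (intro mult_pos_pos; simp)+
  define R where "R = r1 + r2 + r3"
  have R: "R > 0" using r by (simp add: R_def)
  define p where "p = (r1 / R) *\<^sub>R x1 + (r2 / R) *\<^sub>R x2 + (r3 / R) *\<^sub>R x3"
  have sum1: "r1 / R + r2 / R + r3 / R = 1" using R by (simp add: R_def add_divide_distrib[symmetric])
  have p: "p \<in> open_triangle x1 x2 x3"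
    unfolding open_triangle_def p_def using r R sum1 by (intro CollectI exI conjI) auto
  have mp: "m l p = (r1 * m l x1 + r2 * m l x2 + r3 * m l x3) / R" for l
    unfolding m_def p_def homogeneous_affine[OF sum1]
    by (simp add: matrix_vector_right_distrib matrix_vector_mult_scaleR inner_add_right add_divide_distrib)
  have sX: "1 + s = (P + Q) / P" "1 + 1 / s = (P + Q) / Q"
    using PQ by (auto simp: s field_simps)
  have "r2 * m l1 x2 + r3 * m l1 x3 = m l1 x2 * m l1 x3 * m l2 x1 * X * (1 + 1 / s)"
    by (simp add: r2_def r3_def algebra_simps)
  also have "\<dots> = (P + Q) * (X * (m l1 x2 / m l3 x2))"
    unfolding sX using pos by (simp add: Q_def)
  finally have 1: "m l1 p = (P + Q) * (X * (m l1 x2 / m l3 x2)) / R"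
    by (simp add: mp zero)
  have "r1 * m l2 x1 + r3 * m l2 x3 = m l2 x1 * m l1 x2 * m l2 x3 * Y * (1 + s)"
    by (simp add: r1_def r3_def algebra_simps)
  also have "\<dots> = (P + Q) * (Y * (m l2 x1 / m l3 x1))"
    unfolding sX using pos by (simp add: P_def)
  finally have 2: "m l2 p = (P + Q) * (Y * (m l2 x1 / m l3 x1)) / R"
    by (simp add: mp zero)
  have "r1 * m l3 x1 + r2 * m l3 x2 = P * (1 + s * Y - X) + Q * (1 + X / s - Y)"
    by (simp add: r1_def r2_def P_def Q_def)
  also have "\<dots> = P + Q" using PQ by (simp add: s field_simps)
  finally have 3: "m l3 p = (P + Q) / R" by (simp add: mp zero)
  have ln: "(ln (((P + Q) * a / R)\<^sup>2) - ln (((P + Q) / R)\<^sup>2)) / 2 = ln a" if "a > 0" for a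
    using that PQ R by (simp add: ln_realpow ln_mult ln_div)
  have a: "X * (m l1 x2 / m l3 x2) > 0" "Y * (m l2 x1 / m l3 x1) > 0"
    using XY pos by auto
  have lr: "log_ratio l1 l2 l3 (A *v homogeneous p) =
      vector [(ln ((m l1 p)\<^sup>2) - ln ((m l3 p)\<^sup>2)) / 2, (ln ((m l2 p)\<^sup>2) - ln ((m l3 p)\<^sup>2)) / 2]"
    by (simp add: log_ratio_def m_def)
  have "log_ratio l1 l2 l3 (A *v homogeneous p) =
      vector [ln (X * (m l1 x2 / m l3 x2)), ln (Y * (m l2 x1 / m l3 x1))]"
    unfolding lr 1 2 3 ln[OF a(1)] ln[OF a(2)] ..
  also have "\<dots> = z"
    using XY(1,2) pos by (simp add: vec_eq_iff forall_2 z \<kappa>_def ln_mult ln_div X_def Y_def)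
  finally show "z \<in> (\<lambda>x. log_ratio l1 l2 l3 (A *v homogeneous x)) ` open_triangle x1 x2 x3"
    using p by blast
qed

text \<open>Multiplying each form by its sign on \<open>D\<close> makes it positive there. This
  changes neither the squares in \<open>log_ratio\<close> nor \<open>t\<close>, in which each form
  occurs once above and once below. The parameter of the region is then 1 / t, and the squared
  logarithm does not see the inversion.\<close>

lemma emeasure_log_ratio_triangle_ge:
  fixes l1 l2 l3 :: "real^3" and A :: "real^3^3" and x1 x2 x3 :: "real^2"
  defines "m \<equiv> \<lambda>l x. l \<bullet> (A *v homogeneous x)"
  assumes D: "convex D" "D \<noteq> {}" "{x1, x2, x3} \<subseteq> closure D"
    and nz: "\<And>x. x \<in> D \<Longrightarrow> m l1 x \<noteq> 0" "\<And>x. x \<in> D \<Longrightarrow> m l2 x \<noteq> 0" "\<And>x. x \<in> D \<Longrightarrow> m l3 x \<noteq> 0"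
    and zero: "m l1 x1 = 0" "m l2 x2 = 0" "m l3 x3 = 0"
    and ne: "m l1 x2 \<noteq> 0" "m l1 x3 \<noteq> 0" "m l2 x1 \<noteq> 0" "m l2 x3 \<noteq> 0" "m l3 x1 \<noteq> 0" "m l3 x2 \<noteq> 0"
    and t: "t = (m l1 x2 / m l3 x2) * (m l3 x1 / m l2 x1) * (m l2 x3 / m l1 x3)"
    and S: "open_triangle x1 x2 x3 \<subseteq> S"
      "(\<lambda>x. log_ratio l1 l2 l3 (A *v homogeneous x)) ` S \<in> sets lebesgue"
  shows "ennreal ((pi\<^sup>2 + (ln t)\<^sup>2) / 2) \<le> emeasure lebesgue ((\<lambda>x. log_ratio l1 l2 l3 (A *v homogeneous x)) ` S)"
proof -
  obtain p where p: "p \<in> D" using D by auto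
  define e where "e l = sgn (m l p)" for l
  have nn: "e l * m l x \<ge> 0" if l: "\<And>x. x \<in> D \<Longrightarrow> m l x \<noteq> 0" and x: "x \<in> closure D" for l x
  proof -
    have m: "m l x = (transpose A *v l) $ 3 + planar (transpose A *v l) \<bullet> x" for x
      unfolding m_def inner_homogeneous[symmetric] by (simp add: dot_lmul_matrix vector_transpose_matrix)
    have "m l x / m l p \<ge> 0"
      unfolding m by (rule affine_ratio_nonneg[OF D(1) p _ x]) (use l in \<open>simp add: m\<close>)
    then show ?thesis by (auto simp: e_def sgn_if zero_le_divide_iff)
  qed
  have e: "e l1 \<noteq> 0" "e l2 \<noteq> 0" "e l3 \<noteq> 0" "\<bar>e l1\<bar> = 1" "\<bar>e l2\<bar> = 1" "\<bar>e l3\<bar> = 1"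
    using nz p by (auto simp: e_def sgn_if)
  then have e2: "(e l1)\<^sup>2 = 1" "(e l2)\<^sup>2 = 1" "(e l3)\<^sup>2 = 1"
    by (metis power2_abs power_one)+
  have pos: "(e l *\<^sub>R l) \<bullet> (A *v homogeneous x) > 0"
    if "\<And>x. x \<in> D \<Longrightarrow> m l x \<noteq> 0" "x \<in> closure D" "m l x \<noteq> 0" "e l \<noteq> 0" for l x
    using nn[OF that(1,2)] that(3,4) by (simp add: m_def less_le)
  let ?s = "(((e l3 *\<^sub>R l3) \<bullet> (A *v homogeneous x2)) * ((e l1 *\<^sub>R l1) \<bullet> (A *v homogeneous x3)) *
      ((e l2 *\<^sub>R l2) \<bullet> (A *v homogeneous x1))) / (((e l1 *\<^sub>R l1) \<bullet> (A *v homogeneous x2)) *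
      ((e l2 *\<^sub>R l2) \<bullet> (A *v homogeneous x3)) * ((e l3 *\<^sub>R l3) \<bullet> (A *v homogeneous x1)))"
  have x: "x1 \<in> closure D" "x2 \<in> closure D" "x3 \<in> closure D" using D by auto
  note ps = pos[OF nz(1) x(2) ne(1) e(1)] pos[OF nz(1) x(3) ne(2) e(1)] pos[OF nz(2) x(1) ne(3) e(2)]
    pos[OF nz(2) x(3) ne(4) e(2)] pos[OF nz(3) x(1) ne(5) e(3)] pos[OF nz(3) x(2) ne(6) e(3)]
  have s: "?s > 0" using ps by (intro divide_pos_pos mult_pos_pos)
  have "?s = 1 / t"
    unfolding t m_def using e ne by (simp add: field_simps)
  then have ln: "(ln ?s)\<^sup>2 = (ln t)\<^sup>2"
    using s by (simp add: ln_div)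
  obtain \<kappa> where sub: "(+) \<kappa> ` log_region ?s \<subseteq>
      (\<lambda>x. log_ratio (e l1 *\<^sub>R l1) (e l2 *\<^sub>R l2) (e l3 *\<^sub>R l3) (A *v homogeneous x)) ` open_triangle x1 x2 x3"
    using log_region_subset_image[OF _ _ _ ps] zero unfolding m_def by simp
  have unscale: "log_ratio (e l1 *\<^sub>R l1) (e l2 *\<^sub>R l2) (e l3 *\<^sub>R l3) v = log_ratio l1 l2 l3 v" for v
    by (simp add: log_ratio_def power_mult_distrib e2)
  have sub': "(+) \<kappa> ` log_region ?s \<subseteq> (\<lambda>x. log_ratio l1 l2 l3 (A *v homogeneous x)) ` S"
    using sub[unfolded unscale] image_mono[OF S(1)] by (rule order_trans)
  have op: "open ((+) \<kappa> ` log_region ?s)" by (intro open_translation open_log_region s)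
  have "ennreal ((pi\<^sup>2 + (ln t)\<^sup>2) / 2) = emeasure lborel (log_region ?s)"
    by (simp only: emeasure_log_region[OF s] ln)
  also have "\<dots> = emeasure lebesgue (log_region ?s)"
    using open_log_region[OF s] by simp
  also have "\<dots> = emeasure lebesgue ((+) \<kappa> ` log_region ?s)"
    using emeasure_lebesgue_affine[of 1 \<kappa> "log_region ?s"] by (simp add: add.commute[of _ \<kappa>])
  also have "\<dots> \<le> emeasure lebesgue ((\<lambda>x. log_ratio l1 l2 l3 (A *v homogeneous x)) ` S)"
    by (rule emeasure_mono[OF sub' S(2)])
  finally show ?thesis .
qed

subsection \<open>Topology of the model triangle\<close>

lemma other_indices_3: "\<exists>i j::3. i \<noteq> j \<and> i \<noteq> k \<and> j \<noteq> k \<and> UNIV = {i, j, k}"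
proof -
  consider "k = 1" | "k = 2" | "k = 3" using exhaust_3 by blast
  then show ?thesis
  proof cases
    case 1
    moreover have "(UNIV :: 3 set) = {2, 3, 1}" unfolding UNIV_3 by blast
    ultimately have "(2::3) \<noteq> 3 \<and> 2 \<noteq> k \<and> 3 \<noteq> k \<and> UNIV = {2, 3, k}" by (simp del: UNIV_3)
    then show ?thesis by blast
  next
    case 2
    moreover have "(UNIV :: 3 set) = {1, 3, 2}" unfolding UNIV_3 by blast
    ultimately have "(1::3) \<noteq> 3 \<and> 1 \<noteq> k \<and> 3 \<noteq> k \<and> UNIV = {1, 3, k}" by (simp del: UNIV_3)
    then show ?thesis by blast
  next
    case 3
    moreover have "(UNIV :: 3 set) = {1, 2, 3}" unfolding UNIV_3 by blast
    ultimately have "(1::3) \<noteq> 2 \<and> 1 \<noteq> k \<and> 2 \<noteq> k \<and> UNIV = {1, 2, k}" by (simp del: UNIV_3)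
    then show ?thesis by blast
  qed
qed

lemma sum_other_indices_3:
  fixes f :: "3 \<Rightarrow> real"
  assumes "i \<noteq> j" "i \<noteq> k" "j \<noteq> k" "UNIV = {i, j, k}"
  shows "sum f UNIV = f i + f j + f k"
proof -
  have "sum f UNIV = sum f {i, j, k}" by (rule arg_cong[OF assms(4)])
  also have "\<dots> = f i + f j + f k" using assms(1-3) by (simp add: add.assoc)
  finally show ?thesis .
qed

text \<open>Parametrises an open edge by an interval, so that invariance of domain in dimension one
  applies to maps between edges.\<close>

lemma triangle_edge_homeomorphism:
  obtains \<gamma> c where "homeomorphism {0<..<1::real} (triangle_edge k) \<gamma> c"
proof -
  obtain i j where ij: "i \<noteq> j" "i \<noteq> k" "j \<noteq> k" "(UNIV :: 3 set) = {i, j, k}"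
    using other_indices_3[of k] by blast
  have all: "(\<forall>l. P l) \<longleftrightarrow> P i \<and> P j \<and> P k" for P :: "3 \<Rightarrow> bool"
    using ij(4) by (metis UNIV_I insertE singletonD)
  have sum: "(\<Sum>l\<in>UNIV. f l) = f i + f j + f k" for f :: "3 \<Rightarrow> real"
    by (rule sum_other_indices_3[OF ij])
  have edge: "z \<in> triangle_edge k \<longleftrightarrow> z $ k = 0 \<and> z $ i > 0 \<and> z $ j > 0 \<and> z $ i + z $ j = 1" for z
    using ij by (auto simp: triangle_edge_def model_triangle_def all sum)
  have "homeomorphism {0<..<1} (triangle_edge k) (\<lambda>t. t *\<^sub>R axis i 1 + (1 - t) *\<^sub>R axis j 1) (\<lambda>z. z $ i)"
  proof (rule homeomorphismI)
    show "continuous_on {0<..<1} (\<lambda>t::real. t *\<^sub>R axis i 1 + (1 - t) *\<^sub>R axis j 1 :: real^3)"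
      by (intro continuous_intros)
    show "continuous_on (triangle_edge k) (\<lambda>z. z $ i)" by (intro continuous_intros)
    show "(\<lambda>t. t *\<^sub>R axis i 1 + (1 - t) *\<^sub>R axis j 1) ` {0<..<1} \<subseteq> triangle_edge k"
      using ij by (auto simp: edge axis_def)
    show "(\<lambda>z. z $ i) ` triangle_edge k \<subseteq> {0<..<1}"
      by (auto simp: edge)
    show "(x *\<^sub>R axis i 1 + (1 - x) *\<^sub>R axis j 1 :: real^3) $ i = x" for x :: real
      using ij by (simp add: axis_def)
    show "z $ i *\<^sub>R axis i 1 + (1 - z $ i) *\<^sub>R axis j 1 = z" if "z \<in> triangle_edge k" for z
      using that ij by (auto simp: edge vec_eq_iff all axis_def)
  qed
  then show thesis by (rule that)
qed

lemma connected_triangle_edge: "connected (triangle_edge k)"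
proof -
  obtain \<gamma> c where "homeomorphism {0<..<1::real} (triangle_edge k) \<gamma> c"
    by (rule triangle_edge_homeomorphism)
  then show ?thesis
    using connected_continuous_image[of "{0<..<1::real}" \<gamma>] by (auto simp: homeomorphism_def)
qed

lemma triangle_edge_nonempty: "triangle_edge k \<noteq> {}"
proof -
  obtain \<gamma> c where "homeomorphism {0<..<1::real} (triangle_edge k) \<gamma> c"
    by (rule triangle_edge_homeomorphism)
  then have "\<gamma> ` {0<..<1} = triangle_edge k" by (simp add: homeomorphism_def)
  moreover have "(1/2::real) \<in> {0<..<1}" by simp
  ultimately show ?thesis by (metis empty_iff image_eqI)
qed

lemma triangle_edge_disjoint: "k \<noteq> l \<Longrightarrow> triangle_edge k \<inter> triangle_edge l = {}"
proof -
  assume "k \<noteq> l"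
  have False if "z \<in> triangle_edge k" "z \<in> triangle_edge l" for z
  proof -
    have "z $ k = 0" using that(1) by (simp add: triangle_edge_def)
    moreover have "z $ k > 0" using that(2) \<open>k \<noteq> l\<close> by (simp add: triangle_edge_def)
    ultimately show False by simp
  qed
  then show ?thesis by blast
qed

lemma triangle_edge_interior_disjoint: "triangle_edge k \<inter> triangle_interior = {}"
proof -
  have False if "z \<in> triangle_edge k" "z \<in> triangle_interior" for z
  proof -
    have "z $ k = 0" using that(1) by (simp add: triangle_edge_def)
    moreover have "z $ k > 0" using that(2) by (simp add: triangle_interior_def)
    ultimately show False by simp
  qed
  then show ?thesis by blast
qed

lemma not_triangle_vertex: "z $ k = 0 \<Longrightarrow> (\<And>l. l \<noteq> k \<Longrightarrow> z $ l > 0) \<Longrightarrow> z \<notin> triangle_vertices"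
proof
  assume z: "z $ k = 0" "\<And>l. l \<noteq> k \<Longrightarrow> z $ l > 0" "z \<in> triangle_vertices"
  then obtain m where m: "z = axis m 1" by (auto simp: triangle_vertices_def)
  obtain i j :: 3 where "i \<noteq> j" "i \<noteq> k" "j \<noteq> k" using other_indices_3[of k] by blast
  then have "z $ i > 0" "z $ j > 0" using z by auto
  then show False using m \<open>i \<noteq> j\<close> by (auto simp: axis_def split: if_splits)
qed

text \<open>Two vanishing coordinates force a vertex, because the coordinates are nonnegative and
  add up to 1.\<close>

lemma model_ideal_triangle_eq:
  "model_ideal_triangle = triangle_interior \<union> (\<Union>k. triangle_edge k)"
proof (rule Set.set_eqI, rule iffI)
  fix z assume "z \<in> model_ideal_triangle"
  then have z3: "z \<in> model_triangle" and "z \<notin> triangle_vertices"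
    by (simp_all add: model_ideal_triangle_def)
  then have nv: "z \<noteq> axis m 1" for m unfolding triangle_vertices_def by blast
  have z: "\<And>k. z $ k \<ge> 0" "(\<Sum>k\<in>UNIV. z $ k) = 1"
    using z3 by (simp_all add: model_triangle_def)
  have "z \<in> triangle_edge k" if "z $ k = 0" for k
  proof -
    have "z $ l > 0" if "l \<noteq> k" for l
    proof (rule ccontr)
      assume "\<not> z $ l > 0"
      then have "z $ l = 0" using z(1)[of l] by linarith
      obtain i j where ij: "i \<noteq> j" "i \<noteq> k" "j \<noteq> k" "(UNIV :: 3 set) = {i, j, k}"
        using other_indices_3[of k] by blast
      have "l = i \<or> l = j" using ij(4) \<open>l \<noteq> k\<close> by (metis UNIV_I insertE singletonD)
      then obtain m where m: "z $ m = 1" "\<And>n. n \<noteq> m \<Longrightarrow> z $ n = 0"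
      proof
        assume "l = i"
        have "z $ j = 1" using z(2) sum_other_indices_3[OF ij, of "($) z"] \<open>z $ l = 0\<close> \<open>z $ k = 0\<close> \<open>l = i\<close> by simp
        moreover have "z $ n = 0" if "n \<noteq> j" for n
          using that ij(4) \<open>z $ l = 0\<close> \<open>z $ k = 0\<close> \<open>l = i\<close> by (metis UNIV_I insertE singletonD)
        ultimately show ?thesis using that by blast
      next
        assume "l = j"
        have "z $ i = 1" using z(2) sum_other_indices_3[OF ij, of "($) z"] \<open>z $ l = 0\<close> \<open>z $ k = 0\<close> \<open>l = j\<close> by simp
        moreover have "z $ n = 0" if "n \<noteq> i" for n
          using that ij(4) \<open>z $ l = 0\<close> \<open>z $ k = 0\<close> \<open>l = j\<close> by (metis UNIV_I insertE singletonD)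
        ultimately show ?thesis using that by blast
      qed
      then have "z = axis m 1" by (auto simp: vec_eq_iff axis_def)
      then show False using nv by blast
    qed
    then show ?thesis using that z3 by (simp add: triangle_edge_def)
  qed
  moreover have "z \<in> triangle_interior" if "\<And>k. z $ k \<noteq> 0"
  proof -
    have "z $ k > 0" for k using that[of k] z(1)[of k] by linarith
    then show ?thesis using z3 by (simp add: triangle_interior_def)
  qed
  ultimately show "z \<in> triangle_interior \<union> (\<Union>k. triangle_edge k)" by blast
next
  fix z assume z: "z \<in> triangle_interior \<union> (\<Union>k. triangle_edge k)"
  have "z \<notin> triangle_vertices" if "z \<in> triangle_interior"
  proof
    assume "z \<in> triangle_vertices"
    then obtain m where m: "z = axis m 1" by (auto simp: triangle_vertices_def)
    obtain i :: 3 where "i \<noteq> m" using other_indices_3[of m] by blast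
    moreover have "z $ i > 0" using that by (simp add: triangle_interior_def)
    ultimately show False using m by (simp add: axis_def)
  qed
  moreover have "z \<notin> triangle_vertices" if "z \<in> triangle_edge k" for k
    using that not_triangle_vertex[of z k] by (auto simp: triangle_edge_def)
  moreover have "z \<in> model_triangle" using z by (auto simp: triangle_interior_def triangle_edge_def)
  ultimately show "z \<in> model_ideal_triangle"
    using z by (auto simp: model_ideal_triangle_def)
qed

lemma closedin_triangle_edge: "closedin (top_of_set model_ideal_triangle) (triangle_edge k)"
proof -
  have "triangle_edge k = model_ideal_triangle \<inter> {z. z $ k = 0}"
  proof
    show "triangle_edge k \<subseteq> model_ideal_triangle \<inter> {z. z $ k = 0}"
      by (auto simp: model_ideal_triangle_eq) (simp add: triangle_edge_def)
    show "model_ideal_triangle \<inter> {z. z $ k = 0} \<subseteq> triangle_edge k"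
    proof
      fix z assume z: "z \<in> model_ideal_triangle \<inter> {z. z $ k = 0}"
      have "z \<notin> triangle_interior"
      proof
        assume "z \<in> triangle_interior"
        then have "z $ k > 0" by (simp add: triangle_interior_def)
        then show False using z by simp
      qed
      then obtain l where l: "z \<in> triangle_edge l" using z by (auto simp: model_ideal_triangle_eq)
      have "l = k"
      proof (rule ccontr)
        assume "l \<noteq> k"
        then have "z $ k > 0" using l by (simp add: triangle_edge_def)
        then show False using z by simp
      qed
      then show "z \<in> triangle_edge k" using l by simp
    qed
  qed
  moreover have "closed {z::real^3. z $ k = 0}"
    by (intro closed_Collect_eq continuous_intros)
  ultimately show ?thesis by (simp add: closedin_closed_Int)
qed

lemma triangle_interior_chart:
  "triangle_interior = (\<lambda>x::real^2. vector [x $ 1, x $ 2, 1 - x $ 1 - x $ 2]) ` {x. x $ 1 > 0 \<and> x $ 2 > 0 \<and> x $ 1 + x $ 2 < 1}"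
proof (rule Set.set_eqI, rule iffI)
  fix z assume "z \<in> triangle_interior"
  then have "z $ 1 > 0" "z $ 2 > 0" "z $ 3 > 0" "z $ 3 = 1 - z $ 1 - z $ 2"
    by (auto simp: triangle_interior_def model_triangle_def sum_3)
  then show "z \<in> (\<lambda>x::real^2. vector [x $ 1, x $ 2, 1 - x $ 1 - x $ 2]) ` {x. x $ 1 > 0 \<and> x $ 2 > 0 \<and> x $ 1 + x $ 2 < 1}"
    by (intro image_eqI[of _ _ "vector [z $ 1, z $ 2]"]) (auto simp: vec_eq_iff forall_3)
next
  fix z assume "z \<in> (\<lambda>x::real^2. vector [x $ 1, x $ 2, 1 - x $ 1 - x $ 2] :: real^3) ` {x. x $ 1 > 0 \<and> x $ 2 > 0 \<and> x $ 1 + x $ 2 < 1}"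
  then show "z \<in> triangle_interior"
    by (auto simp: triangle_interior_def model_triangle_def sum_3 forall_3)
qed

text \<open>The open triangle lies in a plane of \<open>real^3\<close>, so invariance of domain is
  applied after parametrising it by an open set of \<open>real^2\<close>.\<close>

lemma open_image_triangle_interior:
  fixes f :: "real^3 \<Rightarrow> real^2"
  assumes "continuous_on triangle_interior f" "inj_on f triangle_interior"
  shows "open (f ` triangle_interior)"
proof -
  let ?\<psi> = "\<lambda>x::real^2. vector [x $ 1, x $ 2, 1 - x $ 1 - x $ 2] :: real^3"
  let ?U = "{x::real^2. x $ 1 > 0 \<and> x $ 2 > 0 \<and> x $ 1 + x $ 2 < 1}"
  have eq: "?\<psi> = (\<lambda>x. x $ 1 *\<^sub>R axis 1 1 + x $ 2 *\<^sub>R axis 2 1 + (1 - x $ 1 - x $ 2) *\<^sub>R axis 3 1)"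
    by (auto simp: fun_eq_iff vec_eq_iff forall_3 axis_def)
  have c: "continuous_on ?U ?\<psi>" unfolding eq by (intro continuous_intros)
  have inj: "inj_on ?\<psi> ?U" by (auto simp: inj_on_def vec_eq_iff forall_3 forall_2)
  have "open ((f \<circ> ?\<psi>) ` ?U)"
  proof (rule invariance_of_domain)
    show "continuous_on ?U (f \<circ> ?\<psi>)"
      using c assms(1) by (intro continuous_on_compose) (simp_all flip: triangle_interior_chart)
    show "open ?U"
      by (intro open_Collect_conj open_Collect_less continuous_intros)
    show "inj_on (f \<circ> ?\<psi>) ?U"
      using inj assms(2) by (intro comp_inj_on) (simp_all flip: triangle_interior_chart)
  qed
  then show ?thesis unfolding triangle_interior_chart image_comp .
qed

lemma compact_model_triangle: "compact model_triangle"
proof -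
  have "bounded model_triangle"
  proof (rule bounded_subset[OF bounded_cbox])
    show "model_triangle \<subseteq> cbox 0 (vec 1)"
    proof
      fix z assume z: "z \<in> model_triangle"
      have "z $ i \<le> 1" for i
        using z member_le_sum[of i UNIV "($) z"] by (simp add: model_triangle_def)
      then show "z \<in> cbox 0 (vec 1)" using z by (simp add: mem_box_cart model_triangle_def)
    qed
  qed
  moreover have "closed model_triangle"
    unfolding model_triangle_def
    by (intro closed_Collect_conj closed_Collect_all closed_Collect_le closed_Collect_eq continuous_intros)
  ultimately show ?thesis by (simp add: compact_eq_bounded_closed)
qed

text \<open>The image of the open triangle is open in its plane, and near a point of an edge the triangle is
  not.\<close>

lemma triangle_self_map_interior:
  fixes g :: "real^3 \<Rightarrow> real^3"
  assumes cont: "continuous_on triangle_interior g" and inj: "inj_on g triangle_interior"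
    and im: "g ` triangle_interior \<subseteq> model_triangle"
  shows "g ` triangle_interior \<subseteq> triangle_interior"
proof -
  let ?\<pi> = "\<lambda>z::real^3. vector [z $ 1, z $ 2] :: real^2"
  have inj\<pi>: "inj_on ?\<pi> model_triangle"
    by (auto simp: inj_on_def model_triangle_def vec_eq_iff sum_3 forall_3 forall_2)
  have op: "open ((?\<pi> \<circ> g) ` triangle_interior)"
  proof (rule open_image_triangle_interior)
    have "continuous_on X ?\<pi>" for X
      unfolding vector_2_eq by (intro continuous_intros)
    then show "continuous_on triangle_interior (?\<pi> \<circ> g)"
      by (intro continuous_on_compose cont)
    show "inj_on (?\<pi> \<circ> g) triangle_interior"
      by (rule comp_inj_on[OF inj inj_on_subset[OF inj\<pi> im]])
  qed
  have sub: "x $ 1 \<ge> 0 \<and> x $ 2 \<ge> 0 \<and> x $ 1 + x $ 2 \<le> 1" if "x \<in> (?\<pi> \<circ> g) ` triangle_interior" for x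
  proof -
    from that obtain z where z: "z \<in> triangle_interior" "x = ?\<pi> (g z)" by auto
    then have "g z \<in> model_triangle" using im by auto
    then have "g z $ 1 \<ge> 0" "g z $ 2 \<ge> 0" "g z $ 3 \<ge> 0" "g z $ 1 + g z $ 2 + g z $ 3 = 1"
      by (auto simp: model_triangle_def sum_3)
    then show ?thesis using z by simp
  qed
  show ?thesis
  proof
    fix w assume w: "w \<in> g ` triangle_interior"
    then have wm: "w \<in> model_triangle" using im by auto
    have sum: "w $ 1 + w $ 2 + w $ 3 = 1" using wm by (simp add: model_triangle_def sum_3)
    have "?\<pi> w \<in> (?\<pi> \<circ> g) ` triangle_interior" using w by auto
    then obtain e where e: "e > 0" "ball (?\<pi> w) e \<subseteq> (?\<pi> \<circ> g) ` triangle_interior"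
      using op unfolding open_contains_ball by blast
    have "?\<pi> w + (e / 2) *\<^sub>R d \<in> ball (?\<pi> w) e" if "norm d = 1" for d
      using e that by (simp add: dist_norm)
    then have d: "?\<pi> w + (e / 2) *\<^sub>R d \<in> (?\<pi> \<circ> g) ` triangle_interior" if "norm d = 1" for d
      using e that by blast
    \<comment> \<open>Moving by e / 2 in these directions lowers the first, second and third
      barycentric coordinate in turn. None may become negative, so all are positive.\<close>
    have norm1: "norm (- axis 1 1 :: real^2) = 1" "norm (- axis 2 1 :: real^2) = 1" "norm (axis 1 1 :: real^2) = 1"
      by simp_all
    have "w $ 1 - e / 2 \<ge> 0"
      using sub[OF d[of "- axis 1 1", OF norm1(1)]] by (simp add: axis_def)
    moreover have "w $ 2 - e / 2 \<ge> 0"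
      using sub[OF d[of "- axis 2 1", OF norm1(2)]] by (simp add: axis_def)
    moreover have "w $ 1 + e / 2 + w $ 2 \<le> 1"
      using sub[OF d[of "axis 1 1", OF norm1(3)]] by (simp add: axis_def)
    ultimately have "w $ 1 > 0" "w $ 2 > 0" "w $ 3 > 0" using e sum by linarith+
    then show "w \<in> triangle_interior" using wm by (simp add: triangle_interior_def forall_3)
  qed
qed

text \<open>Pulled back to the interval, the edge \<open>m\<close> becomes a nonempty subset that is
  open by invariance of domain and closed because edges are closed in the ideal triangle. By
  connectedness it is the whole interval.\<close>

lemma triangle_edge_eq_image:
  fixes g :: "real^3 \<Rightarrow> real^3"
  assumes "continuous_on (triangle_edge k) g" "inj_on g (triangle_edge k)"
    and closed: "\<And>C. closedin (top_of_set (triangle_edge k)) C \<Longrightarrow>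
      closedin (top_of_set model_ideal_triangle) (g ` C)"
    and sub: "triangle_edge m \<subseteq> g ` triangle_edge k"
  shows "triangle_edge m = g ` triangle_edge k"
proof -
  have gsub: "g ` triangle_edge k \<subseteq> model_ideal_triangle"
    by (rule closedin_imp_subset[OF closed]) simp
  obtain g' where g': "homeomorphism (triangle_edge k) (g ` triangle_edge k) g g'"
  proof (rule homeomorphism_injective_closed_map[OF assms(1) refl assms(2)])
    fix C assume C: "closedin (top_of_set (triangle_edge k)) C"
    show "closedin (top_of_set (g ` triangle_edge k)) (g ` C)"
      using closed[OF C] gsub closedin_imp_subset[OF C] by (meson closedin_subset_trans image_mono)
  qed
  obtain \<gamma> c where k: "homeomorphism {0<..<1::real} (triangle_edge k) \<gamma> c"
    by (rule triangle_edge_homeomorphism)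
  obtain \<gamma>' c' where m: "homeomorphism {0<..<1::real} (triangle_edge m) \<gamma>' c'"
    by (rule triangle_edge_homeomorphism)
  have hk: "homeomorphism (g ` triangle_edge k) {0<..<1} (c \<circ> g') (g \<circ> \<gamma>)"
    using homeomorphism_compose[OF g'[THEN homeomorphism_symD] k[THEN homeomorphism_symD]] .
  let ?W = "(c \<circ> g') ` triangle_edge m"
  have W: "?W = (c \<circ> g' \<circ> \<gamma>') ` {0<..<1}"
  proof -
    have "\<gamma>' ` {0<..<1} = triangle_edge m" using m by (simp add: homeomorphism_def)
    then show ?thesis by (simp only: image_comp[symmetric])
  qed
  have "open ?W"
    unfolding W
  proof (rule invariance_of_domain)
    show "continuous_on {0<..<1} (c \<circ> g' \<circ> \<gamma>')"
    proof (rule continuous_on_compose)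
      show "continuous_on {0<..<1} \<gamma>'" using m by (simp add: homeomorphism_def)
      have "continuous_on (g ` triangle_edge k) (c \<circ> g')" using hk by (simp add: homeomorphism_def)
      then show "continuous_on (\<gamma>' ` {0<..<1}) (c \<circ> g')"
        using m sub by (simp add: homeomorphism_def continuous_on_subset)
    qed
    have inj: "inj_on (c \<circ> g') (g ` triangle_edge k)" "inj_on \<gamma>' {0<..<1}"
      by (rule inj_on_inverseI, erule homeomorphism_apply1[OF hk])
        (rule inj_on_inverseI, erule homeomorphism_apply1[OF m])
    have "\<gamma>' ` {0<..<1} = triangle_edge m" using m by (simp add: homeomorphism_def)
    then show "inj_on (c \<circ> g' \<circ> \<gamma>') {0<..<1}"
      using comp_inj_on[OF inj(2), of "c \<circ> g'"] inj_on_subset[OF inj(1) sub] by simp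
  qed simp
  moreover have Wsub: "?W \<subseteq> {0<..<1}"
    using image_mono[OF sub, of "c \<circ> g'"] homeomorphism_image1[OF hk] by simp
  ultimately have "openin (top_of_set {0<..<1}) ?W" by (simp add: open_subset)
  moreover have "closedin (top_of_set {0<..<1}) ?W"
  proof (rule homeomorphism_imp_closed_map[OF hk])
    show "closedin (top_of_set (g ` triangle_edge k)) (triangle_edge m)"
      by (rule closedin_subset_trans[OF closedin_triangle_edge sub gsub])
  qed
  ultimately have "?W = {} \<or> ?W = {0<..<1}"
    using connected_clopen[of "{0<..<1::real}"] connected_Ioo[of 0 "1::real"] by blast
  then have "?W = {0<..<1}" using triangle_edge_nonempty by blast
  then have "(g \<circ> \<gamma>) ` ?W = g ` triangle_edge k" using hk by (simp add: homeomorphism_def)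
  moreover have "(g \<circ> \<gamma>) ` ?W = triangle_edge m"
  proof -
    have "(g \<circ> \<gamma>) ((c \<circ> g') x) = x" if "x \<in> triangle_edge m" for x
      by (rule homeomorphism_apply1[OF hk subsetD[OF sub that]])
    then show ?thesis unfolding image_image by simp
  qed
  ultimately show ?thesis by simp
qed

text \<open>The image of the interior stays inside the interior, so the edges can only be covered by
  images of edges. These are closed and pairwise equal or disjoint, hence a connected edge lies in a
  single one of them, and then equals it.\<close>

lemma triangle_self_map_covers_interior:
  fixes g :: "real^3 \<Rightarrow> real^3"
  assumes cont: "continuous_on model_ideal_triangle g"
    and im: "g ` model_ideal_triangle = model_ideal_triangle"
    and inj: "inj_on g triangle_interior" "\<And>k. inj_on g (triangle_edge k)"
    and sep: "\<And>k. g ` triangle_interior \<inter> g ` triangle_edge k = {}"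
    and edges: "\<And>k l. g ` triangle_edge k = g ` triangle_edge l \<or> g ` triangle_edge k \<inter> g ` triangle_edge l = {}"
    and closed: "\<And>k C. closedin (top_of_set (triangle_edge k)) C \<Longrightarrow>
      closedin (top_of_set model_ideal_triangle) (g ` C)"
  shows "triangle_interior \<subseteq> g ` triangle_interior"
proof -
  have sub: "triangle_interior \<subseteq> model_ideal_triangle" "triangle_edge k \<subseteq> model_ideal_triangle" for k
    by (auto simp: model_ideal_triangle_eq)
  have "model_ideal_triangle \<subseteq> model_triangle" by (auto simp: model_ideal_triangle_def)
  then have int: "g ` triangle_interior \<subseteq> triangle_interior"
    using im sub by (intro triangle_self_map_interior inj continuous_on_subset[OF cont]) blast+
  have cover: "triangle_edge m \<subseteq> (\<Union>k. g ` triangle_edge k)" for m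
  proof
    fix w assume w: "w \<in> triangle_edge m"
    then obtain z where z: "z \<in> model_ideal_triangle" "w = g z" using im sub by blast
    have "z \<notin> triangle_interior"
      using w z int triangle_edge_interior_disjoint[of m] by blast
    then show "w \<in> (\<Union>k. g ` triangle_edge k)" using z by (auto simp: model_ideal_triangle_eq)
  qed
  have closed': "closedin (top_of_set model_ideal_triangle) (g ` triangle_edge k)" for k
    by (rule closed[of k]) simp
  have "\<exists>k. triangle_edge m = g ` triangle_edge k" for m
  proof -
    obtain w where "w \<in> triangle_edge m" using triangle_edge_nonempty by blast
    then obtain k where k: "w \<in> g ` triangle_edge k" using cover by blast
    \<comment> \<open>The edge images disjoint from the chosen one. Being finitely many, they have a
      closed union, which would disconnect the edge \<open>m\<close> if it met it.\<close>
    let ?B = "\<Union>l\<in>{l. g ` triangle_edge l \<inter> g ` triangle_edge k = {}}. g ` triangle_edge l"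
    have "closedin (top_of_set model_ideal_triangle) ?B"
      by (intro closedin_Union) (auto intro: closed')
    then have B: "closedin (top_of_set (triangle_edge m)) (triangle_edge m \<inter> ?B)"
      using sub(2)[of m] by (meson closedin_subset_trans closedin_closed closedin_closed_Int inf_le1 subset_trans closedin_Int closedin_triangle_edge closedin_subset)
    have A: "closedin (top_of_set (triangle_edge m)) (triangle_edge m \<inter> g ` triangle_edge k)"
      using closed'[of k] sub(2)[of m] by (meson closedin_subset_trans closedin_Int closedin_triangle_edge inf_le1)
    have cov: "triangle_edge m \<subseteq> (triangle_edge m \<inter> g ` triangle_edge k) \<union> (triangle_edge m \<inter> ?B)"
    proof
      fix x assume x: "x \<in> triangle_edge m"
      then obtain l where l: "x \<in> g ` triangle_edge l" using cover by blast
      show "x \<in> (triangle_edge m \<inter> g ` triangle_edge k) \<union> (triangle_edge m \<inter> ?B)"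
        using edges[of l k]
      proof
        assume "g ` triangle_edge l = g ` triangle_edge k"
        then show ?thesis using x l by simp
      next
        assume "g ` triangle_edge l \<inter> g ` triangle_edge k = {}"
        then have "x \<in> ?B" using l by (intro UN_I[of l]) simp_all
        then show ?thesis using x by simp
      qed
    qed
    have ne: "triangle_edge m \<inter> g ` triangle_edge k \<noteq> {}" using \<open>w \<in> triangle_edge m\<close> k by blast
    have disj: "(triangle_edge m \<inter> g ` triangle_edge k) \<inter> (triangle_edge m \<inter> ?B) = {}" by blast
    have "triangle_edge m \<inter> ?B = {}"
      by (rule ccontr, rule notE[OF connected_triangle_edge[of m, unfolded connected_closedin]],
        intro exI conjI) (rule A B cov disj ne, assumption?)+
    with cov have "triangle_edge m \<subseteq> triangle_edge m \<inter> g ` triangle_edge k"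
      by (simp only: Un_empty_right)
    then have "triangle_edge m \<subseteq> g ` triangle_edge k" by (rule order_trans) (rule inf_le2)
    then have "triangle_edge m = g ` triangle_edge k"
      by (intro triangle_edge_eq_image inj(2) closed continuous_on_subset[OF cont sub(2)])
    then show ?thesis ..
  qed
  then obtain f where f: "\<And>m. triangle_edge m = g ` triangle_edge (f m)" by metis
  \<comment> \<open>Distinct edges are images of distinct edges, and there are only three of them.
    So every image of an edge is an edge, and interior points can be reached from the interior
    only.\<close>
  have "inj f"
  proof (rule injI, rule ccontr)
    fix m n assume "f m = f n" "m \<noteq> n"
    then have "triangle_edge m = triangle_edge n" using f by metis
    then show False using triangle_edge_disjoint[OF \<open>m \<noteq> n\<close>] triangle_edge_nonempty by blast
  qed
  then have surj: "surj f" by (simp add: finite_UNIV_inj_surj)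
  show ?thesis
  proof
    fix w assume w: "w \<in> triangle_interior"
    then obtain z where z: "z \<in> model_ideal_triangle" "w = g z" using im sub by blast
    have "z \<notin> triangle_edge k" for k
    proof
      assume "z \<in> triangle_edge k"
      obtain m where "k = f m" using surj by blast
      then have "w \<in> triangle_edge m" using f[of m] z \<open>z \<in> triangle_edge k\<close> by blast
      then show False using w triangle_edge_interior_disjoint by blast
    qed
    then show "w \<in> g ` triangle_interior" using z by (auto simp: model_ideal_triangle_eq)
  qed
qed

text \<open>The barycentric parametrisation \<open>L\<close> of the straight triangle turns
  \<open>G\<close> into a self-map of the model. Closedness is required in the larger set
  \<open>D\<close>, where properness of a lift provides it, and restricts to the straight
  triangle.\<close>

lemma triangle_map_covers_open_triangle:
  fixes G :: "real^3 \<Rightarrow> real^2"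
  assumes det: "(x2 $ 1 - x1 $ 1) * (x3 $ 2 - x1 $ 2) - (x2 $ 2 - x1 $ 2) * (x3 $ 1 - x1 $ 1) \<noteq> 0"
    and cont: "continuous_on model_ideal_triangle G"
    and im: "G ` model_ideal_triangle = convex hull {x1, x2, x3} - {x1, x2, x3}"
    and inj: "inj_on G triangle_interior" "\<And>k. inj_on G (triangle_edge k)"
    and sep: "\<And>k. G ` triangle_interior \<inter> G ` triangle_edge k = {}"
    and edges: "\<And>k l. G ` triangle_edge k = G ` triangle_edge l \<or> G ` triangle_edge k \<inter> G ` triangle_edge l = {}"
    and D: "convex hull {x1, x2, x3} - {x1, x2, x3} \<subseteq> D"
    and closed: "\<And>k C. closedin (top_of_set (triangle_edge k)) C \<Longrightarrow> closedin (top_of_set D) (G ` C)"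
  shows "open_triangle x1 x2 x3 \<subseteq> G ` triangle_interior"
proof -
  define L where "L z = z $ 1 *\<^sub>R x1 + z $ 2 *\<^sub>R x2 + z $ 3 *\<^sub>R x3" for z :: "real^3"
  have contL: "continuous_on X L" for X
    unfolding L_def by (intro continuous_intros)
  have Laxis: "L (axis 1 1) = x1" "L (axis 2 1) = x2" "L (axis 3 1) = x3"
    by (simp_all add: L_def axis_def)
  have injL: "inj_on L model_triangle"
  proof (rule inj_onI)
    fix z w assume zw: "z \<in> model_triangle" "w \<in> model_triangle" "L z = L w"
    define a where "a = z - w"
    have a1: "a $ 1 = - a $ 2 - a $ 3"
      using zw(1,2) by (simp add: a_def model_triangle_def sum_3)
    have "L z $ i = L w $ i" for i using zw(3) by simp
    then have "a $ 1 * x1 $ i + a $ 2 * x2 $ i + a $ 3 * x3 $ i = 0" for i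
      by (simp add: L_def a_def algebra_simps)
    then have e: "a $ 2 * (x2 $ i - x1 $ i) + a $ 3 * (x3 $ i - x1 $ i) = 0" for i
      unfolding a1 by (simp add: algebra_simps)
    let ?d = "(x2 $ 1 - x1 $ 1) * (x3 $ 2 - x1 $ 2) - (x2 $ 2 - x1 $ 2) * (x3 $ 1 - x1 $ 1)"
    let ?p = "\<lambda>i. x2 $ i - x1 $ i" and ?q = "\<lambda>i. x3 $ i - x1 $ i"
    \<comment> \<open>Cramer's rule for two equations: as the determinant of the edge vectors is
      nonzero, barycentric coordinates are unique.\<close>
    have cramer: "b * (p * s - r * q) = (b * p + c * q) * s - (b * r + c * s) * q"
      "c * (p * s - r * q) = (b * r + c * s) * p - (b * p + c * q) * r" for b c p q r s :: real
      by (simp_all add: algebra_simps)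
    have "a $ 2 * ?d = (a $ 2 * ?p 1 + a $ 3 * ?q 1) * ?q 2 - (a $ 2 * ?p 2 + a $ 3 * ?q 2) * ?q 1"
      "a $ 3 * ?d = (a $ 2 * ?p 2 + a $ 3 * ?q 2) * ?p 1 - (a $ 2 * ?p 1 + a $ 3 * ?q 1) * ?p 2"
      by (rule cramer)+
    then have "a $ 2 * ?d = 0" "a $ 3 * ?d = 0" by (simp_all add: e)
    then have "a $ 2 = 0" "a $ 3 = 0" using det by simp_all
    then have "a = 0" using a1 by (simp add: vec_eq_iff forall_3)
    then show "z = w" by (simp add: a_def)
  qed
  have imL: "L ` model_triangle = convex hull {x1, x2, x3}"
    unfolding convex_hull_3
  proof (rule Set.set_eqI, rule iffI)
    fix y assume "y \<in> L ` model_triangle"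
    then obtain z where "z \<in> model_triangle" "y = L z" by auto
    then show "y \<in> {u *\<^sub>R x1 + v *\<^sub>R x2 + w *\<^sub>R x3 |u v w. 0 \<le> u \<and> 0 \<le> v \<and> 0 \<le> w \<and> u + v + w = 1}"
      unfolding L_def model_triangle_def sum_3 by blast
  next
    fix y assume "y \<in> {u *\<^sub>R x1 + v *\<^sub>R x2 + w *\<^sub>R x3 |u v w. 0 \<le> u \<and> 0 \<le> v \<and> 0 \<le> w \<and> u + v + w = 1}"
    then obtain u v w where *: "y = u *\<^sub>R x1 + v *\<^sub>R x2 + w *\<^sub>R x3" "0 \<le> u" "0 \<le> v" "0 \<le> w" "u + v + w = 1"
      by blast
    then show "y \<in> L ` model_triangle"
      by (intro image_eqI[of _ _ "vector [u, v, w]"]) (simp_all add: L_def model_triangle_def sum_3 forall_3)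
  qed
  have vs: "triangle_vertices \<subseteq> model_triangle"
    by (auto simp: triangle_vertices_def model_triangle_def axis_def)
  have imV: "L ` triangle_vertices = {x1, x2, x3}"
    unfolding triangle_vertices_def UNIV_3 by (simp add: Laxis)
  have imL': "L ` model_ideal_triangle = convex hull {x1, x2, x3} - {x1, x2, x3}"
  proof -
    have "L ` (model_triangle - triangle_vertices) = L ` model_triangle - L ` triangle_vertices"
      by (rule inj_on_image_set_diff[OF injL]) (use vs in auto)
    then show ?thesis by (simp only: model_ideal_triangle_def imL imV)
  qed
  have sub: "triangle_interior \<subseteq> model_ideal_triangle" "triangle_edge k \<subseteq> model_ideal_triangle" for k
    by (auto simp: model_ideal_triangle_eq)
  have sub': "model_ideal_triangle \<subseteq> model_triangle" by (auto simp: model_ideal_triangle_def)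
  obtain B where B: "homeomorphism model_triangle (convex hull {x1, x2, x3}) L B"
    using homeomorphism_compact[OF compact_model_triangle contL imL injL] by blast
  have B': "homeomorphism model_ideal_triangle (convex hull {x1, x2, x3} - {x1, x2, x3}) L B"
    by (rule homeomorphism_of_subsets[OF B sub' _ imL']) auto
  let ?T = "convex hull {x1, x2, x3} - {x1, x2, x3}"
  have injB: "inj_on B ?T"
    by (rule inj_on_inverseI, erule homeomorphism_apply2[OF B'])
  have img: "G ` X \<subseteq> ?T" if "X \<subseteq> model_ideal_triangle" for X
    using image_mono[OF that, of G] by (simp only: im)
  have "triangle_interior \<subseteq> (B \<circ> G) ` triangle_interior"
  proof (rule triangle_self_map_covers_interior)
    show "continuous_on model_ideal_triangle (B \<circ> G)"
      by (rule continuous_on_compose[OF cont]) (use homeomorphism_cont2[OF B'] im in simp)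
    show "(B \<circ> G) ` model_ideal_triangle = model_ideal_triangle"
      unfolding image_comp[symmetric] im by (rule homeomorphism_image2[OF B'])
    show "inj_on (B \<circ> G) triangle_interior"
      by (rule comp_inj_on[OF inj(1) inj_on_subset[OF injB img[OF sub(1)]]])
    show "inj_on (B \<circ> G) (triangle_edge k)" for k
      by (rule comp_inj_on[OF inj(2) inj_on_subset[OF injB img[OF sub(2)]]])
    show "(B \<circ> G) ` triangle_interior \<inter> (B \<circ> G) ` triangle_edge k = {}" for k
      unfolding image_comp[symmetric] inj_on_image_Int[OF injB img[OF sub(1)] img[OF sub(2)], symmetric] sep
      by simp
    show "(B \<circ> G) ` triangle_edge k = (B \<circ> G) ` triangle_edge l \<or>
        (B \<circ> G) ` triangle_edge k \<inter> (B \<circ> G) ` triangle_edge l = {}" for k l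
      unfolding image_comp[symmetric] inj_on_image_Int[OF injB img[OF sub(2)] img[OF sub(2)], symmetric]
      using edges[of k l] by auto
    show "closedin (top_of_set model_ideal_triangle) ((B \<circ> G) ` C)"
      if C: "closedin (top_of_set (triangle_edge k)) C" for k C
    proof -
      have CT: "G ` C \<subseteq> ?T"
        using closedin_imp_subset[OF C] sub(2)[of k] by (intro img) blast
      have "closedin (top_of_set ?T) (G ` C)"
        by (rule closedin_subset_trans[OF closed[OF C] CT D])
      then have "closedin (top_of_set model_ideal_triangle) (B ` G ` C)"
        by (rule homeomorphism_imp_closed_map[OF homeomorphism_symD[OF B']])
      then show ?thesis by (simp only: image_comp)
    qed
  qed
  then have "L ` triangle_interior \<subseteq> L ` B ` G ` triangle_interior"
    unfolding image_comp[symmetric] by (rule image_mono)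
  also have "\<dots> = G ` triangle_interior"
  proof -
    have "L (B y) = y" if "y \<in> G ` triangle_interior" for y
      by (rule homeomorphism_apply2[OF B' subsetD[OF img[OF sub(1)] that]])
    then show ?thesis unfolding image_image[of L] by (simp cong: image_cong)
  qed
  finally have "L ` triangle_interior \<subseteq> G ` triangle_interior" .
  moreover have "open_triangle x1 x2 x3 \<subseteq> L ` triangle_interior"
  proof
    fix y assume "y \<in> open_triangle x1 x2 x3"
    then obtain u v w where *: "y = u *\<^sub>R x1 + v *\<^sub>R x2 + w *\<^sub>R x3" "0 < u" "0 < v" "0 < w" "u + v + w = 1"
      unfolding open_triangle_def by blast
    then show "y \<in> L ` triangle_interior"
      by (intro image_eqI[of _ _ "vector [u, v, w]"])
        (simp_all add: L_def triangle_interior_def model_triangle_def sum_3 forall_3)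
  qed
  ultimately show ?thesis by (rule order_trans[rotated])
qed

subsection \<open>Lifts of characteristic maps\<close>

text \<open>Lets the universal covering be read on the planar domain; \<open>f\<close> carries the
  sheets along.\<close>

lemma covering_space_homeomorphism:
  assumes cov: "covering_space U q S" and hom: "homeomorphism U D f g"
  shows "covering_space D (q \<circ> g) S"
proof (rule covering_spaceI)
  have gD: "g ` D = U" and fU: "f ` U = D" using hom by (auto simp: homeomorphism_def)
  show "continuous_on D (q \<circ> g)"
    using hom covering_space_imp_continuous[OF cov]
    by (intro continuous_on_compose) (simp_all add: homeomorphism_def)
  show "(q \<circ> g) ` D = S"
    unfolding image_comp[symmetric] gD by (rule covering_space_imp_surjective[OF cov])
  fix x assume "x \<in> S"
  then obtain T v where T: "x \<in> T" "openin (top_of_set S) T" and v: "\<Union>v = U \<inter> q -` T"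
      "\<And>u. u \<in> v \<Longrightarrow> openin (top_of_set U) u" "pairwise disjnt v" "\<And>u. u \<in> v \<Longrightarrow> \<exists>r. homeomorphism u T q r"
    using cov unfolding covering_space_def by metis
  have vU: "u \<subseteq> U" if "u \<in> v" for u using v(1) that by blast
  show "\<exists>T. x \<in> T \<and> openin (top_of_set S) T \<and>
      (\<exists>v. \<Union> v = D \<inter> (q \<circ> g) -` T \<and> (\<forall>u\<in>v. openin (top_of_set D) u) \<and> pairwise disjnt v \<and>
        (\<forall>u\<in>v. \<exists>qa. homeomorphism u T (q \<circ> g) qa))"
  proof (rule exI[of _ T], intro conjI T, rule exI[of _ "(`) f ` v"], intro conjI ballI)
    show "\<Union> ((`) f ` v) = D \<inter> (q \<circ> g) -` T"
    proof (rule Set.set_eqI, rule iffI)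
      fix y assume "y \<in> \<Union> ((`) f ` v)"
      then obtain u z where u: "u \<in> v" "z \<in> u" "y = f z" by auto
      then have "z \<in> U \<inter> q -` T" using v(1) by blast
      then show "y \<in> D \<inter> (q \<circ> g) -` T"
        using u fU homeomorphism_apply1[OF hom, of z] by auto
    next
      fix y assume y: "y \<in> D \<inter> (q \<circ> g) -` T"
      then have "g y \<in> \<Union>v" using gD v(1) by auto
      then obtain u where "u \<in> v" "g y \<in> u" by blast
      then show "y \<in> \<Union> ((`) f ` v)"
        using homeomorphism_apply2[OF hom, of y] y by (metis IntD1 UN_I image_eqI)
    qed
    show "openin (top_of_set D) w" if "w \<in> (`) f ` v" for w
      using that v(2) homeomorphism_imp_open_map[OF hom] by auto
    show "pairwise disjnt ((`) f ` v)"
    proof (rule pairwiseI)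
      fix a b assume ab: "a \<in> (`) f ` v" "b \<in> (`) f ` v" "a \<noteq> b"
      then obtain u w where uw: "u \<in> v" "w \<in> v" "a = f ` u" "b = f ` w" by blast
      then have "u \<inter> w = {}" using v(3) ab(3) by (metis disjnt_def pairwiseD)
      moreover have "inj_on f U" by (rule inj_on_inverseI, erule homeomorphism_apply1[OF hom])
      ultimately show "disjnt a b"
        unfolding uw disjnt_def using inj_on_image_Int[of f U u w] vU[OF uw(1)] vU[OF uw(2)] by simp
    qed
    show "\<exists>r. homeomorphism w T (q \<circ> g) r" if w: "w \<in> (`) f ` v" for w
    proof -
      obtain u where u: "u \<in> v" "w = f ` u" using w by blast
      obtain r where r: "homeomorphism u T q r" using v(4)[OF u(1)] by blast
      have "f ` u \<subseteq> D" using image_mono[OF vU[OF u(1)], of f] fU by simp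
      then have "homeomorphism u w f g"
        unfolding u(2) by (rule homeomorphism_of_subsets[OF hom vU[OF u(1)] _ refl])
      then show ?thesis
        using homeomorphism_compose[OF homeomorphism_symD r] by blast
    qed
  qed
qed

lemma closedin_edge_triangle:
  assumes "closedin (top_of_set (triangle_edge k)) C"
  shows "closedin (top_of_set model_ideal_triangle) C"
  using assms closedin_triangle_edge by (rule closedin_trans)

lemma model_ideal_triangle_subset: "model_ideal_triangle \<subseteq> model_triangle"
  by (auto simp: model_ideal_triangle_def)

lemma triangle_edge_subset: "triangle_edge k \<subseteq> model_ideal_triangle"
  by (auto simp: model_ideal_triangle_eq)

lemma triangle_interior_subset: "triangle_interior \<subseteq> model_ideal_triangle"
  by (auto simp: model_ideal_triangle_eq)

text \<open>A characteristic map sends the vertices to punctures, so its lifts are proper.\<close>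

lemma closedin_lift_image:
  fixes f :: "real^3 \<Rightarrow> 's::t2_space" and G :: "real^3 \<Rightarrow> 'b::metric_space"
  assumes p: "continuous_on D p" "p ` D \<subseteq> X - P"
    and f: "continuous_on model_triangle f" "f ` triangle_vertices \<subseteq> P"
    and G: "continuous_on model_ideal_triangle G" "G ` model_ideal_triangle \<subseteq> D"
      "\<And>z. z \<in> model_ideal_triangle \<Longrightarrow> p (G z) = f z"
    and C: "closedin (top_of_set model_ideal_triangle) C"
  shows "closedin (top_of_set D) (G ` C)"
proof -
  have CT: "C \<subseteq> model_ideal_triangle" by (rule closedin_imp_subset[OF C])
  have cl: "y \<in> G ` C" if y: "y \<in> D" "y \<in> closure (G ` C)" for y
  proof -
    obtain w where w: "\<And>n. w n \<in> G ` C" "w \<longlonglongrightarrow> y"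
      using y(2) unfolding closure_sequential by blast
    then obtain z where z: "\<And>n. z n \<in> C" "\<And>n. w n = G (z n)"
      unfolding image_iff by metis
    then have "\<forall>n. z n \<in> model_triangle" using CT model_ideal_triangle_subset by blast
    then obtain l r where l: "l \<in> model_triangle" and r: "strict_mono (r :: nat \<Rightarrow> nat)" "(z \<circ> r) \<longlonglongrightarrow> l"
      using compact_model_triangle unfolding compact_eq_seq_compact_metric seq_compact_def by metis
    have wr: "(w \<circ> r) \<longlonglongrightarrow> y" by (rule LIMSEQ_subseq_LIMSEQ[OF w(2) r(1)])
    have zr: "(z \<circ> r) n \<in> model_ideal_triangle" for n using z CT by auto
    have "(\<lambda>n. f ((z \<circ> r) n)) \<longlonglongrightarrow> f l"
      by (rule continuous_on_tendsto_compose[OF f(1) r(2) l])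
        (use zr model_ideal_triangle_subset in \<open>auto intro!: always_eventually\<close>)
    moreover have "(\<lambda>n. p ((w \<circ> r) n)) \<longlonglongrightarrow> p y"
    proof (rule continuous_on_tendsto_compose[OF p(1) wr y(1)])
      have "(w \<circ> r) n \<in> D" for n using zr[of n] G(2) z(2) by auto
      then show "\<forall>\<^sub>F n in sequentially. (w \<circ> r) n \<in> D" by simp
    qed
    moreover have "p ((w \<circ> r) n) = f ((z \<circ> r) n)" for n
      using G(3)[OF zr[of n]] z(2) by simp
    \<comment> \<open>The limit \<open>l\<close> of the parameters might be a vertex. But then
      \<open>f l\<close> would be a puncture, whereas \<open>p y\<close> lies in the
      surface.\<close>
    ultimately have "f l = p y" using LIMSEQ_unique by fastforce
    then have "f l \<notin> P" using p(2) y(1) by blast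
    then have "l \<in> model_ideal_triangle" using f(2) l by (auto simp: model_ideal_triangle_def)
    obtain K where K: "closed K" "C = model_ideal_triangle \<inter> K"
      using C by (auto simp: closedin_closed)
    have "l \<in> K"
      by (rule closed_sequentially[OF K(1) _ r(2)]) (use z K(2) in auto)
    then have "l \<in> C" using K(2) \<open>l \<in> model_ideal_triangle\<close> by blast
    have "(\<lambda>n. G ((z \<circ> r) n)) \<longlonglongrightarrow> G l"
      by (rule continuous_on_tendsto_compose[OF G(1) r(2) \<open>l \<in> model_ideal_triangle\<close>])
        (use zr in \<open>auto intro!: always_eventually\<close>)
    then have "(w \<circ> r) \<longlonglongrightarrow> G l" by (simp add: comp_def z(2))
    then have "y = G l" by (rule LIMSEQ_unique[OF wr])
    then show "y \<in> G ` C" using \<open>l \<in> C\<close> by blast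
  qed
  have "G ` C \<subseteq> D" using CT G(2) by blast
  then have "G ` C = D \<inter> closure (G ` C)"
    by (intro subset_antisym Int_greatest closure_subset subsetI) (auto intro: cl)
  then show ?thesis by (metis closed_closure closedin_closed_Int)
qed

text \<open>Closedness of the image of \<open>C\<close> is seen by passing to a compact subset of
  the full triangle, whose additional points are vertices. These are mapped to punctures and
  disappear on intersecting with the image of the edge.\<close>

lemma edge_map_homeomorphism:
  fixes f :: "real^3 \<Rightarrow> 's::t2_space"
  assumes f: "continuous_on model_triangle f" "f ` triangle_vertices \<subseteq> P" "f ` model_ideal_triangle \<subseteq> X - P"
    and inj: "inj_on f (triangle_edge k)"
  obtains f' where "homeomorphism (triangle_edge k) (f ` triangle_edge k) f f'"
proof (rule homeomorphism_injective_closed_map[OF _ refl inj])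
  show "continuous_on (triangle_edge k) f"
    using f(1) triangle_edge_subset model_ideal_triangle_subset by (meson continuous_on_subset order_trans)
  fix C assume C: "closedin (top_of_set (triangle_edge k)) C"
  have CT: "C \<subseteq> model_triangle"
    using closedin_imp_subset[OF C] triangle_edge_subset model_ideal_triangle_subset by blast
  obtain K where K: "closed K" "C = model_ideal_triangle \<inter> K"
    using closedin_edge_triangle[OF C] by (auto simp: closedin_closed)
  have "compact (model_triangle \<inter> K)" by (rule compact_Int_closed[OF compact_model_triangle K(1)])
  then have "compact (f ` (model_triangle \<inter> K))"
    by (intro compact_continuous_image continuous_on_subset[OF f(1)]) simp_all
  then have "closed (f ` (model_triangle \<inter> K))" by (rule compact_imp_closed)
  moreover have "f ` C = f ` triangle_edge k \<inter> f ` (model_triangle \<inter> K)"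
  proof
    show "f ` C \<subseteq> f ` triangle_edge k \<inter> f ` (model_triangle \<inter> K)"
      using closedin_imp_subset[OF C] CT K(2) by blast
    show "f ` triangle_edge k \<inter> f ` (model_triangle \<inter> K) \<subseteq> f ` C"
    proof
      fix y assume "y \<in> f ` triangle_edge k \<inter> f ` (model_triangle \<inter> K)"
      then obtain z w where z: "z \<in> triangle_edge k" "y = f z" and w: "w \<in> model_triangle" "w \<in> K" "y = f w"
        by blast
      have "y \<notin> P" using z f(3) triangle_edge_subset by blast
      then have "w \<notin> triangle_vertices" using f(2) w(3) by blast
      then have "w \<in> C" using w K(2) by (simp add: model_ideal_triangle_def)
      then show "y \<in> f ` C" using w by blast
    qed
  qed
  ultimately show "closedin (top_of_set (f ` triangle_edge k)) (f ` C)"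
    by (metis closedin_closed_Int)
qed (rule that)

text \<open>The gluing of the two edges in the surface gives a reparametrisation \<psi>, and G
  \<circ> \<psi> is a second lift along the edge \<open>k\<close>. It agrees with \<open>G\<close>
  at \<open>z0\<close>, so the two lifts coincide on the connected edge.\<close>

lemma lifted_edge_subset:
  fixes f :: "real^3 \<Rightarrow> 's::t2_space" and G :: "real^3 \<Rightarrow> 'b::real_normed_vector"
  assumes p: "covering_space D p (X - P)"
    and f: "continuous_on model_triangle f" "f ` triangle_vertices \<subseteq> P" "f ` model_ideal_triangle \<subseteq> X - P"
    and inj: "inj_on f (triangle_edge l)" and eq: "f ` triangle_edge k = f ` triangle_edge l"
    and G: "continuous_on model_ideal_triangle G" "G ` model_ideal_triangle \<subseteq> D"
      "\<And>z. z \<in> model_ideal_triangle \<Longrightarrow> p (G z) = f z"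
    and meet: "z0 \<in> triangle_edge k" "w0 \<in> triangle_edge l" "G z0 = G w0"
  shows "G ` triangle_edge k \<subseteq> G ` triangle_edge l"
proof -
  obtain f' where f': "homeomorphism (triangle_edge l) (f ` triangle_edge l) f f'"
    by (rule edge_map_homeomorphism[OF f inj])
  note sub = subsetD[OF triangle_edge_subset]
  have cf: "continuous_on (triangle_edge k) f"
    using f(1) triangle_edge_subset model_ideal_triangle_subset by (meson continuous_on_subset order_trans)
  define \<psi> where "\<psi> = f' \<circ> f"
  have \<psi>: "\<psi> z \<in> triangle_edge l" "f (\<psi> z) = f z" if "z \<in> triangle_edge k" for z
  proof -
    have "f z \<in> f ` triangle_edge l" using that eq by blast
    then show "\<psi> z \<in> triangle_edge l" "f (\<psi> z) = f z"
      using f' by (auto simp: \<psi>_def homeomorphism_def)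
  qed
  have c\<psi>: "continuous_on (triangle_edge k) \<psi>"
    unfolding \<psi>_def by (rule continuous_on_compose[OF cf]) (use f' eq in \<open>simp add: homeomorphism_def\<close>)
  have "f z0 = f w0" using G(3)[OF sub[OF meet(1)]] G(3)[OF sub[OF meet(2)]] meet(3) by simp
  then have "\<psi> z0 = w0" using homeomorphism_apply1[OF f' meet(2)] by (simp add: \<psi>_def)
  have "G z = (G \<circ> \<psi>) z" if z: "z \<in> triangle_edge k" for z
  proof (rule covering_space_lift_unique[OF p, of _ z0 _ "triangle_edge k" f])
    show "G z0 = (G \<circ> \<psi>) z0" using \<open>\<psi> z0 = w0\<close> meet(3) by simp
    show "continuous_on (triangle_edge k) G" by (rule continuous_on_subset[OF G(1) triangle_edge_subset])
    show "continuous_on (triangle_edge k) (G \<circ> \<psi>)"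
      by (rule continuous_on_compose[OF c\<psi> continuous_on_subset[OF G(1)]]) (use \<psi> sub in auto)
    show "f \<in> triangle_edge k \<rightarrow> X - P" using f(3) sub by blast
    show "G \<in> triangle_edge k \<rightarrow> D" using G(2) sub by blast
    show "G \<circ> \<psi> \<in> triangle_edge k \<rightarrow> D" using G(2) sub \<psi>(1) by fastforce
    show "f x = p (G x)" if "x \<in> triangle_edge k" for x using G(3)[OF sub[OF that]] by simp
    show "f x = p ((G \<circ> \<psi>) x)" if "x \<in> triangle_edge k" for x
      using G(3)[OF sub[OF \<psi>(1)[OF that]]] \<psi>(2)[OF that] by simp
  qed (use cf connected_triangle_edge meet z in auto)
  then show ?thesis using \<psi>(1) by auto
qed

text \<open>Injectivity and disjointness pass from \<open>f\<close> to \<open>G\<close> because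
  \<open>p\<close> maps \<open>G z\<close> to \<open>f z\<close>. The dichotomy for edges needs
  unique lifting: edges glued in the surface may have distinct lifts, but lifts that meet
  coincide.\<close>

lemma lifted_triangle_covers:
  fixes f :: "real^3 \<Rightarrow> 's::t2_space" and G :: "real^3 \<Rightarrow> real^2"
  assumes p: "covering_space D p (X - P)"
    and f: "continuous_on model_triangle f" "f ` triangle_vertices \<subseteq> P" "f ` model_ideal_triangle \<subseteq> X - P"
    and inj: "inj_on f triangle_interior" "\<And>k. inj_on f (triangle_edge k)"
    and sep: "\<And>k. f ` triangle_interior \<inter> f ` triangle_edge k = {}"
    and edges: "\<And>k l. f ` triangle_edge k = f ` triangle_edge l \<or> f ` triangle_edge k \<inter> f ` triangle_edge l = {}"
    and G: "continuous_on model_ideal_triangle G" "G ` model_ideal_triangle \<subseteq> D"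
      "\<And>z. z \<in> model_ideal_triangle \<Longrightarrow> p (G z) = f z"
    and det: "(x2 $ 1 - x1 $ 1) * (x3 $ 2 - x1 $ 2) - (x2 $ 2 - x1 $ 2) * (x3 $ 1 - x1 $ 1) \<noteq> 0"
    and im: "G ` model_ideal_triangle = convex hull {x1, x2, x3} - {x1, x2, x3}"
  shows "open (G ` triangle_interior)" "open_triangle x1 x2 x3 \<subseteq> G ` triangle_interior"
proof -
  note subi = triangle_interior_subset and sube = triangle_edge_subset
  have injG: "inj_on G Y" if "inj_on f Y" "Y \<subseteq> model_ideal_triangle" for Y
    using that G(3) by (metis inj_on_def subsetD)
  show "open (G ` triangle_interior)"
    by (rule open_image_triangle_interior[OF continuous_on_subset[OF G(1) subi] injG[OF inj(1) subi]])
  show "open_triangle x1 x2 x3 \<subseteq> G ` triangle_interior"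
  proof (rule triangle_map_covers_open_triangle[OF det G(1) im injG[OF inj(1) subi] injG[OF inj(2) sube]])
    show "G ` triangle_interior \<inter> G ` triangle_edge k = {}" for k
    proof -
      have False if "z \<in> triangle_interior" "w \<in> triangle_edge k" "G z = G w" for z w
      proof -
        have "f z = f w"
          using that G(3)[OF subsetD[OF subi that(1)]] G(3)[OF subsetD[OF sube that(2)]] by simp
        then show False using sep[of k] that by blast
      qed
      then show ?thesis by blast
    qed
    show "G ` triangle_edge k = G ` triangle_edge l \<or> G ` triangle_edge k \<inter> G ` triangle_edge l = {}" for k l
    proof (cases "G ` triangle_edge k \<inter> G ` triangle_edge l = {}")
      case False
      then obtain z w where zw: "z \<in> triangle_edge k" "w \<in> triangle_edge l" "G z = G w" by blast
      then have "f z = f w"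
        using G(3)[OF subsetD[OF sube zw(1)]] G(3)[OF subsetD[OF sube zw(2)]] by simp
      then have eq: "f ` triangle_edge k = f ` triangle_edge l" using edges[of k l] zw by blast
      have "G ` triangle_edge k \<subseteq> G ` triangle_edge l"
        by (rule lifted_edge_subset[OF p f inj(2) eq G zw])
      moreover have "G ` triangle_edge l \<subseteq> G ` triangle_edge k"
        by (rule lifted_edge_subset[OF p f inj(2) eq[symmetric] G zw(2,1) zw(3)[symmetric]])
      ultimately show ?thesis by blast
    qed simp
    show "convex hull {x1, x2, x3} - {x1, x2, x3} \<subseteq> D" using G(2) im by simp
    show "closedin (top_of_set D) (G ` C)" if "closedin (top_of_set (triangle_edge k)) C" for k C
      by (rule closedin_lift_image[where X = X, OF covering_space_imp_continuous[OF p] _ f(1,2) G closedin_edge_triangle[OF that]])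
        (simp add: covering_space_imp_surjective[OF p])
  qed
qed

subsection \<open>Flags and triple ratios\<close>

lemma det3_cross3: "det3 u v w = cross3 u v \<bullet> w"
  by (simp add: det3_def cross3_simps)

text \<open>Up to the factor \<open>?l \<bullet> ?l\<close>, the vector \<open>v\<close> is the
  cross product of \<open>cross3 ?l v\<close> with \<open>cross3 e1 e2\<close>, and such a product
  expands in \<open>e1\<close> and \<open>e2\<close>.\<close>

lemma orthogonal_cross3_in_span:
  assumes "e1 \<noteq> 0" "e2 \<notin> span {e1}" "cross3 e1 e2 \<bullet> v = 0"
  shows "v \<in> span {e1, e2}"
proof -
  let ?l = "cross3 e1 e2"
  have "?l \<noteq> 0"
  proof
    assume "?l = 0"
    then have "e2 = 0 \<or> (\<exists>c. e2 = c *\<^sub>R e1)"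
      unfolding cross_eq_0 collinear_lemma using assms(1) by blast
    then show False using assms(2) by (auto simp: span_zero span_base span_scale)
  qed
  have "cross3 (cross3 a b) a = (a \<bullet> a) *\<^sub>R b - (a \<bullet> b) *\<^sub>R a" for a b :: "real^3"
    by (simp add: cross3_simps forall_3)
  then have "(?l \<bullet> ?l) *\<^sub>R v = cross3 (cross3 ?l v) ?l" using assms(3) by simp
  also have "\<dots> \<in> span {e1, e2}"
    unfolding cross_cross_det by (intro span_diff span_scale span_base) auto
  finally have "(1 / (?l \<bullet> ?l)) *\<^sub>R ((?l \<bullet> ?l) *\<^sub>R v) \<in> span {e1, e2}" by (rule span_scale)
  then show ?thesis using \<open>?l \<noteq> 0\<close> by simp
qed

text \<open>The cross product of two spanning vectors cuts out the tangent line, so a line that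
  misses the domain becomes a form without zeros on it.\<close>

lemma tangent_flag_covector:
  assumes A: "invertible A" and flag: "tangent_flag \<Omega> (aff_chart A x) e1 e2"
  shows "\<And>y. aff_chart A y \<in> \<Omega> \<Longrightarrow> cross3 e1 e2 \<bullet> (A *v homogeneous y) \<noteq> 0"
    and "cross3 e1 e2 \<bullet> (A *v homogeneous x) = 0"
    and "\<exists>c. c \<noteq> 0 \<and> e1 = c *\<^sub>R (A *v homogeneous x)"
proof -
  have e: "e1 \<noteq> 0" "e2 \<notin> span {e1}" "proj_pt e1 = aff_chart A x"
    and span: "\<And>v. v \<in> span {e1, e2} \<Longrightarrow> v \<noteq> 0 \<Longrightarrow> proj_pt v \<notin> \<Omega>"
    using flag by (auto simp: tangent_flag_def)
  note nz = invertible_mult_nonzero[OF A homogeneous_nonzero]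
  show "cross3 e1 e2 \<bullet> (A *v homogeneous y) \<noteq> 0" if "aff_chart A y \<in> \<Omega>" for y
    using span[OF orthogonal_cross3_in_span[OF e(1,2)] nz] that by (auto simp: aff_chart_eq)
  have "proj_pt (A *v homogeneous x) = proj_pt e1" using e(3) by (simp add: aff_chart_eq)
  then obtain c where c: "e1 = c *\<^sub>R (A *v homogeneous x)"
    using proj_pt_eq_iff[OF nz e(1)] by blast
  then have "c \<noteq> 0" using e(1) by auto
  then show "\<exists>c. c \<noteq> 0 \<and> e1 = c *\<^sub>R (A *v homogeneous x)" using c by blast
  have "cross3 e1 e2 \<bullet> e1 = 0" by (simp add: cross3_simps)
  then show "cross3 e1 e2 \<bullet> (A *v homogeneous x) = 0"
    using \<open>c \<noteq> 0\<close> by (simp add: c inner_add_right)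
qed

lemma ideal_triangle_det:
  "ideal_triangle A \<Omega> T x1 x2 x3 \<Longrightarrow>
    (x2 $ 1 - x1 $ 1) * (x3 $ 2 - x1 $ 2) - (x2 $ 2 - x1 $ 2) * (x3 $ 1 - x1 $ 1) \<noteq> 0"
  by (simp add: ideal_triangle_def)

text \<open>A form that vanishes at both ends of a side vanishes at its midpoint; so a form without
  zeros on the domain that vanishes at one vertex is nonzero at the others. The zero summand gives
  the point the shape that \<open>homogeneous_affine\<close> expects.\<close>

lemma ideal_triangle_midpoints:
  assumes "ideal_triangle A \<Omega> T x1 x2 x3" "x \<in> {x1, x2, x3}" "y \<in> {x1, x2, x3}" "x \<noteq> y"
  shows "aff_chart A ((1/2) *\<^sub>R x + (1/2) *\<^sub>R y + 0 *\<^sub>R x) \<in> \<Omega>"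
proof -
  let ?m = "(1/2) *\<^sub>R x + (1/2) *\<^sub>R y + 0 *\<^sub>R x"
  have det: "(x2 $ 1 - x1 $ 1) * (x3 $ 2 - x1 $ 2) - (x2 $ 2 - x1 $ 2) * (x3 $ 1 - x1 $ 1) \<noteq> 0"
    by (rule ideal_triangle_det[OF assms(1)])
  have "?m \<in> convex hull {x1, x2, x3}"
    using convexD[OF convex_convex_hull[of "{x1, x2, x3}"], of x y "1/2" "1/2"] assms(2,3)
    by (simp add: hull_inc)
  moreover have "?m \<notin> {x1, x2, x3}"
  proof
    assume m: "?m \<in> {x1, x2, x3}"
    have "?m \<noteq> x" "?m \<noteq> y" using assms(4) by (auto simp: vec_eq_iff forall_2)
    then obtain z where z: "z \<in> {x1, x2, x3}" "z \<noteq> x" "z \<noteq> y" "?m = z" using m by blast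
    have zc: "2 * z $ i = x $ i + y $ i" for i
      unfolding z(4)[symmetric] by simp
    have zc: "z $ 1 = (x $ 1 + y $ 1) / 2" "z $ 2 = (x $ 2 + y $ 2) / 2"
      using zc[of 1] zc[of 2] by simp_all
    consider "z = x3" "x = x1 \<and> y = x2 \<or> x = x2 \<and> y = x1"
      | "z = x2" "x = x1 \<and> y = x3 \<or> x = x3 \<and> y = x1"
      | "z = x1" "x = x2 \<and> y = x3 \<or> x = x3 \<and> y = x2"
      using assms(2-4) z(1-3) by auto
    then show False
    proof cases
      case 1
      then have eq: "x3 $ 1 = (x1 $ 1 + x2 $ 1) / 2" "x3 $ 2 = (x1 $ 2 + x2 $ 2) / 2" using zc by auto
      show False using det unfolding eq by (simp add: field_simps)
    next
      case 2
      then have eq: "x2 $ 1 = (x1 $ 1 + x3 $ 1) / 2" "x2 $ 2 = (x1 $ 2 + x3 $ 2) / 2" using zc by auto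
      show False using det unfolding eq by (simp add: field_simps)
    next
      case 3
      then have eq: "x1 $ 1 = (x2 $ 1 + x3 $ 1) / 2" "x1 $ 2 = (x2 $ 2 + x3 $ 2) / 2" using zc by auto
      show False using det unfolding eq by (simp add: field_simps)
    qed
  qed
  ultimately have "aff_chart A ?m \<in> T" using assms(1) unfolding ideal_triangle_def by blast
  then show ?thesis using assms(1) unfolding ideal_triangle_def by blast
qed

text \<open>After cyclic rotation the determinants are values of the three tangent forms. Each
  vertex vector occurs once above and once below, so its scale cancels and chart points may replace
  it.\<close>

lemma triple_ratio_covectors:
  assumes A: "invertible A" and tr: "is_triple_ratio A \<Omega> T t"
  obtains x1 x2 x3 l1 l2 l3 where "ideal_triangle A \<Omega> T x1 x2 x3"
    "\<And>y. aff_chart A y \<in> \<Omega> \<Longrightarrow> l1 \<bullet> (A *v homogeneous y) \<noteq> 0"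
    "\<And>y. aff_chart A y \<in> \<Omega> \<Longrightarrow> l2 \<bullet> (A *v homogeneous y) \<noteq> 0"
    "\<And>y. aff_chart A y \<in> \<Omega> \<Longrightarrow> l3 \<bullet> (A *v homogeneous y) \<noteq> 0"
    "l1 \<bullet> (A *v homogeneous x1) = 0" "l2 \<bullet> (A *v homogeneous x2) = 0" "l3 \<bullet> (A *v homogeneous x3) = 0"
    "l1 \<bullet> (A *v homogeneous x2) \<noteq> 0" "l1 \<bullet> (A *v homogeneous x3) \<noteq> 0" "l2 \<bullet> (A *v homogeneous x1) \<noteq> 0"
    "l2 \<bullet> (A *v homogeneous x3) \<noteq> 0" "l3 \<bullet> (A *v homogeneous x1) \<noteq> 0" "l3 \<bullet> (A *v homogeneous x2) \<noteq> 0"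
    "t = ((l1 \<bullet> (A *v homogeneous x2)) / (l3 \<bullet> (A *v homogeneous x2))) *
      ((l3 \<bullet> (A *v homogeneous x1)) / (l2 \<bullet> (A *v homogeneous x1))) *
      ((l2 \<bullet> (A *v homogeneous x3)) / (l1 \<bullet> (A *v homogeneous x3)))"
proof -
  obtain x1 x2 x3 e1 e2 f1 f2 g1 g2 where it: "ideal_triangle A \<Omega> T x1 x2 x3"
    and e: "tangent_flag \<Omega> (aff_chart A x1) e1 e2" and f: "tangent_flag \<Omega> (aff_chart A x2) f1 f2"
    and g: "tangent_flag \<Omega> (aff_chart A x3) g1 g2" and t: "t = flag_triple_ratio e1 e2 f1 f2 g1 g2"
    using tr unfolding is_triple_ratio_def by metis
  note E = tangent_flag_covector[OF A e] and F = tangent_flag_covector[OF A f] and G = tangent_flag_covector[OF A g]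
  have ne: "x1 \<noteq> x2" "x1 \<noteq> x3" "x2 \<noteq> x3"
    using ideal_triangle_det[OF it] by auto
  have off: "l \<bullet> (A *v homogeneous y) \<noteq> 0"
    if "\<And>y. aff_chart A y \<in> \<Omega> \<Longrightarrow> l \<bullet> (A *v homogeneous y) \<noteq> 0" "l \<bullet> (A *v homogeneous x) = 0"
      "x \<in> {x1, x2, x3}" "y \<in> {x1, x2, x3}" "x \<noteq> y" for l x y
  proof
    assume "l \<bullet> (A *v homogeneous y) = 0"
    then have "l \<bullet> (A *v homogeneous ((1/2) *\<^sub>R x + (1/2) *\<^sub>R y + 0 *\<^sub>R x)) = 0"
      using that(2) by (subst homogeneous_affine)
        (simp_all add: matrix_vector_right_distrib matrix_vector_mult_scaleR inner_add_right)
    then show False using that(1)[OF ideal_triangle_midpoints[OF it that(3-5)]] by simp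
  qed
  obtain a where a: "a \<noteq> 0" "e1 = a *\<^sub>R (A *v homogeneous x1)" using E(3) by blast
  obtain b where b: "b \<noteq> 0" "f1 = b *\<^sub>R (A *v homogeneous x2)" using F(3) by blast
  obtain c where c: "c \<noteq> 0" "g1 = c *\<^sub>R (A *v homogeneous x3)" using G(3) by blast
  have cyc: "det3 u v w = det3 v w u" for u v w by (simp add: det3_def det_3 algebra_simps)
  have t': "t = ((cross3 e1 e2 \<bullet> f1) / (cross3 g1 g2 \<bullet> f1)) * ((cross3 g1 g2 \<bullet> e1) / (cross3 f1 f2 \<bullet> e1)) *
      ((cross3 f1 f2 \<bullet> g1) / (cross3 e1 e2 \<bullet> g1))"
    unfolding t flag_triple_ratio_def det3_cross3[symmetric] using cyc by metis
  show thesis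
  proof (rule that[OF it E(1) F(1) G(1) E(2) F(2) G(2)])
    show "cross3 e1 e2 \<bullet> (A *v homogeneous x2) \<noteq> 0" by (rule off[OF E(1,2)]) (use ne in auto)
    show "cross3 e1 e2 \<bullet> (A *v homogeneous x3) \<noteq> 0" by (rule off[OF E(1,2)]) (use ne in auto)
    show "cross3 f1 f2 \<bullet> (A *v homogeneous x1) \<noteq> 0" by (rule off[OF F(1,2)]) (use ne in auto)
    show "cross3 f1 f2 \<bullet> (A *v homogeneous x3) \<noteq> 0" by (rule off[OF F(1,2)]) (use ne in auto)
    show "cross3 g1 g2 \<bullet> (A *v homogeneous x1) \<noteq> 0" by (rule off[OF G(1,2)]) (use ne in auto)
    show "cross3 g1 g2 \<bullet> (A *v homogeneous x2) \<noteq> 0" by (rule off[OF G(1,2)]) (use ne in auto)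
    have scale: "(l \<bullet> (r *\<^sub>R v)) / (l' \<bullet> (r *\<^sub>R v)) = (l \<bullet> v) / (l' \<bullet> v)" if "r \<noteq> 0" for r l l' and v :: "real^3"
      using that by simp
    have "t = ((cross3 e1 e2 \<bullet> (b *\<^sub>R (A *v homogeneous x2))) / (cross3 g1 g2 \<bullet> (b *\<^sub>R (A *v homogeneous x2)))) *
        ((cross3 g1 g2 \<bullet> (a *\<^sub>R (A *v homogeneous x1))) / (cross3 f1 f2 \<bullet> (a *\<^sub>R (A *v homogeneous x1)))) *
        ((cross3 f1 f2 \<bullet> (c *\<^sub>R (A *v homogeneous x3))) / (cross3 e1 e2 \<bullet> (c *\<^sub>R (A *v homogeneous x3))))"
      unfolding t' using a(2) b(2) c(2) by metis
    then show "t = ((cross3 e1 e2 \<bullet> (A *v homogeneous x2)) / (cross3 g1 g2 \<bullet> (A *v homogeneous x2))) *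
        ((cross3 g1 g2 \<bullet> (A *v homogeneous x1)) / (cross3 f1 f2 \<bullet> (A *v homogeneous x1))) *
        ((cross3 f1 f2 \<bullet> (A *v homogeneous x3)) / (cross3 e1 e2 \<bullet> (A *v homogeneous x3)))"
      unfolding scale[OF a(1)] scale[OF b(1)] scale[OF c(1)] .
  qed
qed

subsection \<open>Unfolding the area of a fundamental domain\<close>

lemma inner_matrix_vector_mult: "l \<bullet> (N *v w) = (transpose N *v l) \<bullet> w" for l w :: "real^3"
  by (simp add: dot_lmul_matrix vector_transpose_matrix)

text \<open>Moves a holonomy matrix from the point to the forms, so that a point of the fundamental
  domain can stay where it is.\<close>

lemma log_ratio_matrix_vector_mult:
  "log_ratio l1 l2 l3 (N *v w) = log_ratio (transpose N *v l1) (transpose N *v l2) (transpose N *v l3) w"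
  by (simp add: log_ratio_def inner_matrix_vector_mult)

lemma log_ratio_differentiable_on:
  assumes "\<And>x. x \<in> X \<Longrightarrow> l1 \<bullet> (N *v homogeneous x) \<noteq> 0" "\<And>x. x \<in> X \<Longrightarrow> l2 \<bullet> (N *v homogeneous x) \<noteq> 0"
    "\<And>x. x \<in> X \<Longrightarrow> l3 \<bullet> (N *v homogeneous x) \<noteq> 0"
  shows "(\<lambda>x. log_ratio l1 l2 l3 (N *v homogeneous x)) differentiable_on X"
  unfolding differentiable_on_def differentiable_def log_ratio_matrix_vector_mult
  using assms unfolding inner_matrix_vector_mult
  by (blast intro: has_derivative_log_ratio)

text \<open>At most one pair contributes, so the sum is a single term. Applied pointwise: the orbit
  of a point of the fundamental domain enters the lifted triangles at most once.\<close>

lemma double_sum_le_of_unique: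
  fixes f :: "'i \<Rightarrow> nat \<Rightarrow> ennreal"
  assumes I: "finite I" and le: "\<And>i n. i \<in> I \<Longrightarrow> f i n \<le> c"
    and uniq: "\<And>i j n m. i \<in> I \<Longrightarrow> j \<in> I \<Longrightarrow> f i n \<noteq> 0 \<Longrightarrow> f j m \<noteq> 0 \<Longrightarrow> i = j \<and> n = m"
  shows "(\<Sum>i\<in>I. suminf (\<lambda>n. f i n)) \<le> c"
proof (cases "\<exists>i\<in>I. \<exists>n. f i n \<noteq> 0")
  case False
  then have "(\<Sum>i\<in>I. suminf (\<lambda>n. f i n)) = 0" by simp
  then show ?thesis by simp
next
  case True
  then obtain i n where i: "i \<in> I" "f i n \<noteq> 0" by blast
  have "suminf (\<lambda>m. f j m) = (if j = i then f i n else 0)" if "j \<in> I" for j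
  proof (cases "j = i")
    case True
    have "suminf (\<lambda>m. f i m) = (\<Sum>m\<in>{n}. f i m)"
      by (rule suminf_finite) (use uniq[OF i(1) i(1)] i(2) in blast)+
    then show ?thesis using True by simp
  next
    case False
    then have "f j m = 0" for m using uniq[OF that i(1) _ i(2)] by blast
    then show ?thesis using False by simp
  qed
  then have "(\<Sum>j\<in>I. suminf (\<lambda>m. f j m)) = (\<Sum>j\<in>I. if j = i then f i n else 0)" by simp
  also have "\<dots> = f i n" using I i by (simp add: sum.delta)
  finally show ?thesis using le[OF i(1)] by simp
qed

text \<open>Up to a null set, \<open>V i\<close> is assembled from the translates of the sets
  \<open>B i n\<close>, the parts of \<open>F\<close> that the n-th group element moves into it. On
  \<open>B i n\<close>, composing \<open>\<Phi> i\<close> with this element gives the logarithmic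
  map of the pulled-back forms, and 3 / 4 of its Jacobian is at most the area of the dual ball at
  the unmoved point. By \<open>uniq\<close> these sets are disjoint for different pairs, so the
  bounds fit into one integral over \<open>F\<close>.\<close>

lemma area_unfolding:
  fixes A :: "real^3^3" and N :: "'g \<Rightarrow> real^3^3" and \<rho> :: "'g \<Rightarrow> real^2 \<Rightarrow> real^2"
    and l1 l2 l3 :: "'i \<Rightarrow> real^3"
  assumes D: "open D" "convex D" "bounded D"
    and I: "finite I" and \<Gamma>: "countable \<Gamma>"
    and F: "F \<subseteq> D" "F \<in> sets lebesgue"
    and \<rho>: "\<And>\<gamma> x. \<gamma> \<in> \<Gamma> \<Longrightarrow> x \<in> D \<Longrightarrow> \<rho> \<gamma> x \<in> D" "\<And>\<gamma>. \<gamma> \<in> \<Gamma> \<Longrightarrow> continuous_on D (\<rho> \<gamma>)"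
      "\<And>\<gamma> x. \<gamma> \<in> \<Gamma> \<Longrightarrow> x \<in> D \<Longrightarrow> \<exists>c. c \<noteq> 0 \<and> N \<gamma> *v homogeneous x = c *\<^sub>R (A *v homogeneous (\<rho> \<gamma> x))"
    and V: "\<And>i. i \<in> I \<Longrightarrow> open (V i)" "\<And>i. i \<in> I \<Longrightarrow> V i \<subseteq> D"
    and nz: "\<And>i x. i \<in> I \<Longrightarrow> x \<in> D \<Longrightarrow> l1 i \<bullet> (A *v homogeneous x) \<noteq> 0"
      "\<And>i x. i \<in> I \<Longrightarrow> x \<in> D \<Longrightarrow> l2 i \<bullet> (A *v homogeneous x) \<noteq> 0"
      "\<And>i x. i \<in> I \<Longrightarrow> x \<in> D \<Longrightarrow> l3 i \<bullet> (A *v homogeneous x) \<noteq> 0"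
    and uniq: "\<And>i j \<gamma> \<delta> x. i \<in> I \<Longrightarrow> j \<in> I \<Longrightarrow> \<gamma> \<in> \<Gamma> \<Longrightarrow> \<delta> \<in> \<Gamma> \<Longrightarrow> x \<in> D \<Longrightarrow> \<rho> \<gamma> x \<in> V i \<Longrightarrow> \<rho> \<delta> x \<in> V j
       \<Longrightarrow> i = j \<and> \<gamma> = \<delta>"
    and cover: "negligible (D - (\<Union>\<gamma>\<in>\<Gamma>. \<rho> \<gamma> ` F))"
    and fin: "(\<integral>\<^sup>+p\<in>F. emeasure lebesgue (hilbert_dual_ball D p) \<partial>lebesgue) < \<infinity>"
  defines "\<Phi> \<equiv> \<lambda>i x. log_ratio (l1 i) (l2 i) (l3 i) (A *v homogeneous x)"
  shows "\<And>i. i \<in> I \<Longrightarrow> \<Phi> i ` V i \<in> sets lebesgue"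
    and "(\<Sum>i\<in>I. ennreal (3 / 4) * emeasure lebesgue (\<Phi> i ` V i)) \<le>
      (\<integral>\<^sup>+p\<in>F. emeasure lebesgue (hilbert_dual_ball D p) \<partial>lebesgue)"
proof -
  have diff: "\<Phi> i differentiable_on V i" if "i \<in> I" for i
    unfolding \<Phi>_def by (rule log_ratio_differentiable_on) (use nz[OF that] V(2)[OF that] in blast)+
  show meas: "\<Phi> i ` V i \<in> sets lebesgue" if "i \<in> I" for i
    by (rule differentiable_image_in_sets_lebesgue[OF _ _ diff[OF that]]) (use V(1)[OF that] in auto)
  \<comment> \<open>The group may be finite, so an index counts only if it is the code of an
    element; for the others \<open>B i n\<close> is empty.\<close>
  define ok where "ok n \<longleftrightarrow> n \<in> to_nat_on \<Gamma> ` \<Gamma>" for n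
  define g where "g = from_nat_into \<Gamma>"
  have g: "g n \<in> \<Gamma>" "to_nat_on \<Gamma> (g n) = n" if "ok n" for n
    using that \<Gamma> by (auto simp: ok_def g_def)
  have surj: "\<exists>n. ok n \<and> g n = \<gamma>" if "\<gamma> \<in> \<Gamma>" for \<gamma>
    using that \<Gamma> by (intro exI[of _ "to_nat_on \<Gamma> \<gamma>"]) (auto simp: ok_def g_def)
  define B where "B i n = (if ok n then {x \<in> F. \<rho> (g n) x \<in> V i} else {})" for i n
  \<comment> \<open>The pull-back of a form by the n-th matrix. It has no zeros on \<open>D\<close>
    if the form has none, because the group element maps \<open>D\<close> into itself.\<close>
  define m where "m l n = transpose (N (g n)) *v l" for l :: "real^3" and n
  define J where "J i n = log_jacobian (m (l1 i) n) (m (l2 i) n) (m (l3 i) n)" for i n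
  have BF: "B i n \<subseteq> F" for i n by (auto simp: B_def)
  have Bm: "B i n \<in> sets lebesgue" if "i \<in> I" for i n
  proof (cases "ok n")
    case True
    have "open (D \<inter> \<rho> (g n) -` V i)"
      by (rule continuous_open_preimage[OF \<rho>(2)[OF g(1)[OF True]] D(1) V(1)[OF that]])
    then have "D \<inter> \<rho> (g n) -` V i \<in> sets lebesgue" by (intro sets_completionI_sets) simp
    with F(2) have "F \<inter> (D \<inter> \<rho> (g n) -` V i) \<in> sets lebesgue" by (rule sets.Int)
    moreover have "B i n = F \<inter> (D \<inter> \<rho> (g n) -` V i)" using True F(1) by (auto simp: B_def)
    ultimately show ?thesis by simp
  qed (simp add: B_def)
  have mnz: "m l n \<bullet> homogeneous x \<noteq> 0"
    if ok: "ok n" and x: "x \<in> D" and lz: "\<And>y. y \<in> D \<Longrightarrow> l \<bullet> (A *v homogeneous y) \<noteq> 0" for l n x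
  proof -
    obtain c where "c \<noteq> 0" "N (g n) *v homogeneous x = c *\<^sub>R (A *v homogeneous (\<rho> (g n) x))"
      using \<rho>(3)[OF g(1)[OF ok] x] by blast
    moreover have "m l n \<bullet> homogeneous x = l \<bullet> (N (g n) *v homogeneous x)"
      by (simp only: m_def inner_matrix_vector_mult)
    ultimately show ?thesis
      using lz[OF \<rho>(1)[OF g(1)[OF ok] x]] by simp
  qed
  have Jle: "ennreal (3 / 4 * J i n x) \<le> emeasure lebesgue (hilbert_dual_ball D x)" if "i \<in> I" "ok n" "x \<in> D" for i n x
    unfolding J_def
    by (rule log_jacobian_le_dual_ball[OF D that(3)]; rule mnz[OF that(2)]) (use nz[OF that(1)] in auto)
  have Jm [measurable]: "J i n \<in> borel_measurable lebesgue" for i n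
    unfolding J_def by (intro measurable_completion) simp
  define f where "f i n x = ennreal (3 / 4 * J i n x) * indicator (B i n) x" for i n x
  have fm: "f i n \<in> borel_measurable lebesgue" if "i \<in> I" for i n
    unfolding f_def using Bm[OF that] by measurable
  have Jpos: "J i n x \<ge> 0" for i n x by (simp add: J_def log_jacobian_def)
  have fint: "(\<integral>\<^sup>+x. f i n x \<partial>lebesgue) = ennreal (3 / 4) * (\<integral>\<^sup>+x\<in>B i n. ennreal (J i n x) \<partial>lebesgue)" if "i \<in> I" for i n
  proof -
    have "f i n x = ennreal (3 / 4) * (ennreal (J i n x) * indicator (B i n) x)" for x
      unfolding f_def mult.assoc[symmetric] by (subst ennreal_mult[symmetric]) (use Jpos in auto)
    then show ?thesis using Bm[OF that] by (simp add: nn_integral_cmult)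
  qed
  have ptw: "(\<Sum>i\<in>I. suminf (\<lambda>n. f i n x)) \<le> emeasure lebesgue (hilbert_dual_ball D x) * indicator F x" for x
  proof (rule double_sum_le_of_unique[OF I])
    fix i n assume "i \<in> I"
    show "f i n x \<le> emeasure lebesgue (hilbert_dual_ball D x) * indicator F x"
    proof (cases "x \<in> B i n")
      case True
      then have "ok n" "x \<in> F" by (auto simp: B_def split: if_splits)
      then show ?thesis using Jle[OF \<open>i \<in> I\<close> \<open>ok n\<close>, of x] F(1) True by (auto simp: f_def)
    qed (simp add: f_def)
  next
    fix i j n k assume *: "i \<in> I" "j \<in> I" "f i n x \<noteq> 0" "f j k x \<noteq> 0"
    then have "x \<in> B i n" "x \<in> B j k" by (auto simp: f_def indicator_def split: if_splits)
    then have o: "ok n" "ok k" "x \<in> F" "\<rho> (g n) x \<in> V i" "\<rho> (g k) x \<in> V j"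
      by (auto simp: B_def split: if_splits)
    have "i = j \<and> g n = g k"
      by (rule uniq[OF *(1,2) g(1)[OF o(1)] g(1)[OF o(2)] subsetD[OF F(1) o(3)] o(4,5)])
    then show "i = j \<and> n = k" using g(2)[OF o(1)] g(2)[OF o(2)] by metis
  qed
  have total: "(\<Sum>i\<in>I. suminf (\<lambda>n. \<integral>\<^sup>+x. f i n x \<partial>lebesgue)) \<le>
      (\<integral>\<^sup>+p\<in>F. emeasure lebesgue (hilbert_dual_ball D p) \<partial>lebesgue)"
  proof -
    have "(\<Sum>i\<in>I. suminf (\<lambda>n. \<integral>\<^sup>+x. f i n x \<partial>lebesgue)) = (\<Sum>i\<in>I. \<integral>\<^sup>+x. (suminf (\<lambda>n. f i n x)) \<partial>lebesgue)"
      by (intro sum.cong refl nn_integral_suminf[symmetric] fm)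
    also have "\<dots> = (\<integral>\<^sup>+x. (\<Sum>i\<in>I. suminf (\<lambda>n. f i n x)) \<partial>lebesgue)"
      by (intro nn_integral_sum[symmetric] borel_measurable_suminf_order fm)
    also have "\<dots> \<le> (\<integral>\<^sup>+p\<in>F. emeasure lebesgue (hilbert_dual_ball D p) \<partial>lebesgue)"
      by (intro nn_integral_mono ptw)
    finally show ?thesis .
  qed
  have piece: "emeasure lebesgue (\<Phi> i ` V i) \<le> suminf (\<lambda>n. \<integral>\<^sup>+x\<in>B i n. ennreal (J i n x) \<partial>lebesgue)" if i: "i \<in> I" for i
  proof -
    define E where "E n = (\<lambda>x. log_ratio (m (l1 i) n) (m (l2 i) n) (m (l3 i) n) (homogeneous x)) ` B i n" for n
    have E: "E n \<in> lmeasurable \<and> emeasure lebesgue (E n) \<le> (\<integral>\<^sup>+x\<in>B i n. ennreal (J i n x) \<partial>lebesgue)" for n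
    proof (cases "ok n")
      case True
      have BD: "B i n \<subseteq> D" using BF F(1) by blast
      have nzB: "m l n \<bullet> homogeneous x \<noteq> 0" if "x \<in> B i n" "\<And>y. y \<in> D \<Longrightarrow> l \<bullet> (A *v homogeneous y) \<noteq> 0" for l x
        by (rule mnz[OF True subsetD[OF BD that(1)] that(2)])
      have "(\<integral>\<^sup>+x. f i n x \<partial>lebesgue) \<le> (\<integral>\<^sup>+p\<in>F. emeasure lebesgue (hilbert_dual_ball D p) \<partial>lebesgue)"
      proof (rule nn_integral_mono)
        fix x
        show "f i n x \<le> emeasure lebesgue (hilbert_dual_ball D x) * indicator F x"
          using Jle[OF i True, of x] BF[of i n] F(1) by (auto simp: f_def indicator_def)
      qed
      then have "ennreal (3 / 4) * (\<integral>\<^sup>+x\<in>B i n. ennreal (J i n x) \<partial>lebesgue) < \<infinity>"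
        unfolding fint[OF i] using fin by (rule le_less_trans)
      then have fin': "(\<integral>\<^sup>+x\<in>B i n. ennreal (J i n x) \<partial>lebesgue) < \<infinity>"
        by (auto simp: ennreal_mult_less_top)
      show ?thesis
        unfolding E_def J_def
        by (intro conjI; rule emeasure_log_ratio_image_le[OF Bm[OF i] nzB nzB nzB fin'[unfolded J_def]])
          (use nz[OF i] in auto)
    qed (simp add: E_def B_def)
    \<comment> \<open>What the translates of \<open>F\<close> miss is null, and a differentiable map
      between planes keeps null sets null.\<close>
    let ?Z = "\<Phi> i ` (V i - (\<Union>\<gamma>\<in>\<Gamma>. \<rho> \<gamma> ` F))"
    have Z: "negligible ?Z"
    proof (rule negligible_differentiable_image_negligible)
      show "negligible (V i - (\<Union>\<gamma>\<in>\<Gamma>. \<rho> \<gamma> ` F))"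
        by (rule negligible_subset[OF cover]) (use V(2)[OF i] in blast)
      show "\<Phi> i differentiable_on V i - (\<Union>\<gamma>\<in>\<Gamma>. \<rho> \<gamma> ` F)"
        by (rule differentiable_on_subset[OF diff[OF i]]) blast
    qed simp
    have sub: "\<Phi> i ` V i \<subseteq> (\<Union>n. E n) \<union> ?Z"
    proof
      fix w assume "w \<in> \<Phi> i ` V i"
      then obtain y where y: "y \<in> V i" "w = \<Phi> i y" by blast
      show "w \<in> (\<Union>n. E n) \<union> ?Z"
      proof (cases "y \<in> (\<Union>\<gamma>\<in>\<Gamma>. \<rho> \<gamma> ` F)")
        case True
        then obtain \<gamma> x where x: "\<gamma> \<in> \<Gamma>" "x \<in> F" "y = \<rho> \<gamma> x" by blast
        then obtain n where n: "ok n" "g n = \<gamma>" using surj by blast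
        have xB: "x \<in> B i n" using x y n by (simp add: B_def)
        have xD: "x \<in> D" using x F(1) by blast
        obtain c where c: "c \<noteq> 0" "N (g n) *v homogeneous x = c *\<^sub>R (A *v homogeneous y)"
          using \<rho>(3)[OF x(1) xD] n(2) x(3) by blast
        have yD: "y \<in> D" using y V(2)[OF i] by blast
        have "log_ratio (m (l1 i) n) (m (l2 i) n) (m (l3 i) n) (homogeneous x) = w"
          unfolding m_def log_ratio_matrix_vector_mult[symmetric] c(2) y(2) \<Phi>_def
          by (rule log_ratio_scaleR[OF c(1)]) (use nz[OF i yD] in auto)
        then have "w \<in> E n" unfolding E_def using xB by blast
        then show ?thesis by blast
      next
        case False
        then show ?thesis using y by blast
      qed
    qed
    have Em: "range E \<subseteq> sets lebesgue" using E by (auto intro: fmeasurableD)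
    have "emeasure lebesgue (\<Phi> i ` V i) \<le> emeasure lebesgue ((\<Union>n. E n) \<union> ?Z)"
      by (rule emeasure_mono[OF sub]) (use Em Z in \<open>auto simp: negligible_iff_null_sets\<close>)
    also have "\<dots> = emeasure lebesgue (\<Union>n. E n)"
      by (rule emeasure_Un_null_set) (use Em Z in \<open>auto simp: negligible_iff_null_sets\<close>)
    also have "\<dots> \<le> suminf (\<lambda>n. emeasure lebesgue (E n))"
      by (rule emeasure_subadditive_countably[OF Em])
    also have "\<dots> \<le> suminf (\<lambda>n. \<integral>\<^sup>+x\<in>B i n. ennreal (J i n x) \<partial>lebesgue)"
      by (intro suminf_le) (use E in auto)
    finally show ?thesis .
  qed
  have "(\<Sum>i\<in>I. ennreal (3 / 4) * emeasure lebesgue (\<Phi> i ` V i)) \<le>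
      (\<Sum>i\<in>I. ennreal (3 / 4) * (suminf (\<lambda>n. \<integral>\<^sup>+x\<in>B i n. ennreal (J i n x) \<partial>lebesgue)))"
    by (intro sum_mono mult_left_mono piece) auto
  also have "\<dots> = (\<Sum>i\<in>I. suminf (\<lambda>n. \<integral>\<^sup>+x. f i n x \<partial>lebesgue))"
    by (intro sum.cong refl) (simp add: fint ennreal_suminf_cmult)
  also note total
  finally show "(\<Sum>i\<in>I. ennreal (3 / 4) * emeasure lebesgue (\<Phi> i ` V i)) \<le>
      (\<integral>\<^sup>+p\<in>F. emeasure lebesgue (hilbert_dual_ball D p) \<partial>lebesgue)" .
qed

section \<open>Lifted triangles in the chart, and countability of the group\<close>

lemma homeomorphism_aff_chart:
  assumes "convex_chart A \<Omega>" "open \<Omega>"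
  shows "homeomorphism (aff_chart A -` \<Omega>) \<Omega> (aff_chart A) (inv_into UNIV (aff_chart A))"
proof -
  note dom = convex_chart_domain[OF assms]
  have inv: "inv_into UNIV (aff_chart A) (aff_chart A x) = x" for x
    using inj_aff_chart[OF dom(1)] by simp
  have sub: "\<Omega> \<subseteq> range (aff_chart A)" using dom(5) by blast
  have im: "inv_into UNIV (aff_chart A) ` \<Omega> = aff_chart A -` \<Omega>"
    using inv_into_image_cancel[OF inj_aff_chart[OF dom(1)] subset_UNIV, of "aff_chart A -` \<Omega>"]
    by (simp only: dom(5))
  show ?thesis
  proof (rule homeomorphismI)
    show "aff_chart A (inv_into UNIV (aff_chart A) y) = y" if "y \<in> \<Omega>" for y
      using subsetD[OF sub that] by (rule f_inv_into_f)
  qed (simp_all only: inv im dom(5) order_refl continuous_on_aff_chart[OF dom(1)]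
      continuous_on_inv_aff_chart[OF dom(1) sub])
qed

text \<open>\<open>V\<close> is the lifted open triangle in chart coordinates; \<open>p\<close> is
  injective on it because the characteristic map is injective inside. The area bound carries a
  measurability premise, which the unfolding of the area discharges.\<close>

lemma ideal_triangle_piece:
  fixes f :: "real^3 \<Rightarrow> 's::t2_space" and s :: "real^3 \<Rightarrow> 'u::topological_space"
  assumes chart: "convex_chart A \<Omega>" "open \<Omega>" "\<Omega> \<noteq> {}"
    and cov: "covering_space U q (X - P)" and dev: "homeomorphism U \<Omega> dev vde"
    and f: "continuous_on model_triangle f" "f ` triangle_vertices \<subseteq> P" "f ` model_ideal_triangle \<subseteq> X - P"
    and inj: "inj_on f triangle_interior" "\<And>k. inj_on f (triangle_edge k)"
    and sep: "\<And>k. f ` triangle_interior \<inter> f ` triangle_edge k = {}"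
    and edges: "\<And>k l. f ` triangle_edge k = f ` triangle_edge l \<or> f ` triangle_edge k \<inter> f ` triangle_edge l = {}"
    and t: "triangle_triple_ratio U q \<Omega> dev A f t"
  defines "D \<equiv> aff_chart A -` \<Omega>" and "p \<equiv> q \<circ> (vde \<circ> aff_chart A)"
  shows "\<exists>V l1 l2 l3. open V \<and> V \<subseteq> D \<and> p ` V \<subseteq> f ` triangle_interior \<and> inj_on p V \<and>
    (\<forall>x\<in>D. l1 \<bullet> (A *v homogeneous x) \<noteq> 0) \<and> (\<forall>x\<in>D. l2 \<bullet> (A *v homogeneous x) \<noteq> 0) \<and>
    (\<forall>x\<in>D. l3 \<bullet> (A *v homogeneous x) \<noteq> 0) \<and>
    ((\<lambda>x. log_ratio l1 l2 l3 (A *v homogeneous x)) ` V \<in> sets lebesgue \<longrightarrow>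
      ennreal ((pi\<^sup>2 + (ln t)\<^sup>2) / 2) \<le> emeasure lebesgue ((\<lambda>x. log_ratio l1 l2 l3 (A *v homogeneous x)) ` V))"
proof -
  note dom = convex_chart_domain[OF chart(1,2), folded D_def]
  let ?c = "aff_chart A" and ?ci = "inv_into UNIV (aff_chart A)"
  have hD: "homeomorphism D \<Omega> ?c ?ci"
    unfolding D_def by (rule homeomorphism_aff_chart[OF chart(1,2)])
  have hU: "homeomorphism U D (?ci \<circ> dev) (vde \<circ> ?c)"
    by (rule homeomorphism_compose[OF dev homeomorphism_symD[OF hD]])
  have covD: "covering_space D p (X - P)"
    unfolding p_def by (rule covering_space_homeomorphism[OF cov hU])
  obtain s where s: "lift_of U q f s" and tr: "is_triple_ratio A \<Omega> (dev ` s ` model_ideal_triangle) t"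
    using t unfolding triangle_triple_ratio_def by blast
  obtain x1 x2 x3 l1 l2 l3 where it: "ideal_triangle A \<Omega> (dev ` s ` model_ideal_triangle) x1 x2 x3"
    and nz: "\<And>y. ?c y \<in> \<Omega> \<Longrightarrow> l1 \<bullet> (A *v homogeneous y) \<noteq> 0"
    "\<And>y. ?c y \<in> \<Omega> \<Longrightarrow> l2 \<bullet> (A *v homogeneous y) \<noteq> 0"
    "\<And>y. ?c y \<in> \<Omega> \<Longrightarrow> l3 \<bullet> (A *v homogeneous y) \<noteq> 0"
    and l: "l1 \<bullet> (A *v homogeneous x1) = 0" "l2 \<bullet> (A *v homogeneous x2) = 0" "l3 \<bullet> (A *v homogeneous x3) = 0"
    "l1 \<bullet> (A *v homogeneous x2) \<noteq> 0" "l1 \<bullet> (A *v homogeneous x3) \<noteq> 0" "l2 \<bullet> (A *v homogeneous x1) \<noteq> 0"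
    "l2 \<bullet> (A *v homogeneous x3) \<noteq> 0" "l3 \<bullet> (A *v homogeneous x1) \<noteq> 0" "l3 \<bullet> (A *v homogeneous x2) \<noteq> 0"
    and teq: "t = ((l1 \<bullet> (A *v homogeneous x2)) / (l3 \<bullet> (A *v homogeneous x2))) *
      ((l3 \<bullet> (A *v homogeneous x1)) / (l2 \<bullet> (A *v homogeneous x1))) *
      ((l2 \<bullet> (A *v homogeneous x3)) / (l1 \<bullet> (A *v homogeneous x3)))"
    using triple_ratio_covectors[OF dom(1) tr] by metis
  have nzD: "\<forall>x\<in>D. l1 \<bullet> (A *v homogeneous x) \<noteq> 0" "\<forall>x\<in>D. l2 \<bullet> (A *v homogeneous x) \<noteq> 0"
    "\<forall>x\<in>D. l3 \<bullet> (A *v homogeneous x) \<noteq> 0"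
    using nz by (auto simp: D_def)
  define G where "G = (?ci \<circ> dev) \<circ> s"
  have sU: "s ` model_ideal_triangle \<subseteq> U" and sc: "continuous_on model_ideal_triangle s"
    and sq: "\<And>z. z \<in> model_ideal_triangle \<Longrightarrow> q (s z) = f z"
    using s by (auto simp: lift_of_def)
  have G: "continuous_on model_ideal_triangle G" "G ` model_ideal_triangle \<subseteq> D"
    "\<And>z. z \<in> model_ideal_triangle \<Longrightarrow> p (G z) = f z"
  proof -
    show "continuous_on model_ideal_triangle G"
      unfolding G_def by (rule continuous_on_compose[OF sc continuous_on_subset[OF homeomorphism_cont1[OF hU] sU]])
    show "G ` model_ideal_triangle \<subseteq> D"
      unfolding G_def image_comp[symmetric, of "?ci \<circ> dev"]
      using image_mono[OF sU, of "?ci \<circ> dev"] homeomorphism_image1[OF hU] by simp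
    show "p (G z) = f z" if z: "z \<in> model_ideal_triangle" for z
    proof -
      have "(vde \<circ> ?c) ((?ci \<circ> dev) (s z)) = s z"
        by (rule homeomorphism_apply1[OF hU]) (use sU z in blast)
      then show ?thesis using sq[OF z] by (simp add: p_def G_def)
    qed
  qed
  have im: "G ` model_ideal_triangle = convex hull {x1, x2, x3} - {x1, x2, x3}"
  proof -
    have "G ` model_ideal_triangle = ?ci ` (dev ` s ` model_ideal_triangle)"
      by (simp add: G_def image_comp)
    also have "dev ` s ` model_ideal_triangle = ?c ` (convex hull {x1, x2, x3} - {x1, x2, x3})"
      using it unfolding ideal_triangle_def by blast
    also have "?ci ` \<dots> = convex hull {x1, x2, x3} - {x1, x2, x3}"
      by (rule inv_into_image_cancel[OF inj_aff_chart[OF dom(1)]]) simp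
    finally show ?thesis .
  qed
  let ?V = "G ` triangle_interior"
  note V = lifted_triangle_covers[OF covD f inj sep edges G ideal_triangle_det[OF it] im]
  have VD: "?V \<subseteq> D"
    using G(2) image_mono[OF triangle_interior_subset, of G] by (rule order_trans[rotated])
  have pG: "p (G z) = f z" if "z \<in> triangle_interior" for z
    by (rule G(3)[OF subsetD[OF triangle_interior_subset that]])
  have pV: "p ` ?V \<subseteq> f ` triangle_interior"
    using pG by auto
  have injp: "inj_on p ?V"
  proof (rule inj_onI)
    fix y y' assume y: "y \<in> ?V" "y' \<in> ?V" "p y = p y'"
    then obtain z w where zw: "z \<in> triangle_interior" "y = G z" "w \<in> triangle_interior" "y' = G w" by blast
    then have "f z = f w" using y(3) pG by simp
    then have "z = w" using inj_onD[OF inj(1)] zw by blast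
    then show "y = y'" using zw by simp
  qed
  have front: "{x1, x2, x3} \<subseteq> closure D"
    using it unfolding ideal_triangle_def frontier_def D_def by blast
  have Dne: "D \<noteq> {}" using dom(5) chart(3) by blast
  have area: "ennreal ((pi\<^sup>2 + (ln t)\<^sup>2) / 2) \<le> emeasure lebesgue ((\<lambda>x. log_ratio l1 l2 l3 (A *v homogeneous x)) ` ?V)"
    if "(\<lambda>x. log_ratio l1 l2 l3 (A *v homogeneous x)) ` ?V \<in> sets lebesgue"
    by (rule emeasure_log_ratio_triangle_ge[OF dom(3) Dne front nzD[rule_format] l teq V(2) that])
  show ?thesis
    by (intro exI[of _ ?V] exI[of _ l1] exI[of _ l2] exI[of _ l3] conjI impI V(1) VD pV injp nzD area)
qed

text \<open>Exhaust \<open>D\<close> by countably many compact sets and add \<open>x0\<close> to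
  each. Every group element moves \<open>x0\<close> into one of them, and each compact set accounts
  for finitely many elements.\<close>

lemma countable_properly_discontinuous:
  assumes D: "open D" "x0 \<in> D"
    and act: "\<And>\<gamma>. \<gamma> \<in> \<Gamma> \<Longrightarrow> \<rho> \<gamma> x0 \<in> (D :: 'a::euclidean_space set)"
    and fin: "\<And>K. compact K \<Longrightarrow> K \<subseteq> D \<Longrightarrow> finite {\<gamma> \<in> \<Gamma>. \<rho> \<gamma> ` K \<inter> K \<noteq> {}}"
  shows "countable \<Gamma>"
proof -
  obtain C :: "nat \<Rightarrow> 'a set" where C: "\<And>n. compact (C n)" "\<And>n. C n \<subseteq> D" "\<Union> (range C) = D"
    using open_Union_compact_subsets[OF D(1)] by metis
  let ?K = "\<lambda>n. insert x0 (C n)"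
  have "\<Gamma> \<subseteq> (\<Union>n. {\<gamma> \<in> \<Gamma>. \<rho> \<gamma> ` ?K n \<inter> ?K n \<noteq> {}})"
  proof
    fix \<gamma> assume "\<gamma> \<in> \<Gamma>"
    then have "\<rho> \<gamma> x0 \<in> \<Union> (range C)" unfolding C(3) by (rule act)
    then obtain n where "\<rho> \<gamma> x0 \<in> C n" by blast
    then show "\<gamma> \<in> (\<Union>n. {\<gamma> \<in> \<Gamma>. \<rho> \<gamma> ` ?K n \<inter> ?K n \<noteq> {}})" using \<open>\<gamma> \<in> \<Gamma>\<close> by blast
  qed
  moreover have "finite {\<gamma> \<in> \<Gamma>. \<rho> \<gamma> ` ?K n \<inter> ?K n \<noteq> {}}" for n
    by (rule fin) (use C D in \<open>auto intro: compact_insert\<close>)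
  then have "countable (\<Union>n. {\<gamma> \<in> \<Gamma>. \<rho> \<gamma> ` ?K n \<inter> ?K n \<noteq> {}})"
    by (intro countable_UN) (auto intro: countable_finite)
  ultimately show ?thesis by (rule countable_subset)
qed

theorem corollary1p8:
  fixes S X P :: "'s::t2_space set"
    and U :: "'u::topological_space set"
    and q :: "'u \<Rightarrow> 's"
    and \<Omega> :: "rp2 set"
    and hol :: "('u \<Rightarrow> 'u) \<Rightarrow> (real^3^3) set"
    and dev :: "'u \<Rightarrow> rp2"
    and A :: "real^3^3"
    and F :: "rp2 set"
    and chi :: int
    and \<tau> :: "nat \<Rightarrow> real^3 \<Rightarrow> 's"
    and h :: "'s \<Rightarrow> 's"
    and t :: "nat \<Rightarrow> real"
  assumes "punctured_surface S X P"
    and "chi = euler_char (top_of_set S)" and "chi < 0"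
    and "ideal_triangulation X P {1..nat (-2 * chi)} \<tau>"
    and "universal_cover U q S"
    and "marked_convex_projective_structure U q \<Omega> hol dev"
    and "convex_chart A \<Omega>"
    and "fundamental_domain U q \<Omega> hol A F"
    and "HT_area A \<Omega> F < \<infinity>"
    and "straightening X P U q \<Omega> dev A {1..nat (-2 * chi)} \<tau> h"
    and "\<And>i. i \<in> {1..nat (-2 * chi)} \<Longrightarrow> triangle_triple_ratio U q \<Omega> dev A (h \<circ> \<tau> i) (t i)"
  shows "enn2real (HT_area A \<Omega> F) \<ge>
           3 / 8 * (-2 * pi * real_of_int chi) +
           3 / (8 * pi) * (\<Sum>i = 1..nat (-2 * chi). (ln (t i))\<^sup>2)"
proof -
  let ?n = "nat (-2 * chi)"
  let ?I = "{1..?n}"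
  let ?c = "aff_chart A" and ?ci = "inv_into UNIV (aff_chart A)"
  let ?\<Gamma> = "carrier (deck_group U q)"
  define D where "D = ?c -` \<Omega>"
  have S: "S = X - P" and PX: "P \<subseteq> X"
    using assms(1) by (auto simp: punctured_surface_def)
  have \<Omega>: "open \<Omega>" "\<Omega> \<noteq> {}"
    and holhom: "hol \<in> hom (deck_group U q) PGL3"
    and pd: "\<And>K. K \<subseteq> \<Omega> \<Longrightarrow> compact K \<Longrightarrow> finite {\<gamma> \<in> ?\<Gamma>. pgl_act (hol \<gamma>) ` K \<inter> K \<noteq> {}}"
    and equiv: "\<And>\<gamma> u. \<gamma> \<in> ?\<Gamma> \<Longrightarrow> u \<in> U \<Longrightarrow> dev (\<gamma> u) = pgl_act (hol \<gamma>) (dev u)"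
    using assms(6) unfolding marked_convex_projective_structure_def properly_convex_def
    by simp_all
  have hol: "hol \<gamma> \<in> carrier PGL3" if "\<gamma> \<in> ?\<Gamma>" for \<gamma>
    using holhom that by (auto simp: hom_def)
  obtain vde where dev: "homeomorphism U \<Omega> dev vde"
    using assms(6) unfolding marked_convex_projective_structure_def by blast
  have cov: "covering_space U q (X - P)"
    using assms(5) unfolding universal_cover_def S by blast
  note dom = convex_chart_domain[OF assms(7) \<Omega>(1), folded D_def]
  have hD: "homeomorphism D \<Omega> ?c ?ci"
    unfolding D_def by (rule homeomorphism_aff_chart[OF assms(7) \<Omega>(1)])
  define d where "d = ?ci \<circ> dev"
  define e where "e = vde \<circ> ?c"
  have hU: "homeomorphism U D d e"
    unfolding d_def e_def by (rule homeomorphism_compose[OF dev homeomorphism_symD[OF hD]])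
  define p where "p = q \<circ> e"
  have covD: "covering_space D p (X - P)"
    unfolding p_def by (rule covering_space_homeomorphism[OF cov hU])
  have eU: "e x \<in> U" if "x \<in> D" for x
    using homeomorphism_image2[OF hU] that by blast
  have de: "dev (e x) = ?c x" if "x \<in> D" for x
    unfolding e_def comp_def by (rule homeomorphism_apply2[OF dev]) (use that in \<open>simp add: D_def\<close>)

  \<comment> \<open>Deck transformations in chart coordinates\<close>
  have deckU: "\<gamma> u \<in> U" "q (\<gamma> u) = q u" if "\<gamma> \<in> ?\<Gamma>" "u \<in> U" for \<gamma> u
    using that by (auto simp: deck_group_def Bij_def bij_betw_def)
  have deckc: "continuous_on U \<gamma>" if "\<gamma> \<in> ?\<Gamma>" for \<gamma>
    using that by (auto simp: deck_group_def homeomorphism_def)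
  \<comment> \<open>The holonomy read in the chart. Through \<open>dev\<close> it is conjugate to
    the deck transformation, which makes it continuous and compatible with \<open>p\<close>.\<close>
  define \<rho> where "\<rho> \<gamma> x = ?ci (pgl_act (hol \<gamma>) (?c x))" for \<gamma> x
  have \<rho>d: "\<rho> \<gamma> x = d (\<gamma> (e x))" if "\<gamma> \<in> ?\<Gamma>" "x \<in> D" for \<gamma> x
    using equiv[OF that(1) eU[OF that(2)]] de[OF that(2)] by (simp add: \<rho>_def d_def)
  have \<rho>D: "\<rho> \<gamma> x \<in> D" if "\<gamma> \<in> ?\<Gamma>" "x \<in> D" for \<gamma> x
    unfolding \<rho>d[OF that] using homeomorphism_image1[OF hU] deckU(1)[OF that(1) eU[OF that(2)]] by blast
  have p\<rho>: "p (\<rho> \<gamma> x) = p x" if "\<gamma> \<in> ?\<Gamma>" "x \<in> D" for \<gamma> x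
    unfolding \<rho>d[OF that] p_def comp_def
    using homeomorphism_apply1[OF hU deckU(1)[OF that(1) eU[OF that(2)]]] deckU(2)[OF that(1) eU[OF that(2)]]
    by simp
  have act\<Omega>: "pgl_act (hol \<gamma>) (?c x) \<in> \<Omega>" if "\<gamma> \<in> ?\<Gamma>" "x \<in> D" for \<gamma> x
    using equiv[OF that(1) eU[OF that(2)]] de[OF that(2)] homeomorphism_image1[OF dev]
      deckU(1)[OF that(1) eU[OF that(2)]] by (metis image_eqI)
  have c\<rho>: "?c (\<rho> \<gamma> x) = pgl_act (hol \<gamma>) (?c x)" if "\<gamma> \<in> ?\<Gamma>" "x \<in> D" for \<gamma> x
    unfolding \<rho>_def by (rule homeomorphism_apply2[OF hD act\<Omega>[OF that]])
  have \<rho>c: "continuous_on D (\<rho> \<gamma>)" if "\<gamma> \<in> ?\<Gamma>" for \<gamma>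
  proof -
    have "continuous_on D (d \<circ> (\<gamma> \<circ> e))"
    proof (intro continuous_on_compose)
      have im: "e ` D = U" by (rule homeomorphism_image2[OF hU])
      show "continuous_on D e" by (rule homeomorphism_cont2[OF hU])
      show "continuous_on (e ` D) \<gamma>" unfolding im by (rule deckc[OF that])
      show "continuous_on ((\<gamma> \<circ> e) ` D) d"
        unfolding image_comp[symmetric] im
        by (rule continuous_on_subset[OF homeomorphism_cont1[OF hU]]) (use deckU(1)[OF that] in blast)
    qed
    then show ?thesis
      by (rule continuous_on_eq) (use \<rho>d[OF that] in simp)
  qed
  have "\<forall>\<gamma>\<in>?\<Gamma>. \<exists>M. invertible M \<and> (\<forall>v. v \<noteq> 0 \<longrightarrow> pgl_act (hol \<gamma>) (proj_pt v) = proj_pt (M *v v))"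
    using pgl_act_matrix[OF hol] by metis
  then obtain M where M: "\<And>\<gamma>. \<gamma> \<in> ?\<Gamma> \<Longrightarrow> invertible (M \<gamma>)"
    "\<And>\<gamma> v. \<gamma> \<in> ?\<Gamma> \<Longrightarrow> v \<noteq> 0 \<Longrightarrow> pgl_act (hol \<gamma>) (proj_pt v) = proj_pt (M \<gamma> *v v)"
    by metis
  note nzA = invertible_mult_nonzero[OF dom(1) homogeneous_nonzero]
  have \<rho>N: "\<exists>k. k \<noteq> 0 \<and> (M \<gamma> ** A) *v homogeneous x = k *\<^sub>R (A *v homogeneous (\<rho> \<gamma> x))"
    if "\<gamma> \<in> ?\<Gamma>" "x \<in> D" for \<gamma> x
  proof -
    have nz: "M \<gamma> *v (A *v homogeneous x) \<noteq> 0" by (rule invertible_mult_nonzero[OF M(1)[OF that(1)] nzA])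
    have "proj_pt (A *v homogeneous (\<rho> \<gamma> x)) = proj_pt (M \<gamma> *v (A *v homogeneous x))"
      using c\<rho>[OF that] M(2)[OF that(1) nzA] by (simp add: aff_chart_eq)
    then obtain k where k: "M \<gamma> *v (A *v homogeneous x) = k *\<^sub>R (A *v homogeneous (\<rho> \<gamma> x))"
      using proj_pt_eq_iff[OF nzA nz] by blast
    then have "k \<noteq> 0" using nz by auto
    then show ?thesis using k by (auto simp: matrix_vector_mul_assoc)
  qed
  \<comment> \<open>Both maps are lifts of \<open>p\<close>, so agreement at one point spreads over
    the connected set \<open>D\<close>. Equality as functions then follows because elements of
    \<open>Bij U\<close> are extensional: off \<open>U\<close> they share the default value.\<close>
  have \<rho>inj: "\<gamma> = \<delta>" if g: "\<gamma> \<in> ?\<Gamma>" "\<delta> \<in> ?\<Gamma>" and x: "x \<in> D" "\<rho> \<gamma> x = \<rho> \<delta> x" for \<gamma> \<delta> x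
  proof -
    have eq: "\<rho> \<gamma> y = \<rho> \<delta> y" if "y \<in> D" for y
    proof (rule covering_space_lift_unique[OF covD x(2) _ _ \<rho>c[OF g(1)] _ _ \<rho>c[OF g(2)] _ _ _ x(1) that])
      show "continuous_on D p" by (rule covering_space_imp_continuous[OF covD])
      show "p \<in> D \<rightarrow> X - P" using covering_space_imp_surjective[OF covD] by blast
      show "connected D" by (rule convex_connected[OF dom(3)])
    qed (use \<rho>D p\<rho> g in auto)
    have "\<gamma> u = \<delta> u" if u: "u \<in> U" for u
    proof -
      have du: "d u \<in> D" "e (d u) = u"
        using homeomorphism_image1[OF hU] homeomorphism_apply1[OF hU u] u by blast+
      have "d (\<gamma> u) = d (\<delta> u)"
        using eq[OF du(1)] \<rho>d[OF g(1) du(1)] \<rho>d[OF g(2) du(1)] du(2) by simp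
      then show ?thesis
        by (metis homeomorphism_apply1[OF hU] deckU(1)[OF g(1) u] deckU(1)[OF g(2) u])
    qed
    moreover have "\<gamma> \<in> extensional U" "\<delta> \<in> extensional U"
      using g by (auto simp: deck_group_def Bij_def)
    ultimately show ?thesis by (intro extensionalityI) auto
  qed

  obtain x0 where x0: "x0 \<in> D" using dom(5) \<Omega>(2) by blast
  have count: "countable ?\<Gamma>"
  proof (rule countable_properly_discontinuous[OF dom(2) x0, of _ \<rho>])
    fix K :: "(real^2) set" assume K: "compact K" "K \<subseteq> D"
    have cK: "?c ` K \<subseteq> \<Omega>" using K(2) by (auto simp: D_def)
    have "compact (?c ` K)" by (rule compact_continuous_image[OF continuous_on_aff_chart[OF dom(1)] K(1)])
    from pd[OF cK this] show "finite {\<gamma> \<in> ?\<Gamma>. \<rho> \<gamma> ` K \<inter> K \<noteq> {}}"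
    proof (rule finite_subset[rotated], intro subsetI CollectI conjI)
      fix \<gamma> assume "\<gamma> \<in> {\<gamma> \<in> ?\<Gamma>. \<rho> \<gamma> ` K \<inter> K \<noteq> {}}"
      then obtain x where x: "\<gamma> \<in> ?\<Gamma>" "x \<in> K" "\<rho> \<gamma> x \<in> K" by blast
      then have "pgl_act (hol \<gamma>) (?c x) \<in> ?c ` K" using c\<rho>[OF x(1), of x] K(2) by (metis imageI subsetD)
      then show "pgl_act (hol \<gamma>) ` ?c ` K \<inter> ?c ` K \<noteq> {}" using x(2) by blast
    qed simp
  qed (rule \<rho>D[OF _ x0])

  \<comment> \<open>The fundamental domain in the chart\<close>
  define F' where "F' = ?c -` F"
  have F\<Omega>: "F \<subseteq> \<Omega>" and F': "F' \<in> sets lebesgue"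
    and negl: "negligible (?c -` (\<Omega> - (\<Union>\<gamma>\<in>?\<Gamma>. pgl_act (hol \<gamma>) ` F)))"
    using assms(8) unfolding fundamental_domain_def F'_def by blast+
  have F'D: "F' \<subseteq> D" using F\<Omega> by (auto simp: F'_def D_def)
  have cover: "negligible (D - (\<Union>\<gamma>\<in>?\<Gamma>. \<rho> \<gamma> ` F'))"
  proof (rule negligible_subset[OF negl], rule subsetI)
    fix x assume x: "x \<in> D - (\<Union>\<gamma>\<in>?\<Gamma>. \<rho> \<gamma> ` F')"
    have "?c x \<notin> pgl_act (hol \<gamma>) ` F" if g: "\<gamma> \<in> ?\<Gamma>" for \<gamma>
    proof
      assume "?c x \<in> pgl_act (hol \<gamma>) ` F"
      then obtain y where y: "y \<in> F" "?c x = pgl_act (hol \<gamma>) y" by blast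
      have cy: "?c (?ci y) = y" by (rule homeomorphism_apply2[OF hD]) (use y F\<Omega> in blast)
      then have "?ci y \<in> F'" using y by (simp add: F'_def)
      moreover have "x = \<rho> \<gamma> (?ci y)"
        using y(2) homeomorphism_apply1[OF hD, of x] x by (simp add: \<rho>_def cy)
      ultimately show False using x g by blast
    qed
    then show "x \<in> ?c -` (\<Omega> - (\<Union>\<gamma>\<in>?\<Gamma>. pgl_act (hol \<gamma>) ` F))" using x by (auto simp: D_def)
  qed
  let ?int = "\<integral>\<^sup>+x\<in>F'. emeasure lebesgue (hilbert_dual_ball D x) \<partial>lebesgue"
  have HT: "HT_area A \<Omega> F = ennreal (1 / pi) * ?int"
    by (simp add: HT_area_def holmes_thompson_def D_def F'_def)
  have fin: "?int < \<infinity>"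
    using assms(9) unfolding HT by (auto simp: ennreal_mult_less_top)

  \<comment> \<open>At time 1 the isotopy shows that \<open>h\<close> is a homeomorphism of
    \<open>X\<close> fixing the punctures, so the maps h \<circ> \<tau> i inherit the properties of
    characteristic maps.\<close>
  obtain H g where H: "\<And>x. x \<in> X \<Longrightarrow> H (1::real, x) = h x" "homeomorphism X X (\<lambda>x. H (1, x)) g"
    "\<And>x. x \<in> P \<Longrightarrow> H (1, x) = x"
  proof -
    obtain H :: "real \<times> 's \<Rightarrow> 's" where H: "\<forall>s\<in>{0..1}. (\<exists>g. homeomorphism X X (\<lambda>x. H (s, x)) g) \<and> (\<forall>x\<in>P. H (s, x) = x)"
      "\<forall>x\<in>X. H (0, x) = x \<and> H (1, x) = h x"
      using assms(10) unfolding straightening_def isotopic_to_id_rel_def by blast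
    moreover have "(1::real) \<in> {0..1}" by simp
    ultimately obtain g where "homeomorphism X X (\<lambda>x. H (1, x)) g" "\<forall>x\<in>P. H (1, x) = x" by blast
    then show thesis using that[of H g] H(2) by blast
  qed
  have hP: "h x = x" if "x \<in> P" for x using H(1)[of x] H(3)[OF that] PX that by auto
  have hh: "homeomorphism X X h g"
    by (rule homeomorphism_cong[OF H(2)]) (use H(1) in auto)
  have hc: "continuous_on X h" and hX: "h ` X = X"
    using hh by (auto simp: homeomorphism_def)
  have hinj: "inj_on h X" by (rule inj_on_inverseI, erule homeomorphism_apply1[OF hh])

  have T: "\<forall>i\<in>?I. continuous_on model_triangle (\<tau> i) \<and> \<tau> i ` triangle_vertices \<subseteq> P \<and>
      \<tau> i ` model_ideal_triangle \<subseteq> X - P"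
    "\<forall>i\<in>?I. \<forall>k. inj_on (\<tau> i) (triangle_edge k)"
    "\<forall>i\<in>?I. \<forall>j\<in>?I. \<forall>k. \<tau> i ` triangle_interior \<inter> \<tau> j ` triangle_edge k = {}"
    "\<forall>i\<in>?I. \<forall>j\<in>?I. \<forall>k l. \<tau> i ` triangle_edge k = \<tau> j ` triangle_edge l \<or>
        \<tau> i ` triangle_edge k \<inter> \<tau> j ` triangle_edge l = {}"
    and triinj: "inj_on (\<lambda>(i, z). \<tau> i z) (?I \<times> triangle_interior)"
    using assms(4) unfolding ideal_triangulation_def by - (elim conjE, assumption)+
  have tri: "continuous_on model_triangle (\<tau> i)" "\<tau> i ` triangle_vertices \<subseteq> P" "\<tau> i ` model_ideal_triangle \<subseteq> X - P"
    "\<And>k. inj_on (\<tau> i) (triangle_edge k)"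
    "\<And>k. \<tau> i ` triangle_interior \<inter> \<tau> i ` triangle_edge k = {}"
    "\<And>k l. \<tau> i ` triangle_edge k = \<tau> i ` triangle_edge l \<or> \<tau> i ` triangle_edge k \<inter> \<tau> i ` triangle_edge l = {}"
    if "i \<in> ?I" for i
    using T(1)[rule_format, OF that] T(2)[rule_format, OF that] T(3)[rule_format, OF that that]
      T(4)[rule_format, OF that that] by - (elim conjE, assumption)+
  have triX: "\<tau> i ` model_triangle \<subseteq> X" if "i \<in> ?I" for i
  proof -
    have "model_triangle \<subseteq> model_ideal_triangle \<union> triangle_vertices" by (auto simp: model_ideal_triangle_def)
    then show ?thesis using tri(2,3)[OF that] PX by blast
  qed
  have subX: "\<tau> i ` Y \<subseteq> X" if "i \<in> ?I" "Y \<subseteq> model_ideal_triangle" for i Y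
    using tri(3)[OF that(1)] that(2) by blast

  define Q where "Q i V l1 l2 l3 \<longleftrightarrow> open V \<and> V \<subseteq> D \<and> p ` V \<subseteq> (h \<circ> \<tau> i) ` triangle_interior \<and> inj_on p V \<and>
    (\<forall>x\<in>D. l1 \<bullet> (A *v homogeneous x) \<noteq> 0) \<and> (\<forall>x\<in>D. l2 \<bullet> (A *v homogeneous x) \<noteq> 0) \<and>
    (\<forall>x\<in>D. l3 \<bullet> (A *v homogeneous x) \<noteq> 0) \<and>
    ((\<lambda>x. log_ratio l1 l2 l3 (A *v homogeneous x)) ` V \<in> sets lebesgue \<longrightarrow>
      ennreal ((pi\<^sup>2 + (ln (t i))\<^sup>2) / 2) \<le> emeasure lebesgue ((\<lambda>x. log_ratio l1 l2 l3 (A *v homogeneous x)) ` V))" for i V l1 l2 l3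
  have "\<exists>V l1 l2 l3. Q i V l1 l2 l3"
    if i: "i \<in> ?I" for i
    unfolding Q_def D_def p_def e_def
  proof (rule ideal_triangle_piece[OF assms(7) \<Omega> cov dev _ _ _ _ _ _ _ assms(11)[OF i]])
    note subi = subX[OF i triangle_interior_subset] and sube = subX[OF i triangle_edge_subset]
    show "continuous_on model_triangle (h \<circ> \<tau> i)"
      by (rule continuous_on_compose[OF tri(1)[OF i] continuous_on_subset[OF hc triX[OF i]]])
    show "(h \<circ> \<tau> i) ` triangle_vertices \<subseteq> P"
      using tri(2)[OF i] hP by auto
    show "(h \<circ> \<tau> i) ` model_ideal_triangle \<subseteq> X - P"
    proof
      fix y assume "y \<in> (h \<circ> \<tau> i) ` model_ideal_triangle"
      then obtain z where z: "z \<in> model_ideal_triangle" "y = h (\<tau> i z)" by auto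
      then have \<tau>z: "\<tau> i z \<in> X" "\<tau> i z \<notin> P" using tri(3)[OF i] by blast+
      have "y \<notin> P"
      proof
        assume "y \<in> P"
        then have "h y = h (\<tau> i z)" using hP z(2) by simp
        then have "y = \<tau> i z" using inj_onD[OF hinj] \<open>y \<in> P\<close> PX \<tau>z(1) by blast
        then show False using \<tau>z(2) \<open>y \<in> P\<close> by simp
      qed
      then show "y \<in> X - P" using hX \<tau>z(1) z(2) by blast
    qed
    show "inj_on (h \<circ> \<tau> i) triangle_interior"
    proof (rule comp_inj_on[OF _ inj_on_subset[OF hinj subi]])
      show "inj_on (\<tau> i) triangle_interior"
        using triinj i by (auto simp: inj_on_def)
    qed
    show "inj_on (h \<circ> \<tau> i) (triangle_edge k)" for k
      by (rule comp_inj_on[OF tri(4)[OF i] inj_on_subset[OF hinj sube]])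
    show "(h \<circ> \<tau> i) ` triangle_interior \<inter> (h \<circ> \<tau> i) ` triangle_edge k = {}" for k
      unfolding image_comp[symmetric] inj_on_image_Int[OF hinj subi sube, symmetric] tri(5)[OF i] by simp
    show "(h \<circ> \<tau> i) ` triangle_edge k = (h \<circ> \<tau> i) ` triangle_edge l \<or>
        (h \<circ> \<tau> i) ` triangle_edge k \<inter> (h \<circ> \<tau> i) ` triangle_edge l = {}" for k l
      unfolding image_comp[symmetric] inj_on_image_Int[OF hinj sube sube, symmetric]
      using tri(6)[OF i, of k l] by auto
  qed
  then obtain V l1 l2 l3 where Q: "\<And>i. i \<in> ?I \<Longrightarrow> Q i (V i) (l1 i) (l2 i) (l3 i)" by metis
  have V: "\<And>i. i \<in> ?I \<Longrightarrow> open (V i)" "\<And>i. i \<in> ?I \<Longrightarrow> V i \<subseteq> D"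
    "\<And>i. i \<in> ?I \<Longrightarrow> p ` V i \<subseteq> (h \<circ> \<tau> i) ` triangle_interior" "\<And>i. i \<in> ?I \<Longrightarrow> inj_on p (V i)"
    and nz: "\<And>i x. i \<in> ?I \<Longrightarrow> x \<in> D \<Longrightarrow> l1 i \<bullet> (A *v homogeneous x) \<noteq> 0"
      "\<And>i x. i \<in> ?I \<Longrightarrow> x \<in> D \<Longrightarrow> l2 i \<bullet> (A *v homogeneous x) \<noteq> 0"
      "\<And>i x. i \<in> ?I \<Longrightarrow> x \<in> D \<Longrightarrow> l3 i \<bullet> (A *v homogeneous x) \<noteq> 0"
    and area: "\<And>i. i \<in> ?I \<Longrightarrow> (\<lambda>x. log_ratio (l1 i) (l2 i) (l3 i) (A *v homogeneous x)) ` V i \<in> sets lebesgue \<Longrightarrow>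
      ennreal ((pi\<^sup>2 + (ln (t i))\<^sup>2) / 2) \<le>
        emeasure lebesgue ((\<lambda>x. log_ratio (l1 i) (l2 i) (l3 i) (A *v homogeneous x)) ` V i)"
    using Q unfolding Q_def by simp_all
  \<comment> \<open>Two translates of \<open>x\<close> have the same image in the surface. Interiors
    of distinct triangles are disjoint, so \<open>i = j\<close>; then \<open>p\<close> is injective
    on \<open>V i\<close>, and the action is free.\<close>
  have uniq: "i = j \<and> \<gamma> = \<delta>"
    if ij: "i \<in> ?I" "j \<in> ?I" and g: "\<gamma> \<in> ?\<Gamma>" "\<delta> \<in> ?\<Gamma>" and x: "x \<in> D" "\<rho> \<gamma> x \<in> V i" "\<rho> \<delta> x \<in> V j"
    for i j \<gamma> \<delta> x
  proof -
    have pp: "p (\<rho> \<gamma> x) = p (\<rho> \<delta> x)" using p\<rho>[OF g(1) x(1)] p\<rho>[OF g(2) x(1)] by simp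
    obtain z where z: "z \<in> triangle_interior" "p (\<rho> \<gamma> x) = h (\<tau> i z)"
      using V(3)[OF ij(1)] x(2) by (auto simp: image_subset_iff)
    obtain w where w: "w \<in> triangle_interior" "p (\<rho> \<delta> x) = h (\<tau> j w)"
      using V(3)[OF ij(2)] x(3) by (auto simp: image_subset_iff)
    have "\<tau> i z \<in> X" "\<tau> j w \<in> X"
      using subX[OF ij(1) triangle_interior_subset] subX[OF ij(2) triangle_interior_subset] z(1) w(1) by blast+
    then have "\<tau> i z = \<tau> j w" using inj_onD[OF hinj] z(2) w(2) pp by simp
    then have "i = j" using inj_onD[OF triinj, of "(i, z)" "(j, w)"] ij z(1) w(1) by simp
    then have "\<rho> \<gamma> x = \<rho> \<delta> x" using inj_onD[OF V(4)[OF ij(1)] pp] x by simp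
    then show ?thesis using \<rho>inj[OF g x(1)] \<open>i = j\<close> by blast
  qed
  note unfold = area_unfolding[OF dom(2-4) finite_atLeastAtMost count F'D F' \<rho>D \<rho>c \<rho>N V(1,2) nz uniq cover fin]
  have "ennreal (\<Sum>i\<in>?I. 3 / 8 * (pi\<^sup>2 + (ln (t i))\<^sup>2)) = (\<Sum>i\<in>?I. ennreal (3 / 4) * ennreal ((pi\<^sup>2 + (ln (t i))\<^sup>2) / 2))"
    by (subst sum_ennreal[symmetric]) (auto simp: ennreal_mult[symmetric] field_simps intro!: sum.cong)
  also have "\<dots> \<le> (\<Sum>i\<in>?I. ennreal (3 / 4) *
      emeasure lebesgue ((\<lambda>x. log_ratio (l1 i) (l2 i) (l3 i) (A *v homogeneous x)) ` V i))"
    by (intro sum_mono mult_left_mono area unfold(1)) auto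
  also have "\<dots> \<le> ?int" by (rule unfold(2))
  \<comment> \<open>Finiteness of the area is essential here, since \<open>enn2real\<close> sends
    \<infinity> to 0.\<close>
  finally have "enn2real (ennreal (\<Sum>i\<in>?I. 3 / 8 * (pi\<^sup>2 + (ln (t i))\<^sup>2))) \<le> enn2real ?int"
    using fin by (intro enn2real_mono) simp_all
  then have "(\<Sum>i\<in>?I. 3 / 8 * (pi\<^sup>2 + (ln (t i))\<^sup>2)) \<le> enn2real ?int"
    by (subst (asm) enn2real_ennreal) (auto intro: sum_nonneg)
  \<comment> \<open>Each triangle contributes 3 / 4 of (pi^2 + ln^2 t) / 2, divided by pi. The pi^2
    parts of the -2 chi triangles add up to the first summand of the bound.\<close>
  then have "(1 / pi) * (\<Sum>i\<in>?I. 3 / 8 * (pi\<^sup>2 + (ln (t i))\<^sup>2)) \<le> (1 / pi) * enn2real ?int"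
    by (intro mult_left_mono) auto
  also have "\<dots> = enn2real (HT_area A \<Omega> F)" by (simp add: HT enn2real_mult)
  also have "(\<Sum>i\<in>?I. 3 / 8 * (pi\<^sup>2 + (ln (t i))\<^sup>2)) = 3 / 8 * (real ?n * pi\<^sup>2 + (\<Sum>i\<in>?I. (ln (t i))\<^sup>2))"
    by (simp only: sum_distrib_left[symmetric] sum.distrib sum_constant card_atLeastAtMost) simp
  also have "real ?n = -2 * real_of_int chi" using assms(3) by simp
  finally show ?thesis by (simp add: power2_eq_square[of pi] field_simps)
qed

end
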